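(* Let $G$ be a dihedral group of order $2n$, where $n\ge 3$ is odd. Then $\omega(G)=\mathsf D(G)=2n$.
   Context: Let $G$ be a finite group, written multiplicatively, with identity $1_G$. A sequence over $G$ is an element of the free abelian monoid $\mathcal F(G)$ with basis $G$ (a finite unordered list of elements of $G$, repetition allowed); the operation of $\mathcal F(G)$ is concatenation, and $|S|$ is the number of terms of $S$ counted with multiplicity. A sequence is product-one if its terms can be ordered so that their product in $G$ equals $1_G$ (the empty sequence is product-one). $\mathcal B(G)\subset\mathcal F(G)$ is the monoid of all product-one sequences. An atom of $\mathcal B(G)$ (minimal product-one sequence) is a nonempty product-one sequence that is not the concatenation of two nonempty product-one sequences; $\mathcal A(G)$ is the set of atoms. $\mathsf D(G)=\max\{|S|: S\in\mathcal A(G)\}$ is the large Davenport constant. For $A,B\in\mathcal B(G)$, "$A$ divides $B$ in $\mathcal B(G)$" means that $B$ is the concatenation of $A$ and some element of $\mathcal B(G)$. For $A\in\mathcal B(G)$ let $\omega(\mathcal B(G),A)$ be the smallest $N\in\mathbb N_0\cup\{\infty\}$ with the following property: whenever $k\in\mathbb N$ and $A_1,\dots,A_k\in\mathcal B(G)$ are such that $A$ divides the concatenation of $A_1,\dots,A_k$ in $\mathcal B(G)$, there is a subset $\Omega\subset[1,k]$ with $|\Omega|\le N$ such that $A$ divides the concatenation of the $A_\nu$, $\nu\in\Omega$, in $\mathcal B(G)$. Set $\omega(G)=\sup\{\omega(\mathcal B(G),A): A\in\mathcal A(G)\}$. *)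

theory Defs
  imports "HOL-Algebra.Generated_Groups" "HOL-Library.Multiset" "HOL-Library.Extended_Nat"
begin

text \<open>
  A group of order \<open>2n\<close> generated by two elements satisfying the dihedral relations is a quotient
  of the group presented by \<open>\<langle>a, b | a\<^sup>n = b\<^sup>2 = 1, b a b\<^sup>-\<^sup>1 = a\<^sup>-\<^sup>1\<rangle>\<close>, which itself has order \<open>2n\<close>;
  hence it is isomorphic to it.
\<close>
definition dihedral_group :: "('a, 'b) monoid_scheme \<Rightarrow> nat \<Rightarrow> bool" where
  "dihedral_group G n \<longleftrightarrow> group G \<and> order G = 2 * n \<and>
     (\<exists>a \<in> carrier G. \<exists>b \<in> carrier G.
        generate G {a, b} = carrier G \<and>
        a [^]\<^bsub>G\<^esub> n = \<one>\<^bsub>G\<^esub> \<and> b [^]\<^bsub>G\<^esub> (2::nat) = \<one>\<^bsub>G\<^esub> \<and>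
        b \<otimes>\<^bsub>G\<^esub> a \<otimes>\<^bsub>G\<^esub> inv\<^bsub>G\<^esub> b = inv\<^bsub>G\<^esub> a)"

text \<open>Sequences over \<open>G\<close> are multisets of elements of the carrier; concatenation is \<open>+\<close>.\<close>
definition product_one_seqs :: "('a, 'b) monoid_scheme \<Rightarrow> 'a multiset set" where
  "product_one_seqs G = {S. set_mset S \<subseteq> carrier G \<and>
     (\<exists>xs. mset xs = S \<and> foldr (\<otimes>\<^bsub>G\<^esub>) xs \<one>\<^bsub>G\<^esub> = \<one>\<^bsub>G\<^esub>)}"

definition product_one_atoms :: "('a, 'b) monoid_scheme \<Rightarrow> 'a multiset set" where
  "product_one_atoms G = {S \<in> product_one_seqs G. S \<noteq> {#} \<and>
     \<not> (\<exists>A \<in> product_one_seqs G. \<exists>B \<in> product_one_seqs G. A \<noteq> {#} \<and> B \<noteq> {#} \<and> S = A + B)}"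

text \<open>\<open>Max\<close> is unspecified on infinite sets; for finite \<open>G\<close> the set of lengths of atoms is finite.\<close>
definition large_davenport :: "('a, 'b) monoid_scheme \<Rightarrow> nat" where
  "large_davenport G = Max (size ` product_one_atoms G)"

text \<open>
  Divisibility in the monoid of product-one sequences: the cofactor must itself be product-one,
  so this is stronger than \<open>\<subseteq>#\<close>.
\<close>
definition seq_divides :: "('a, 'b) monoid_scheme \<Rightarrow> 'a multiset \<Rightarrow> 'a multiset \<Rightarrow> bool" where
  "seq_divides G A B \<longleftrightarrow> (\<exists>C \<in> product_one_seqs G. B = A + C)"

text \<open>The defining property always holds for \<open>N = \<infinity>\<close>, so the \<open>LEAST\<close> below exists.\<close>
definition omega_elem :: "('a, 'b) monoid_scheme \<Rightarrow> 'a multiset \<Rightarrow> enat" where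
  "omega_elem G A = (LEAST N :: enat.
     \<forall>k \<ge> (1::nat). \<forall>As :: nat \<Rightarrow> 'a multiset.
       (\<forall>i \<in> {1..k}. As i \<in> product_one_seqs G) \<longrightarrow>
       seq_divides G A (\<Sum>i \<in> {1..k}. As i) \<longrightarrow>
       (\<exists>\<Omega> \<subseteq> {1..k}. enat (card \<Omega>) \<le> N \<and> seq_divides G A (\<Sum>i \<in> \<Omega>. As i)))"

definition omega :: "('a, 'b) monoid_scheme \<Rightarrow> enat" where
  "omega G = (SUP A \<in> product_one_atoms G. omega_elem G A)"

end

theory Submission imports Defs begin

text \<open>
  For odd \<open>n\<close>, a sequence over the dihedral group that contains a reflection is product-one iff its
  terms can be given signs such that the signs of the reflections cancel and the signed sum of the
  exponents vanishes modulo \<open>n\<close>. All combinatorics takes place on finite index sets with exponents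
  and such signings. An atom has at most \<open>2n\<close> terms because the partial sums of a signing that
  witnesses it are distinct, and \<open>a\<^bsup>2n-2\<^esup> b\<^sup>2\<close> is an atom of length \<open>2n\<close>.

  For \<open>\<omega>(G) \<le> 2n\<close> let the atom \<open>A\<close> divide \<open>A\<^sub>1 \<dots> A\<^sub>k\<close>, let \<open>I\<close> be the set of indices used by \<open>A\<close> and
  \<open>C\<close> what \<open>A\<close> leaves over of the \<open>A\<^sub>i\<close> with \<open>i \<in> I\<close>. Among the sets \<open>T\<close> of further indices for which
  \<open>C\<close> together with the \<open>A\<^sub>j\<close>, \<open>j \<in> T\<close>, is product-one, and the signings witnessing this, take one that
  minimises \<open>|T|\<close> plus the total sign imbalance of the reflections inside the blocks \<open>A\<^sub>j\<close>. Consider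
  disjoint groups of terms whose sign flip keeps the reflections balanced: a half of a balanced block,
  after which the block can be removed, or two reflections of opposite sign, one of them from an
  unbalanced block. If flipping some of these groups and re-signing a part of \<open>C\<close> keeps the total zero,
  the measure drops; so Scherk's theorem bounds the number of groups plus the number of values of the
  re-signed part by \<open>n + 1\<close>. If \<open>A\<^sub>i\<close> meets \<open>A\<close> in a single term \<open>x\<close>, the rest of \<open>A\<^sub>i\<close> acts like the
  single term \<open>x\<^sup>-\<^sup>1\<close>, and since \<open>A\<close> is an atom the re-signings of these rests take many values.
  Counting then gives \<open>|I| + |T| \<le> 2n\<close>.
\<close>

text \<open>The measure does not drop for every family of flips. Flipping both halves of a balanced
  block does not make it removable, and flipping a whole surplus only reverses the imbalance. This
  is why the groups are arranged in two chains whose prefixes are always uneven; one group has to be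
  omitted, whence \<open>n + 1\<close> instead of \<open>n\<close>.

  A second obstacle is rigidity: without a reflection no sign can be changed.

  The constant \<open>2 * n\<close> splits as \<open>(n + 1) + (n - 1)\<close>: without any
  re-signing at most \<open>n - 1\<close> blocks are added, which settles
  \<open>|I| <= n + 1\<close>. Beyond that, the excess forces blocks that meet the atom in a single
  term, and their re-signings use up part of the bound. Oddness of \<open>n\<close> serves to halve
  differences of re-signed weights and to exclude a splitting of the extremal atom.\<close>

section \<open>Scherk's theorem modulo \<open>n\<close>\<close>

text \<open>Induction on \<open>Y\<close> by Dyson's \<open>e\<close>-transform.\<close>
lemma scherk_mod:
  fixes n :: nat and X Y :: "int set"
  assumes n: "n > 0" and X: "X \<subseteq> {0..<int n}" "0 \<in> X" and Y: "Y \<subseteq> {0..<int n}" "0 \<in> Y"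
    and uniq: "\<And>x y. x \<in> X \<Longrightarrow> y \<in> Y \<Longrightarrow> int n dvd x + y \<Longrightarrow> x = 0 \<and> y = 0"
  shows "card X + card Y \<le> card ((\<lambda>(x, y). (x + y) mod int n) ` (X \<times> Y)) + 1"
  using X Y uniq
proof (induction "card Y" arbitrary: X Y rule: less_induct)
  case less
  have finX: "finite X" and finY: "finite Y"
    using less.prems by (auto intro: finite_subset)
  show ?case
  proof (cases "Y = {0}")
    case True
    have "(\<lambda>(x, y). (x + y) mod int n) ` (X \<times> Y) = X"
    proof -
      have e: "(x + 0) mod int n = x" if "x \<in> X" for x
        using subsetD[OF less.prems(1) that] by simp
      have "(\<lambda>(x, y). (x + y) mod int n) ` (X \<times> {0}) = (\<lambda>x. (x + 0) mod int n) ` X"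
        by (auto simp: image_def)
      also have "\<dots> = (\<lambda>x. x) ` X" using e by (rule image_cong[OF refl])
      finally show ?thesis using True by simp
    qed
    then show ?thesis using True by simp
  next
    case False
    then obtain y where y: "y \<in> Y" "y \<noteq> 0" using less.prems by blast
    \<comment> \<open>If \<open>X\<close> were closed under adding \<open>y\<close>, it would
      contain all multiples of \<open>y\<close>, in particular \<open>(n - 1) * y\<close>, which is
      \<open>- y\<close> modulo \<open>n\<close>; this contradicts the uniqueness of the zero sum
      because \<open>y\<close> is not 0.\<close>
    have "\<exists>a\<in>X. (a + y) mod int n \<notin> X"
    proof (rule ccontr)
      assume neg: "\<not> ?thesis"
      have "(int k * y) mod int n \<in> X" for k
      proof (induction k)
        case 0 then show ?case using less.prems by simp
      next
        case (Suc k)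
        then have "((int k * y) mod int n + y) mod int n \<in> X" using neg by blast
        then show ?case by (simp add: algebra_simps mod_simps)
      qed
      from this[of "n - 1"] have m: "(int (n - 1) * y) mod int n \<in> X" .
      have "int n dvd (int (n - 1) * y) mod int n + y"
      proof -
        have "((int (n - 1) * y) mod int n + y) mod int n = (int (n - 1) * y + y) mod int n"
          by (simp add: mod_simps)
        also have "int (n - 1) * y + y = int n * y" using n by (simp add: of_nat_diff algebra_simps)
        finally show ?thesis by (simp add: dvd_eq_mod_eq_0)
      qed
      with less.prems(5)[OF m y(1)] y(2) show False by simp
    qed
    then obtain a where a: "a \<in> X" "(a + y) mod int n \<notin> X" by blast
    \<comment> \<open>The transform at \<open>a\<close>: the elements of \<open>Y\<close> whose
      translate by \<open>a\<close> leaves \<open>X\<close> move over to \<open>X\<close>, so the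
      sum of the cardinalities is kept, and \<open>y\<close> is among them. The new sumset lies in
      the old one because \<open>(a + b) + z = (a + z) + b\<close>, where \<open>a + z\<close> is in
      \<open>X\<close> for \<open>z\<close> in \<open>Y1\<close>; the same exchange preserves the
      uniqueness of the zero sum.\<close>
    define h where "h = (\<lambda>b. (a + b) mod int n)"
    define Y1 where "Y1 = {b \<in> Y. h b \<in> X}"
    define X1 where "X1 = X \<union> h ` Y"
    have a_lt: "0 \<le> a" "a < int n" using a less.prems(1) by auto
    have Y1sub: "Y1 \<subset> Y" using a y unfolding Y1_def h_def by auto
    have inj: "inj_on h Y"
    proof (rule inj_onI)
      fix b c assume bc: "b \<in> Y" "c \<in> Y" "h b = h c"
      then have "int n dvd (a + b) - (a + c)" unfolding h_def using mod_eq_dvd_iff by blast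
      moreover have "0 \<le> b" "b < int n" "0 \<le> c" "c < int n" using bc less.prems(3) by auto
      ultimately show "b = c"
        by (simp add: dvd_diff_commute) (metis mod_eq_dvd_iff mod_pos_pos_trivial)
    qed
    have X1eq: "X1 = X \<union> h ` (Y - Y1)" unfolding X1_def Y1_def by auto
    have cX1: "card X1 = card X + card (Y - Y1)"
    proof -
      have "X \<inter> h ` (Y - Y1) = {}" unfolding Y1_def by auto
      moreover have "card (h ` (Y - Y1)) = card (Y - Y1)"
        by (rule card_image) (meson Diff_subset inj inj_on_subset)
      ultimately show ?thesis unfolding X1eq using finX finY by (subst card_Un_disjoint) auto
    qed
    have cY: "card Y = card Y1 + card (Y - Y1)"
      using Y1sub finY by (metis card_Diff_subset card_mono finite_subset le_add_diff_inverse psubset_imp_subset)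
    have IH: "card X1 + card Y1 \<le> card ((\<lambda>(x, y). (x + y) mod int n) ` (X1 \<times> Y1)) + 1"
    proof (rule less.hyps)
      show "card Y1 < card Y" using Y1sub finY by (simp add: psubset_card_mono)
      show "X1 \<subseteq> {0..<int n}" unfolding X1_def h_def using less.prems(1) n by auto
      show "0 \<in> X1" unfolding X1_def using less.prems by simp
      show "Y1 \<subseteq> {0..<int n}" using Y1sub less.prems(3) by blast
      show "0 \<in> Y1" unfolding Y1_def h_def using less.prems a a_lt by simp
      fix x z assume xz: "x \<in> X1" "z \<in> Y1" "int n dvd x + z"
      show "x = 0 \<and> z = 0"
      proof (cases "x \<in> X")
        case True then show ?thesis using less.prems(5) xz Y1sub by blast
      next
        case False
        then obtain b where b: "b \<in> Y" "x = h b" using xz unfolding X1_def by auto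
        have hz: "h z \<in> X" "z \<in> Y" using xz unfolding Y1_def by auto
        have "int n dvd h z + b"
        proof -
          have "(h z + b) mod int n = (h b + z) mod int n"
            unfolding h_def by (simp add: mod_simps algebra_simps)
          then show ?thesis using xz b by (simp add: dvd_eq_mod_eq_0)
        qed
        then have "h z = 0" "b = 0" using less.prems(5) hz b by blast+
        then have "x = a" using b a_lt unfolding h_def by simp
        then show ?thesis using False a by simp
      qed
    qed
    have "(\<lambda>(x, y). (x + y) mod int n) ` (X1 \<times> Y1) \<subseteq> (\<lambda>(x, y). (x + y) mod int n) ` (X \<times> Y)"
    proof clarsimp
      fix x z assume xz: "x \<in> X1" "z \<in> Y1"
      show "(x + z) mod int n \<in> (\<lambda>(x, y). (x + y) mod int n) ` (X \<times> Y)"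
      proof (cases "x \<in> X")
        case True then show ?thesis using xz Y1sub by force
      next
        case False
        then obtain b where b: "b \<in> Y" "x = h b" using xz unfolding X1_def by auto
        have hz: "h z \<in> X" using xz unfolding Y1_def by auto
        have "(x + z) mod int n = (h z + b) mod int n"
          unfolding b h_def by (simp add: mod_simps algebra_simps)
        then show ?thesis using hz b by force
      qed
    qed
    then have "card ((\<lambda>(x, y). (x + y) mod int n) ` (X1 \<times> Y1))
        \<le> card ((\<lambda>(x, y). (x + y) mod int n) ` (X \<times> Y))"
      by (intro card_mono) (use finX finY in auto)
    with IH cX1 cY show ?thesis by linarith
  qed
qed

text \<open>The prefix sums of a chain are distinct, since two of them differ by the sum over an
  interval of that chain. Together with \<open>Z\<close> this gives sets of \<open>card Z\<close>,
  \<open>length L1 + 1\<close> and \<open>length L2 + 1\<close> residues with only the trivial zero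
  sum, and Scherk's theorem applied twice bounds the total by \<open>n + 2\<close>. The families
  that occur are intervals of one chain and unions of two prefixes; these are covered by the
  disjunction in \<open>prog\<close>.\<close>

lemma chain_bound:
  fixes n :: nat and t :: "'g \<Rightarrow> int" and Z :: "int set"
  assumes n: "n > 0" and Z: "Z \<subseteq> {0..<int n}" "0 \<in> Z"
    and d: "distinct (L1 @ L2)"
    and prog: "\<And>S z. S \<noteq> {} \<Longrightarrow> S \<subseteq> set L1 \<union> set L2 \<Longrightarrow>
       S \<subseteq> set L1 \<or> S \<subseteq> set L2 \<or> hd L1 \<in> S \<Longrightarrow> z \<in> Z \<Longrightarrow> \<not> int n dvd z + sum t S"
  shows "card Z + length L1 + length L2 \<le> n"
proof -
  define pre where "pre L i = sum t (set (take i L)) mod int n" for L i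
  have prefix_inj: "inj_on (pre L) {..length L}" if L: "distinct L"
      "\<And>S. S \<noteq> {} \<Longrightarrow> S \<subseteq> set L \<Longrightarrow> \<not> int n dvd sum t S" for L
  proof -
    have *: "pre L i \<noteq> pre L j" if ij: "i < j" "j \<le> length L" for i j
    proof
      assume eq: "pre L i = pre L j"
      define S where "S = set (take j L) - set (take i L)"
      have sub: "set (take i L) \<subseteq> set (take j L)" using ij by (simp add: set_take_subset_set_take)
      have "sum t S = sum t (set (take j L)) - sum t (set (take i L))"
        unfolding S_def using sub by (simp add: sum_diff)
      moreover have "int n dvd sum t (set (take j L)) - sum t (set (take i L))"
        using eq unfolding pre_def by (metis mod_eq_dvd_iff)
      moreover have "S \<noteq> {}"
      proof -
        have "card (set (take i L)) = i" "card (set (take j L)) = j"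
          using ij L(1) by (simp_all add: distinct_card)
        then show ?thesis unfolding S_def using ij sub by (metis Diff_eq_empty_iff less_irrefl subset_antisym)
      qed
      moreover have "S \<subseteq> set L" unfolding S_def using set_take_subset by fast
      ultimately show False using L(2) by metis
    qed
    show ?thesis
    proof (rule inj_onI)
      fix i j assume "i \<in> {..length L}" "j \<in> {..length L}" "pre L i = pre L j"
      then show "i = j" using *[of i j] *[of j i] by (metis atMost_iff linorder_neqE_nat)
    qed
  qed
  define X where "X = pre L1 ` {..length L1}"
  define Y where "Y = pre L2 ` {..length L2}"
  have nz1: "\<not> int n dvd sum t S" if "S \<noteq> {}" "S \<subseteq> set L1" for S
    using prog[of S 0] that Z by auto
  have nz2: "\<not> int n dvd sum t S" if "S \<noteq> {}" "S \<subseteq> set L2" for S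
    using prog[of S 0] that Z by auto
  have cX: "card X = length L1 + 1" unfolding X_def
    using prefix_inj[of L1] d nz1 by (simp add: card_image)
  have cY: "card Y = length L2 + 1" unfolding Y_def
    using prefix_inj[of L2] d nz2 by (simp add: card_image)
  have sub: "X \<subseteq> {0..<int n}" "Y \<subseteq> {0..<int n}" unfolding X_def Y_def pre_def using n by auto
  have zero: "0 \<in> X" "0 \<in> Y" unfolding X_def Y_def pre_def by (force intro!: image_eqI[of _ _ 0])+
  have key: "i = 0 \<and> j = 0" if "z \<in> Z" "i \<le> length L1" "j \<le> length L2"
      "int n dvd z + pre L1 i + pre L2 j" for z i j
  proof (rule ccontr)
    assume ij: "\<not> ?thesis"
    define S where "S = set (take i L1) \<union> set (take j L2)"
    have disj: "set (take i L1) \<inter> set (take j L2) = {}"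
      using d set_take_subset[of i L1] set_take_subset[of j L2] by auto
    have "sum t S = sum t (set (take i L1)) + sum t (set (take j L2))"
      unfolding S_def using disj by (simp add: sum.union_disjoint)
    then have "sum t S mod int n = (pre L1 i + pre L2 j) mod int n"
      unfolding pre_def by (simp add: mod_add_eq)
    then have "(z + sum t S) mod int n = (z + pre L1 i + pre L2 j) mod int n"
      unfolding add.assoc by (rule mod_add_cong[OF refl])
    then have "int n dvd z + sum t S" using that by (simp add: dvd_eq_mod_eq_0)
    moreover have "S \<noteq> {}" using ij that unfolding S_def by (auto simp: take_eq_Nil)
    moreover have "S \<subseteq> set L1 \<union> set L2" unfolding S_def using set_take_subset by fast
    moreover have "S \<subseteq> set L1 \<or> S \<subseteq> set L2 \<or> hd L1 \<in> S"
    proof (cases "i = 0")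
      case True then show ?thesis unfolding S_def using set_take_subset by fastforce
    next
      case False
      then have "hd L1 \<in> set (take i L1)" if "L1 \<noteq> []"
        using that by (metis hd_in_set hd_take not_gr_zero take_eq_Nil)
      then show ?thesis unfolding S_def using set_take_subset[of j L2] by (cases "L1 = []") auto
    qed
    ultimately show False using prog that by blast
  qed
  have pre0: "pre L 0 = 0" for L unfolding pre_def by simp
  let ?ZX = "(\<lambda>(x, y). (x + y) mod int n) ` (Z \<times> X)"
  have s1: "card Z + card X \<le> card ?ZX + 1"
  proof (rule scherk_mod[OF n Z sub(1) zero(1)])
    fix z x assume "z \<in> Z" "x \<in> X" and dv: "int n dvd z + x"
    then obtain i where i: "i \<le> length L1" "x = pre L1 i" unfolding X_def by auto
    have "i = 0" using key[of z i 0] \<open>z \<in> Z\<close> i dv pre0 by simp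
    then have "x = 0" using i pre0 by simp
    moreover have "z = 0" using dv \<open>x = 0\<close> Z(1) \<open>z \<in> Z\<close> zdvd_not_zless[of z "int n"] by force
    ultimately show "z = 0 \<and> x = 0" by simp
  qed
  have s2: "card ?ZX + card Y \<le> card ((\<lambda>(x, y). (x + y) mod int n) ` (?ZX \<times> Y)) + 1"
  proof (rule scherk_mod[OF n _ _ sub(2) zero(2)])
    show "?ZX \<subseteq> {0..<int n}" using n by auto
    show "0 \<in> ?ZX" using Z zero by force
    fix v y assume "v \<in> ?ZX" "y \<in> Y" and dv: "int n dvd v + y"
    then obtain z i j where zij: "z \<in> Z" "i \<le> length L1" "v = (z + pre L1 i) mod int n"
      "j \<le> length L2" "y = pre L2 j" unfolding X_def Y_def by auto
    have "(v + y) mod int n = (z + pre L1 i + pre L2 j) mod int n"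
      using zij by (simp add: mod_simps)
    then have dz: "int n dvd z + pre L1 i + pre L2 j" using dv by (simp add: dvd_eq_mod_eq_0)
    have "i = 0 \<and> j = 0" using key zij dz by blast
    then have "y = 0" "v = z mod int n" using zij pre0 by auto
    then show "v = 0 \<and> y = 0" using dv by (metis add.right_neutral dvd_imp_mod_0 mod_mod_trivial)
  qed
  have "(\<lambda>(x, y). (x + y) mod int n) ` (?ZX \<times> Y) \<subseteq> {0..<int n}" using n by auto
  then have "card ((\<lambda>(x, y). (x + y) mod int n) ` (?ZX \<times> Y)) \<le> n"
    using card_mono[of "{0..<int n}"] by fastforce
  with s1 s2 cX cY show ?thesis by linarith
qed

text \<open>Ore: the complement of a minimal dominating set is dominating as well.\<close>
lemma dominating_split:
  assumes fin: "finite V" and sym: "\<And>x y. share x y \<Longrightarrow> share y x"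
    and nb: "\<And>x. x \<in> V \<Longrightarrow> \<exists>y\<in>V. y \<noteq> x \<and> share x y"
  obtains H where "H \<subseteq> V" "\<And>x. x \<in> V - H \<Longrightarrow> \<exists>y\<in>H. share x y" "\<And>x. x \<in> H \<Longrightarrow> \<exists>y\<in>V - H. share x y"
proof -
  define dom where "dom H \<longleftrightarrow> H \<subseteq> V \<and> (\<forall>x\<in>V - H. \<exists>y\<in>H. share x y)" for H
  have "dom V" unfolding dom_def by simp
  then obtain H where H: "dom H" "\<And>H'. dom H' \<Longrightarrow> card H \<le> card H'"
    using ex_has_least_nat[of dom V card] by blast
  have HV: "H \<subseteq> V" "finite H" using H fin unfolding dom_def by (auto intro: finite_subset)
  have "\<exists>y\<in>V - H. share x y" if x: "x \<in> H" for x
  proof (rule ccontr)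
    assume neg: "\<not> ?thesis"
    have "dom (H - {x})" unfolding dom_def
    proof (intro conjI ballI)
      show "H - {x} \<subseteq> V" using HV by auto
      fix z assume z: "z \<in> V - (H - {x})"
      show "\<exists>y\<in>H - {x}. share z y"
      proof (cases "z = x")
        case True
        then obtain y where "y \<in> V" "y \<noteq> x" "share x y" using nb[of x] x HV by blast
        then show ?thesis using neg True by blast
      next
        case False
        then obtain y where "y \<in> H" "share z y" using z H(1) unfolding dom_def by blast
        moreover have "y \<noteq> x" using neg sym z False \<open>share z y\<close> by blast
        ultimately show ?thesis by blast
      qed
    qed
    then have "card H \<le> card (H - {x})" by (rule H(2))
    then show False using x HV(2) by (metis card_Diff1_less not_le)
  qed
  then show ?thesis using that[of H] H(1) HV unfolding dom_def by blast
qed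

text \<open>
  Scherk's theorem is applied to \<open>Z\<close> and the prefix sums of two chains, which are a minimal dominating
  set and its complement; dropping a single element of \<open>V\<close> ensures that every family of elements
  that occurs is not closed under \<open>share\<close>.
\<close>
lemma share_bound:
  fixes n :: nat and t :: "'g \<Rightarrow> int" and Z :: "int set"
  assumes n: "n > 0" and Z: "Z \<subseteq> {0..<int n}" "0 \<in> Z"
    and fin: "finite V" and sym: "\<And>x y. share x y \<Longrightarrow> share y x"
    and nb: "\<And>x. x \<in> V \<Longrightarrow> \<exists>y\<in>V. y \<noteq> x \<and> share x y"
    and prog: "\<And>S z x y. S \<subseteq> V \<Longrightarrow> x \<in> S \<Longrightarrow> y \<in> V - S \<Longrightarrow> share x y \<Longrightarrow> z \<in> Z \<Longrightarrow> \<not> int n dvd z + sum t S"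
  shows "card Z + card V \<le> n + 1"
proof (cases "V = {}")
  case True
  have "card Z \<le> n" using card_mono[OF _ Z(1)] by simp
  then show ?thesis using True by simp
next
  case False
  obtain H where H: "H \<subseteq> V" "\<And>x. x \<in> V - H \<Longrightarrow> \<exists>y\<in>H. share x y" "\<And>x. x \<in> H \<Longrightarrow> \<exists>y\<in>V - H. share x y"
    using dominating_split[OF fin sym nb] by metis
  \<comment> \<open>The head \<open>g\<close> of the first chain has its partner \<open>g'\<close>
    in neither chain, so a family containing \<open>g\<close> is never closed under
    \<open>share\<close>. A family inside one chain is not closed because each of its elements has a
    partner on the other side.\<close>
  obtain g where g: "g \<in> H" using False H(2) by blast
  then obtain g' where g': "g' \<in> V - H" "share g g'" using H(3) by blast
  have finH: "finite H" "finite (V - H)" using H fin by (auto intro: finite_subset)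
  obtain M1 where M1: "set M1 = H - {g}" "distinct M1" using finH finite_distinct_list by (metis finite_Diff)
  obtain L2 where L2: "set L2 = V - H - {g'}" "distinct L2" using finH finite_distinct_list by (metis finite_Diff)
  let ?L1 = "g # M1"
  have set1: "set ?L1 = H" using M1 g by auto
  have "card Z + length ?L1 + length L2 \<le> n"
  proof (rule chain_bound[OF n Z, where t = t])
    show "distinct (?L1 @ L2)" using M1 L2 g H by auto
    fix S z assume S: "S \<noteq> {}" "S \<subseteq> set ?L1 \<union> set L2" "S \<subseteq> set ?L1 \<or> S \<subseteq> set L2 \<or> hd ?L1 \<in> S" and z: "z \<in> Z"
    have SV: "S \<subseteq> V" using S(2) set1 L2 H by auto
    have "\<exists>x\<in>S. \<exists>y\<in>V - S. share x y"
      using S(3)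
    proof (elim disjE)
      assume a: "S \<subseteq> set ?L1"
      obtain x where "x \<in> S" using S by blast
      then show ?thesis using a set1 H(3)[of x] by blast
    next
      assume a: "S \<subseteq> set L2"
      obtain x where "x \<in> S" using S by blast
      then show ?thesis using a L2 H(1) H(2)[of x] by blast
    next
      assume "hd ?L1 \<in> S"
      moreover have "g' \<notin> S" using S(2) set1 L2 g' by auto
      ultimately show ?thesis using g' by auto
    qed
    then show "\<not> int n dvd z + sum t S" using prog SV z by blast
  qed
  moreover have "length ?L1 = card H" using set1 M1 g by (metis distinct.simps(2) distinct_card Diff_iff singletonI)
  moreover have "length L2 = card (V - H) - 1" using L2 g' finH by (metis card_Diff_singleton distinct_card)
  moreover have "card (V - H) > 0" using g' finH by (auto simp: card_gt_0_iff)
  moreover have "card V = card H + card (V - H)" using H fin by (metis card_Diff_subset card_mono finH(1) le_add_diff_inverse)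
  ultimately show ?thesis by linarith
qed

section \<open>Signed index sets\<close>

text \<open>\<open>Up\<close> and \<open>Um\<close> are the surplus terms of either sign,
  \<open>Fp\<close> and \<open>Fm\<close> the supply. Supply terms are matched with surplus terms
  first and the rest of the surplus with itself. So no pair consists of two supply terms; flipping
  such a pair need not improve any block.\<close>

lemma ex_bij_betw_split:
  assumes fin: "finite Up" "finite Fp" "finite Um" "finite Fm"
    and disj: "Up \<inter> Fp = {}" "Um \<inter> Fm = {}"
    and le: "card Fp \<le> card Um" "card Fm \<le> card Up" and eq: "card Up + card Fp = card Um + card Fm"
  obtains p where "bij_betw p (Up \<union> Fp) (Um \<union> Fm)" "\<And>x. x \<in> Fp \<Longrightarrow> p x \<in> Um"
proof -
  obtain Um1 where Um1: "Um1 \<subseteq> Um" "card Um1 = card Fp" using le fin by (meson obtain_subset_with_card_n)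
  obtain Up1 where Up1: "Up1 \<subseteq> Up" "card Up1 = card Fm" using le fin by (meson obtain_subset_with_card_n)
  have fin1: "finite Um1" "finite Up1" using Um1 Up1 fin by (auto intro: finite_subset)
  obtain f1 where f1: "bij_betw f1 Fp Um1" using finite_same_card_bij[OF fin(2) fin1(1)] Um1 by auto
  obtain f2 where f2: "bij_betw f2 Up1 Fm" using finite_same_card_bij[OF fin1(2) fin(4)] Up1 by auto
  have "card (Up - Up1) = card (Um - Um1)"
    using Um1 Up1 fin fin1 eq by (simp add: card_Diff_subset)
  then obtain f3 where f3: "bij_betw f3 (Up - Up1) (Um - Um1)"
    using finite_same_card_bij[of "Up - Up1" "Um - Um1"] fin by auto
  define p where "p x = (if x \<in> Fp then f1 x else if x \<in> Up1 then f2 x else f3 x)" for x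
  have b1: "bij_betw p Fp Um1" using f1 by (rule bij_betw_cong[THEN iffD1, rotated]) (simp add: p_def)
  have b2: "bij_betw p Up1 Fm" using f2
    by (rule bij_betw_cong[THEN iffD1, rotated]) (use disj Up1 in \<open>auto simp: p_def\<close>)
  have b3: "bij_betw p (Up - Up1) (Um - Um1)" using f3
    by (rule bij_betw_cong[THEN iffD1, rotated]) (use disj in \<open>auto simp: p_def\<close>)
  have "bij_betw p (Fp \<union> Up1) (Um1 \<union> Fm)" by (rule bij_betw_combine[OF b1 b2]) (use disj Um1 in auto)
  then have "bij_betw p ((Fp \<union> Up1) \<union> (Up - Up1)) ((Um1 \<union> Fm) \<union> (Um - Um1))"
    by (rule bij_betw_combine[OF _ b3]) (use disj Um1 in auto)
  moreover have "(Fp \<union> Up1) \<union> (Up - Up1) = Up \<union> Fp" "(Um1 \<union> Fm) \<union> (Um - Um1) = Um \<union> Fm"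
    using Up1 Um1 by auto
  ultimately have "bij_betw p (Up \<union> Fp) (Um \<union> Fm)" by simp
  moreover have "p x \<in> Um" if "x \<in> Fp" for x using b1 that Um1 by (auto simp: bij_betw_def)
  ultimately show ?thesis using that by blast
qed

text \<open>Index \<open>i\<close> stands for the rotation \<open>a\<^bsup>val i\<^esup>\<close>, or for the reflection \<open>a\<^bsup>val i\<^esup> b\<close> if \<open>i \<in> Rf\<close>.\<close>
locale signed_index =
  fixes n :: nat and val :: "'i \<Rightarrow> int" and Rf :: "'i set"
  assumes odd_n: "odd n"
begin

lemma n_pos: "n > 0" using odd_n by (cases n) auto

definition signing :: "('i \<Rightarrow> int) \<Rightarrow> bool" where
  "signing s \<longleftrightarrow> (\<forall>i. s i = 1 \<or> s i = -1)"

definition imb :: "'i set \<Rightarrow> ('i \<Rightarrow> int) \<Rightarrow> int" where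
  "imb X s = (\<Sum>i\<in>X \<inter> Rf. s i)"

definition wt :: "'i set \<Rightarrow> ('i \<Rightarrow> int) \<Rightarrow> int" where
  "wt X s = (\<Sum>i\<in>X. s i * val i)"

definition good :: "'i set \<Rightarrow> ('i \<Rightarrow> int) \<Rightarrow> bool" where
  "good X s \<longleftrightarrow> signing s \<and> imb X s = 0 \<and> int n dvd wt X s"

text \<open>
  Without reflections no sign can be changed. Otherwise the sign of a term is the parity of the number of
  reflections in front of it, so that reflections alternate and rotations are free.
\<close>
definition product_one :: "'i set \<Rightarrow> bool" where
  "product_one X \<longleftrightarrow> (if X \<inter> Rf = {} then int n dvd sum val X else \<exists>s. good X s)"

definition atom :: "'i set \<Rightarrow> bool" where
  "atom A \<longleftrightarrow> finite A \<and> A \<noteq> {} \<and> product_one A \<and> (\<forall>B\<subseteq>A. B \<noteq> {} \<longrightarrow> B \<noteq> A \<longrightarrow> product_one B \<longrightarrow> \<not> product_one (A - B))"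

lemma imb_empty [simp]: "imb {} s = 0" by (simp add: imb_def)
lemma wt_empty [simp]: "wt {} s = 0" by (simp add: wt_def)

lemma imb_Un: "finite X \<Longrightarrow> finite X' \<Longrightarrow> X \<inter> X' = {} \<Longrightarrow> imb (X \<union> X') s = imb X s + imb X' s"
  unfolding imb_def by (subst Int_Un_distrib2, subst sum.union_disjoint) auto

lemma wt_Un: "finite X \<Longrightarrow> finite X' \<Longrightarrow> X \<inter> X' = {} \<Longrightarrow> wt (X \<union> X') s = wt X s + wt X' s"
  unfolding wt_def by (simp add: sum.union_disjoint)

lemma imb_Diff: "finite X \<Longrightarrow> X' \<subseteq> X \<Longrightarrow> imb (X - X') s = imb X s - imb X' s"
  using imb_Un[of X' "X - X'" s] by (simp add: finite_subset Un_absorb1)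

lemma wt_Diff: "finite X \<Longrightarrow> X' \<subseteq> X \<Longrightarrow> wt (X - X') s = wt X s - wt X' s"
  using wt_Un[of X' "X - X'" s] by (simp add: finite_subset Un_absorb1)

lemma imb_cong: "(\<And>i. i \<in> X \<Longrightarrow> i \<in> Rf \<Longrightarrow> s i = s' i) \<Longrightarrow> imb X s = imb X s'"
  unfolding imb_def by (rule sum.cong) auto

lemma wt_cong: "(\<And>i. i \<in> X \<Longrightarrow> s i = s' i) \<Longrightarrow> wt X s = wt X s'"
  unfolding wt_def by (rule sum.cong) auto

lemma imb_minus: "(\<And>i. i \<in> X \<Longrightarrow> s' i = - s i) \<Longrightarrow> imb X s' = - imb X s"
  unfolding imb_def by (simp add: sum_negf)

lemma wt_minus: "(\<And>i. i \<in> X \<Longrightarrow> s' i = - s i) \<Longrightarrow> wt X s' = - wt X s"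
  unfolding wt_def by (simp add: sum_negf)

lemma imb_UN: "finite J \<Longrightarrow> (\<And>j. j \<in> J \<Longrightarrow> finite (Y j)) \<Longrightarrow>
    (\<And>j k. j \<in> J \<Longrightarrow> k \<in> J \<Longrightarrow> j \<noteq> k \<Longrightarrow> Y j \<inter> Y k = {}) \<Longrightarrow> imb (\<Union>(Y ` J)) s = (\<Sum>j\<in>J. imb (Y j) s)"
proof -
  assume J: "finite J" "\<And>j. j \<in> J \<Longrightarrow> finite (Y j)"
    and d: "\<And>j k. j \<in> J \<Longrightarrow> k \<in> J \<Longrightarrow> j \<noteq> k \<Longrightarrow> Y j \<inter> Y k = {}"
  have "imb (\<Union>(Y ` J)) s = sum s (\<Union>j\<in>J. Y j \<inter> Rf)" unfolding imb_def by (simp add: Int_UN_distrib2)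
  also have "\<dots> = (\<Sum>j\<in>J. sum s (Y j \<inter> Rf))"
    by (rule sum.UNION_disjoint) (use J d in \<open>auto 4 4\<close>)
  finally show ?thesis unfolding imb_def .
qed

lemma wt_UN: "finite J \<Longrightarrow> (\<And>j. j \<in> J \<Longrightarrow> finite (Y j)) \<Longrightarrow>
    (\<And>j k. j \<in> J \<Longrightarrow> k \<in> J \<Longrightarrow> j \<noteq> k \<Longrightarrow> Y j \<inter> Y k = {}) \<Longrightarrow> wt (\<Union>(Y ` J)) s = (\<Sum>j\<in>J. wt (Y j) s)"
  unfolding wt_def by (rule sum.UNION_disjoint) auto

lemma signingD: "signing s \<Longrightarrow> s i = 1 \<or> s i = -1" unfolding signing_def by blast

lemma signing_minus: "signing s \<Longrightarrow> signing (\<lambda>i. - s i)" unfolding signing_def by force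

lemma imb_card: "finite X \<Longrightarrow> signing s \<Longrightarrow>
    imb X s = int (card (X \<inter> Rf \<inter> {i. s i = 1})) - int (card (X \<inter> Rf \<inter> {i. s i = -1}))"
proof -
  assume f: "finite X" and s: "signing s"
  have "imb X s = (\<Sum>i\<in>X \<inter> Rf \<inter> {i. s i = 1}. s i) + (\<Sum>i\<in>X \<inter> Rf \<inter> {i. s i = -1}. s i)"
    unfolding imb_def using f signingD[OF s]
    by (subst sum.union_disjoint[symmetric]) (auto intro!: sum.cong)
  also have "(\<Sum>i\<in>X \<inter> Rf \<inter> {i. s i = 1}. s i) = int (card (X \<inter> Rf \<inter> {i. s i = 1}))" by simp
  also have "(\<Sum>i\<in>X \<inter> Rf \<inter> {i. s i = -1}. s i) = - int (card (X \<inter> Rf \<inter> {i. s i = -1}))" by simp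
  finally show ?thesis by simp
qed

lemma card_Rf_split: "finite X \<Longrightarrow> signing s \<Longrightarrow>
    card (X \<inter> Rf) = card (X \<inter> Rf \<inter> {i. s i = 1}) + card (X \<inter> Rf \<inter> {i. s i = -1})"
proof -
  assume f: "finite X" and s: "signing s"
  have "X \<inter> Rf = (X \<inter> Rf \<inter> {i. s i = 1}) \<union> (X \<inter> Rf \<inter> {i. s i = -1})" using signingD[OF s] by auto
  also have "card \<dots> = card (X \<inter> Rf \<inter> {i. s i = 1}) + card (X \<inter> Rf \<inter> {i. s i = -1})"
    by (rule card_Un_disjoint) (use f in auto)
  finally show ?thesis .
qed

lemma product_one_good: "product_one X \<Longrightarrow> \<exists>s. good X s"
proof (cases "X \<inter> Rf = {}")
  case True
  assume "product_one X"
  then have "good X (\<lambda>_. 1)" using True by (simp add: product_one_def good_def signing_def imb_def wt_def)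
  then show ?thesis by blast
qed (simp add: product_one_def)

lemma good_product_one: "good X s \<Longrightarrow> X \<inter> Rf \<noteq> {} \<Longrightarrow> product_one X"
  unfolding product_one_def by auto

section \<open>Zero sums inside an atom and the length of atoms\<close>

lemma dvd_double: "int n dvd 2 * x \<longleftrightarrow> int n dvd x"
proof -
  have "coprime (int n) 2" using odd_n by simp
  then show ?thesis by (simp add: coprime_dvd_mult_right_iff)
qed

text \<open>The same signing, restricted to \<open>B\<close> and to \<open>A - B\<close>, witnesses
  that both are product-one. A reflection on both sides is required because a set of rotations alone
  is product-one only if its unsigned sum vanishes.\<close>

lemma atom_no_balanced:
  assumes A: "atom A" "good A a" and B: "B \<subseteq> A" "B \<inter> Rf \<noteq> {}" "(A - B) \<inter> Rf \<noteq> {}" "imb B a = 0"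
  shows "\<not> int n dvd wt B a"
proof
  assume dv: "int n dvd wt B a"
  have fin: "finite A" using A by (simp add: atom_def)
  have "good B a" using A B dv by (simp add: good_def)
  then have "product_one B" using B by (simp add: good_product_one)
  moreover have "good (A - B) a" using A B dv fin
    by (simp add: good_def imb_Diff wt_Diff)
  then have "product_one (A - B)" using B by (simp add: good_product_one)
  ultimately show False using A B unfolding atom_def by (metis Diff_cancel Int_empty_left)
qed

text \<open>Counterpart for parts without reflections: the common sign \<open>c\<close> turns the
  weight of \<open>B\<close> into a multiple of its plain sum, so \<open>B\<close> is product-one
  and the rest keeps its reflections and its signing. Rotations of mixed sign with vanishing weight
  are not excluded.\<close>

lemma atom_no_rotations:
  assumes A: "atom A" "good A a" "A \<inter> Rf \<noteq> {}" and B: "B \<subseteq> A - Rf" "B \<noteq> {}" "\<And>i. i \<in> B \<Longrightarrow> a i = c"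
  shows "\<not> int n dvd sum val B"
proof
  assume dv: "int n dvd sum val B"
  have fin: "finite A" using A by (simp add: atom_def)
  have "product_one B" using B dv by (auto simp: product_one_def)
  have w: "wt B a = c * sum val B" unfolding wt_def sum_distrib_left using B by (intro sum.cong) auto
  have "imb B a = 0" unfolding imb_def using B by (intro sum.neutral) auto
  then have "good (A - B) a" using A B w dv fin
    by (subst good_def, subst imb_Diff, simp, blast, subst wt_Diff, simp, blast) (auto simp: good_def)
  moreover have "(A - B) \<inter> Rf \<noteq> {}" using A B by blast
  ultimately have "product_one (A - B)" by (simp add: good_product_one)
  moreover have "B \<noteq> A" using A B by blast
  ultimately show False using A(1) B \<open>product_one B\<close> unfolding atom_def by blast
qed

text \<open>The classical bound for zero-sum free sequences over a cyclic group, as the case of one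
  chain and \<open>Z = {0}\<close>.\<close>

lemma zero_free_card:
  assumes fin: "finite B" and zf: "\<And>S. S \<noteq> {} \<Longrightarrow> S \<subseteq> B \<Longrightarrow> \<not> int n dvd sum val S"
  shows "card B < n"
proof -
  obtain L where L: "set L = B" "distinct L" using fin finite_distinct_list by metis
  have "card {0::int} + length L + length ([] :: 'i list) \<le> n"
    by (rule chain_bound[OF n_pos, where t = val]) (use L zf n_pos in auto)
  moreover have "length L = card B" using L by (metis distinct_card)
  ultimately show ?thesis by simp
qed

lemma atom_rotations_card:
  assumes A: "atom A" "A \<inter> Rf = {}"
  shows "card A \<le> n"
proof -
  have fin: "finite A" and ne: "A \<noteq> {}" and dv: "int n dvd sum val A" using A by (auto simp: atom_def product_one_def)
  obtain x where x: "x \<in> A" using ne by blast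
  have "card (A - {x}) < n"
  proof (rule zero_free_card)
    fix S assume S: "S \<noteq> {}" "S \<subseteq> A - {x}"
    then have SA: "S \<subseteq> A" "S \<noteq> A" using x by auto
    show "\<not> int n dvd sum val S"
    proof
      assume d: "int n dvd sum val S"
      have e: "S \<inter> Rf = {}" "(A - S) \<inter> Rf = {}" using SA A(2) by auto
      have "int n dvd sum val (A - S)" using d dv SA fin by (simp add: sum_diff)
      then have "product_one S" "product_one (A - S)" using d e by (auto simp: product_one_def)
      then show False using A(1) SA S(1) unfolding atom_def by blast
    qed
  qed (use fin in simp)
  then show ?thesis using x fin by simp
qed

lemma atom_class_card:
  assumes A: "atom A" "good A a" "A \<inter> Rf \<noteq> {}" and B: "B \<subseteq> A - Rf" "\<And>i. i \<in> B \<Longrightarrow> a i = c"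
  shows "card B < n"
proof (rule zero_free_card)
  show "finite B" using A B by (meson atom_def finite_Diff finite_subset)
  show "\<not> int n dvd sum val S" if "S \<noteq> {}" "S \<subseteq> B" for S
    by (rule atom_no_rotations[OF A, of _ c]) (use that B in auto)
qed

text \<open>Each plus reflection is joined with a minus reflection into one balanced item. The pair
  of \<open>x2\<close> is left out, so that a reflection remains outside every family containing a
  pair and \<open>atom_no_balanced\<close> applies. Families of rotations are under control only for
  a single sign; hence the plus rotations follow the pair of \<open>x1\<close> in one chain and the
  minus rotations lie in the other, and a family that meets both chains contains \<open>x1\<close>.
  The count is \<open>1 + (1 + |up|) + (b - 2 + |um|) <= n\<close>.\<close>

lemma atom_card_pairs:
  assumes A: "atom A" "good A a" and b: "card (A \<inter> Rf) = 2 * b" "b \<ge> 2"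
  shows "card (A - Rf) + b \<le> n"
proof -
  have fin: "finite A" and sa: "signing a" and im: "imb A a = 0" using A by (auto simp: atom_def good_def)
  define Ap where "Ap = A \<inter> Rf \<inter> {i. a i = 1}"
  define Am where "Am = A \<inter> Rf \<inter> {i. a i = -1}"
  have cA: "card Ap = b" "card Am = b"
    using imb_card[OF fin sa] im card_Rf_split[OF fin sa] b unfolding Ap_def Am_def by auto
  have finA: "finite Ap" "finite Am" using fin by (auto simp: Ap_def Am_def)
  obtain p where p: "bij_betw p Ap Am" using finite_same_card_bij[OF finA] cA by auto
  obtain x1 where x1: "x1 \<in> Ap" using cA b by fastforce
  have "card (Ap - {x1}) \<ge> 1" using cA b x1 finA by simp
  then have "Ap - {x1} \<noteq> {}" by (metis card.empty not_one_le_zero)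
  then obtain x2 where x2: "x2 \<in> Ap" "x2 \<noteq> x1" by blast
  define up where "up = (A - Rf) \<inter> {i. a i = 1}"
  define um where "um = (A - Rf) \<inter> {i. a i = -1}"
  have finu: "finite up" "finite um" using fin by (auto simp: up_def um_def)
  obtain M1 where M1: "set M1 = up" "distinct M1" using finu finite_distinct_list by metis
  obtain L2 where L2: "set L2 = (Ap - {x1, x2}) \<union> um" "distinct L2" using finA finu finite_distinct_list
    by (metis finite_Diff finite_Un)
  define t where "t x = (if x \<in> Ap then val x - val (p x) else a x * val x)" for x
  have "card {0::int} + length (x1 # M1) + length L2 \<le> n"
  proof (rule chain_bound[OF n_pos, where t = t])
    show "{0} \<subseteq> {0..<int n}" using n_pos by simp
    show "distinct ((x1 # M1) @ L2)"
    proof -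
      have "Ap \<inter> up = {}" "Ap \<inter> um = {}" "up \<inter> um = {}" by (auto simp: Ap_def up_def um_def)
      then have "x1 \<notin> set M1" "x1 \<notin> set L2" "set M1 \<inter> set L2 = {}"
        using x1 unfolding M1(1) L2(1) by blast+
      then show ?thesis using M1(2) L2(2) by simp
    qed
    fix S and z :: int assume S: "S \<noteq> {}" "S \<subseteq> set (x1 # M1) \<union> set L2"
      "S \<subseteq> set (x1 # M1) \<or> S \<subseteq> set L2 \<or> hd (x1 # M1) \<in> S" and z: "z \<in> {0}"
    have Scov: "S \<subseteq> Ap \<union> up \<union> um" "x2 \<notin> S"
    proof -
      have "S \<subseteq> insert x1 up \<union> ((Ap - {x1, x2}) \<union> um)" using S(2) M1(1) L2(1) by simp
      moreover have "x2 \<notin> up" "x2 \<notin> um" using x2 by (auto simp: Ap_def up_def um_def)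
      ultimately show "S \<subseteq> Ap \<union> up \<union> um" "x2 \<notin> S" using x1 x2 by blast+
    qed
    have sets: "Ap \<subseteq> A" "up \<subseteq> A" "um \<subseteq> A" "Ap \<subseteq> Rf" "up \<inter> Rf = {}" "um \<inter> Rf = {}"
      by (auto simp: Ap_def up_def um_def)
    have SA: "S \<subseteq> A" using Scov sets by blast
    have finS: "finite S" using SA fin finite_subset by blast
    have x2S: "x2 \<notin> S" using Scov by blast
    have "\<not> int n dvd sum t S"
    proof (cases "S \<inter> Ap = {}")
      case True
      then have x1S: "x1 \<notin> S" using x1 by auto
      have "S \<subseteq> insert x1 up \<or> S \<subseteq> (Ap - {x1, x2}) \<union> um" using S(3) x1S M1(1) L2(1) by simp
      then have "S \<subseteq> up \<or> S \<subseteq> um" using x1S True by blast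
      then obtain c where c: "\<And>i. i \<in> S \<Longrightarrow> a i = c" "c = 1 \<or> c = -1" "S \<subseteq> A - Rf"
      proof
        assume h: "S \<subseteq> up"
        show ?thesis by (rule that[of 1]) (use h in \<open>auto simp: up_def\<close>)
      next
        assume h: "S \<subseteq> um"
        show ?thesis by (rule that[of "-1"]) (use h in \<open>auto simp: um_def\<close>)
      qed
      have "A \<inter> Rf \<noteq> {}" using x1 by (auto simp: Ap_def)
      then have nd: "\<not> int n dvd sum val S" using atom_no_rotations[OF A, of S c] c S(1) by blast
      have "sum t S = c * sum val S" unfolding sum_distrib_left t_def using c True by (intro sum.cong) auto
      then show ?thesis using nd c by auto
    next
      case False
      define B where "B = S \<union> p ` (S \<inter> Ap)"
      have pA: "p ` (S \<inter> Ap) \<subseteq> Am" using p by (auto simp: bij_betw_def)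
      have "Am \<inter> (Ap \<union> up \<union> um) = {}" by (auto simp: Ap_def Am_def up_def um_def)
      then have disj: "S \<inter> p ` (S \<inter> Ap) = {}" using pA Scov by blast
      have inj: "inj_on p (S \<inter> Ap)" using p by (meson bij_betw_def inf_le2 inj_on_subset)
      have SRf: "S \<inter> Rf = S \<inter> Ap" using Scov sets by blast
      have finp: "finite (p ` (S \<inter> Ap))" using finS by auto
      have i1: "imb S a = int (card (S \<inter> Ap))" unfolding imb_def SRf by (simp add: Ap_def)
      have pR: "p ` (S \<inter> Ap) \<inter> Rf = p ` (S \<inter> Ap)" using pA by (auto simp: Am_def)
      have "imb (p ` (S \<inter> Ap)) a = (\<Sum>i\<in>p ` (S \<inter> Ap). -1)" unfolding imb_def pR
        using pA by (intro sum.cong) (auto simp: Am_def)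
      then have i2: "imb (p ` (S \<inter> Ap)) a = - int (card (S \<inter> Ap))" by (simp add: card_image[OF inj])
      have "imb B a = 0" unfolding B_def using imb_Un[OF finS finp disj] i1 i2 by simp
      moreover have "B \<subseteq> A" using SA pA by (auto simp: B_def Am_def)
      moreover have "B \<inter> Rf \<noteq> {}" using False SRf by (auto simp: B_def)
      moreover have "x2 \<notin> B" using x2S x2 pA by (auto simp: B_def Ap_def Am_def)
      then have "(A - B) \<inter> Rf \<noteq> {}" using x2 by (auto simp: Ap_def)
      ultimately have nd: "\<not> int n dvd wt B a" using atom_no_balanced[OF A] by blast
      have "wt (p ` (S \<inter> Ap)) a = (\<Sum>i\<in>S \<inter> Ap. a (p i) * val (p i))"
        unfolding wt_def using sum.reindex[OF inj] by simp
      also have "\<dots> = (\<Sum>i\<in>S \<inter> Ap. - val (p i))" using pA by (intro sum.cong) (auto simp: Am_def)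
      finally have w2: "wt (p ` (S \<inter> Ap)) a = (\<Sum>i\<in>S. if i \<in> Ap then - val (p i) else 0)"
        using finS by (simp add: sum.inter_restrict)
      have "wt B a = (\<Sum>i\<in>S. a i * val i + (if i \<in> Ap then - val (p i) else 0))"
        unfolding B_def using wt_Un[OF finS finp disj, of a] w2 by (simp add: wt_def sum.distrib)
      also have "\<dots> = sum t S" unfolding t_def by (intro sum.cong) (auto simp: Ap_def)
      finally show ?thesis using nd by simp
    qed
    then show "\<not> int n dvd z + sum t S" using z by simp
  qed simp
  moreover have "length M1 = card up" using M1 by (metis distinct_card)
  moreover have "length L2 = card (Ap - {x1, x2}) + card um" using L2 finA finu
    by (metis (no_types, lifting) Ap_def Diff_iff Int_iff card_Un_disjoint disjoint_iff distinct_card finite_Diff um_def)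
  moreover have "card (Ap - {x1, x2}) = b - 2" using x1 x2 cA finA by (simp add: card_Diff_subset)
  moreover have "card (A - Rf) = card up + card um"
  proof -
    have "A - Rf = up \<union> um" using signingD[OF sa] by (auto simp: up_def um_def)
    moreover have "up \<inter> um = {}" by (auto simp: up_def um_def)
    ultimately show ?thesis using finu by (simp add: card_Un_disjoint)
  qed
  ultimately show ?thesis using b by simp
qed

lemma atom_card_le:
  assumes A: "atom A"
  shows "card A \<le> 2 * n"
proof (cases "A \<inter> Rf = {}")
  case True then show ?thesis using atom_rotations_card[OF A] by simp
next
  case False
  then obtain a where a: "good A a" using A product_one_good by (auto simp: atom_def)
  have fin: "finite A" and sa: "signing a" and im: "imb A a = 0" using A a by (auto simp: atom_def good_def)
  define b where "b = card (A \<inter> Rf \<inter> {i. a i = 1})"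
  have cb: "card (A \<inter> Rf) = 2 * b"
    using imb_card[OF fin sa] im card_Rf_split[OF fin sa] unfolding b_def by auto
  have b0: "b > 0" using False cb fin by (metis card_gt_0_iff finite_Int mult_is_0 not_gr_zero)
  have cA: "card A = card (A \<inter> Rf) + card (A - Rf)"
    using fin by (metis card_Diff_subset_Int card_mono finite_Int inf_le1 le_add_diff_inverse)
  show ?thesis
  proof (cases "b \<ge> 2")
    case True then show ?thesis using atom_card_pairs[OF A a cb] cA cb by simp
  next
    \<comment> \<open>Here \<open>b = 1\<close>: the rotations of either sign are zero-sum free,
      which gives \<open>2 + 2 * (n - 1)\<close>, the length of the extremal atom.\<close>
    case b1: False
    have "card ((A - Rf) \<inter> {i. a i = 1}) < n"
      by (rule atom_class_card[OF A a False, of _ 1]) blast+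
    moreover have "card ((A - Rf) \<inter> {i. a i = -1}) < n"
      by (rule atom_class_card[OF A a False, of _ "-1"]) blast+
    moreover have "card (A - Rf) = card ((A - Rf) \<inter> {i. a i = 1}) + card ((A - Rf) \<inter> {i. a i = -1})"
    proof -
      have "A - Rf = ((A - Rf) \<inter> {i. a i = 1}) \<union> ((A - Rf) \<inter> {i. a i = -1})" using signingD[OF sa] by auto
      moreover have "card (((A - Rf) \<inter> {i. a i = 1}) \<union> ((A - Rf) \<inter> {i. a i = -1}))
         = card ((A - Rf) \<inter> {i. a i = 1}) + card ((A - Rf) \<inter> {i. a i = -1})"
        by (rule card_Un_disjoint) (use fin in auto)
      ultimately show ?thesis by simp
    qed
    moreover have "b = 1" using b0 b1 by simp
    ultimately show ?thesis using cA cb by simp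
  qed
qed

end

section \<open>Minimal states and sign flips\<close>

text \<open>
  \<open>C0\<close> has to be kept and the blocks \<open>Y j\<close> with \<open>j \<in> T0\<close> are optional. \<open>Sg\<close> indexes blocks inside \<open>C0\<close>;
  in the application each of them is a product-one sequence with one term removed.
\<close>
locale flip_state = signed_index n val Rf for n :: nat and val :: "'i \<Rightarrow> int" and Rf :: "'i set" +
  fixes C0 :: "'i set" and T0 Sg :: "'j set" and Y :: "'j \<Rightarrow> 'i set"
  assumes finC0: "finite C0" and finT0: "finite T0" and finSg: "finite Sg"
    and finY: "j \<in> T0 \<union> Sg \<Longrightarrow> finite (Y j)"
    and T0Sg: "T0 \<inter> Sg = {}"
    and Ydisj: "j \<in> T0 \<union> Sg \<Longrightarrow> k \<in> T0 \<union> Sg \<Longrightarrow> j \<noteq> k \<Longrightarrow> Y j \<inter> Y k = {}"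
    and SgC0: "j \<in> Sg \<Longrightarrow> Y j \<subseteq> C0"
    and T0C0: "j \<in> T0 \<Longrightarrow> Y j \<inter> C0 = {}"
    and T0good: "j \<in> T0 \<Longrightarrow> \<exists>s. good (Y j) s"
begin

definition carr :: "'j set \<Rightarrow> 'i set" where "carr T = C0 \<union> \<Union>(Y ` T)"

definition mu :: "'j set \<Rightarrow> ('i \<Rightarrow> int) \<Rightarrow> int" where
  "mu T s = (\<Sum>j\<in>T. 1 + \<bar>imb (Y j) s\<bar>) + (\<Sum>j\<in>Sg. \<bar>imb (Y j) s\<bar>)"

definition minimal_state :: "'j set \<Rightarrow> ('i \<Rightarrow> int) \<Rightarrow> bool" where
  "minimal_state T s \<longleftrightarrow> T \<subseteq> T0 \<and> good (carr T) s \<and>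
     (\<forall>T' s'. T' \<subseteq> T0 \<longrightarrow> good (carr T') s' \<longrightarrow> mu T s \<le> mu T' s')"

definition Null :: "'j set \<Rightarrow> ('i \<Rightarrow> int) \<Rightarrow> 'j set" where
  "Null T s = {j \<in> T. imb (Y j) s = 0}"

definition Act :: "'j set \<Rightarrow> ('i \<Rightarrow> int) \<Rightarrow> 'j set" where
  "Act T s = {j \<in> T \<union> Sg. imb (Y j) s \<noteq> 0}"

lemma mu_nonneg: "mu T s \<ge> 0" unfolding mu_def by (intro add_nonneg_nonneg sum_nonneg) auto

lemma ex_minimal_state:
  assumes "T' \<subseteq> T0" "good (carr T') s'"
  obtains T s where "minimal_state T s"
proof -
  let ?P = "\<lambda>(T, s). T \<subseteq> T0 \<and> good (carr T) s"
  have "?P (T', s')" using assms by simp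
  then obtain Ts where Ts: "?P Ts" "\<And>Us. ?P Us \<Longrightarrow> nat (mu (fst Ts) (snd Ts)) \<le> nat (mu (fst Us) (snd Us))"
    using ex_has_least_nat[of ?P "(T', s')" "\<lambda>Us. nat (mu (fst Us) (snd Us))"] by blast
  have "mu (fst Ts) (snd Ts) \<le> mu T s" if "T \<subseteq> T0" "good (carr T) s" for T s
    using Ts(2)[of "(T, s)"] that mu_nonneg nat_le_eq_zle[of "mu (fst Ts) (snd Ts)" "mu T s"] by (auto simp: le_less)
  then have "minimal_state (fst Ts) (snd Ts)" unfolding minimal_state_def using Ts(1) by (auto simp: case_prod_beta)
  then show ?thesis using that by blast
qed

lemma finT: "T \<subseteq> T0 \<Longrightarrow> finite T" using finT0 finite_subset by blast

lemma fin_carr: "T \<subseteq> T0 \<Longrightarrow> finite (carr T)"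
  unfolding carr_def using finC0 finT finY by (auto intro!: finite_UN_I)

text \<open>
  A balanced block \<open>j \<in> T\<close> is split into the two halves where \<open>s\<close> agrees, respectively disagrees, with a
  signing that witnesses that \<open>Y j\<close> is product-one: flipping exactly one half makes \<open>Y j\<close> removable.
  \<open>Phi j\<close> is the surplus of an unbalanced block: flipping a part of it lowers the imbalance of \<open>Y j\<close>
  unless it is everything. Each other group consists of two reflections of opposite sign, at least
  one of them from some \<open>U j\<close>, and the other one from some \<open>U j\<close> or from the supply \<open>F\<close>.
\<close>
lemma pair_bound:
  assumes st: "minimal_state T s"
    and Phi: "\<And>j. j \<in> Act T s \<Longrightarrow> Phi j \<subseteq> Y j \<inter> Rf"
      "\<And>j. j \<in> Act T s \<Longrightarrow> int (card (Phi j)) = \<bar>imb (Y j) s\<bar>"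
      "\<And>j x. j \<in> Act T s \<Longrightarrow> x \<in> Phi j \<Longrightarrow> s x = sgn (imb (Y j) s)"
    and U: "\<And>j. j \<in> Act T s \<Longrightarrow> U j \<subseteq> Phi j" "\<And>j. j \<in> Act T s \<Longrightarrow> U j = {} \<or> 2 \<le> card (U j)"
    and F: "F \<subseteq> C0 \<inter> Rf" "\<And>j. j \<in> Act T s \<Longrightarrow> F \<inter> U j = {}"
      "\<And>j. j \<in> Sg \<Longrightarrow> j \<in> Act T s \<Longrightarrow> F \<inter> Y j \<subseteq> Phi j" "\<And>j. j \<in> Sg \<Longrightarrow> j \<notin> Act T s \<Longrightarrow> F \<inter> Y j = {}"
    and R: "R \<subseteq> C0" "R \<inter> F = {}" "\<And>j. j \<in> Act T s \<Longrightarrow> R \<inter> U j = {}"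
    and Zs: "s \<in> Zs" "\<And>z. z \<in> Zs \<Longrightarrow> signing z" "\<And>z. z \<in> Zs \<Longrightarrow> imb R z = imb R s"
      "\<And>z j. z \<in> Zs \<Longrightarrow> j \<in> Sg \<Longrightarrow>
         (Y j \<subseteq> R \<and> (j \<in> Act T s \<longrightarrow> U j = {}) \<and> \<bar>imb (Y j) z\<bar> \<le> \<bar>imb (Y j) s\<bar>)
         \<or> (\<forall>x\<in>Y j \<inter> R \<inter> Rf. z x \<noteq> s x \<longrightarrow> j \<in> Act T s \<and> x \<in> Phi j)"
    and Up: "Up = \<Union>(U ` Act T s) \<inter> {x. s x = 1}" and Um: "Um = \<Union>(U ` Act T s) \<inter> {x. s x = -1}"
    and Fp: "Fp = F \<inter> {x. s x = 1}" and Fm: "Fm = F \<inter> {x. s x = -1}"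
    and le: "card Fp \<le> card Um" "card Fm \<le> card Up" and eq: "card Up + card Fp = card Um + card Fm"
  shows "card ((\<lambda>z. (wt R z - wt R s) mod int n) ` Zs) + 2 * card (Null T s) + card Up + card Fp \<le> n + 1"
proof -
  have TT0: "T \<subseteq> T0" and gs: "good (carr T) s" and mn: "\<And>T' s'. T' \<subseteq> T0 \<Longrightarrow> good (carr T') s' \<Longrightarrow> mu T s \<le> mu T' s'"
    using st unfolding minimal_state_def by auto
  have sg: "signing s" using gs by (simp add: good_def)
  have fT: "finite T" using finT[OF TT0] .
  have fA: "finite (Act T s)" unfolding Act_def using fT finSg by simp
  have Asub: "j \<in> T0 \<union> Sg" if "j \<in> Act T s" for j using that TT0 unfolding Act_def by auto
  have UY: "U j \<subseteq> Y j \<inter> Rf" if "j \<in> Act T s" for j using U(1) Phi(1) that by blast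
  have finU: "finite (U j)" if "j \<in> Act T s" for j using UY[OF that] finY[OF Asub[OF that]] by (meson finite_Int finite_subset)
  have finUU: "finite Up" "finite Um" unfolding Up Um using fA finU by auto
  have finF: "finite F" using F(1) finC0 by (meson finite_Int finite_subset)
  have finFF: "finite Fp" "finite Fm" unfolding Fp Fm using finF by auto
  have disjs: "Up \<inter> Fp = {}" "Um \<inter> Fm = {}" unfolding Up Um Fp Fm using F(2) by auto
  obtain p where p: "bij_betw p (Up \<union> Fp) (Um \<union> Fm)" "\<And>x. x \<in> Fp \<Longrightarrow> p x \<in> Um"
    using ex_bij_betw_split[OF finUU(1) finFF(1) finUU(2) finFF(2) disjs le eq] by blast
  have pin: "p x \<in> Um \<union> Fm" if "x \<in> Up \<union> Fp" for x using p(1) that by (auto simp: bij_betw_def)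
  have pinj: "p x = p y \<longleftrightarrow> x = y" if "x \<in> Up \<union> Fp" "y \<in> Up \<union> Fp" for x y
    using p(1) that by (auto simp: bij_betw_def inj_on_def)
  have splus: "s x = 1" if "x \<in> Up \<union> Fp" for x using that unfolding Up Fp by auto
  have smin: "s x = -1" if "x \<in> Um \<union> Fm" for x using that unfolding Um Fm by auto
  have URf: "x \<in> Rf" if "x \<in> Up \<union> Fp \<union> (Um \<union> Fm)" for x
    using that UY F(1) unfolding Up Um Fp Fm by blast
  obtain sig where sig: "\<And>j. j \<in> T0 \<Longrightarrow> good (Y j) (sig j)" using T0good by metis

  define N where "N = Null T s"
  have NT: "N \<subseteq> T" unfolding N_def Null_def by auto
  have NAct: "j \<notin> Act T s" if "j \<in> N" for j using that unfolding N_def Null_def Act_def by simp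
  \<comment> \<open>The groups to be flipped: the two halves of each balanced block of
    \<open>T\<close>, and the pairs of the matching \<open>p\<close>, each named by its plus member.
    Flipping a group changes the total weight by minus twice its weight, which is
    \<open>t\<close>.\<close>
  define V where "V = Inl ` (N \<times> (UNIV :: bool set)) \<union> Inr ` (Up \<union> Fp)"
  define grp where "grp g = (case g of Inl (j, b) \<Rightarrow> {x \<in> Y j. (s x = sig j x) = b} | Inr x \<Rightarrow> {x, p x})" for g
  \<comment> \<open>Two groups have a common block here if flipping one of them but not the other
    improves that block: it becomes removable, or its imbalance drops.\<close>
  define cls where "cls g = (case g of Inl (j, b) \<Rightarrow> {j} | Inr x \<Rightarrow> {j \<in> Act T s. U j \<inter> {x, p x} \<noteq> {}})" for g :: "'j \<times> bool + 'i"
  define t where "t g = - 2 * wt (grp g) s" for g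
  have grpL: "grp (Inl (j, b)) = {x \<in> Y j. (s x = sig j x) = b}" for j b by (simp add: grp_def)
  have grpR: "grp (Inr x) = {x, p x}" for x by (simp add: grp_def)
  have clsL: "cls (Inl (j, b)) = {j}" for j b by (simp add: cls_def)
  have clsR: "cls (Inr x) = {j \<in> Act T s. U j \<inter> {x, p x} \<noteq> {}}" for x by (simp add: cls_def)
  have finN: "finite N" using NT fT finite_subset by blast
  have finV: "finite V" unfolding V_def using finN finUU finFF by simp
  have Vcases: "\<exists>j b. g = Inl (j, b) \<and> j \<in> N" if "g \<in> V" "\<nexists>x. g = Inr x \<and> x \<in> Up \<union> Fp" for g
    using that unfolding V_def by auto
  have YN: "Y j \<inter> U k = {}" if "j \<in> N" "k \<in> Act T s" for j k
    using that UY[of k] Ydisj[of j k] NT TT0 Asub[of k] NAct by blast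
  have YNC: "Y j \<inter> C0 = {}" if "j \<in> T" for j using T0C0 that TT0 by blast
  have Udisj: "U j \<inter> U k = {}" if "j \<in> Act T s" "k \<in> Act T s" "j \<noteq> k" for j k
    using Ydisj[OF Asub Asub] that UY by blast
  have grpRel: "grp (Inr x) \<subseteq> F \<union> \<Union>(U ` Act T s)" if "x \<in> Up \<union> Fp" for x
    using pin[OF that] that unfolding grpR Up Um Fp Fm by auto
  have grp_disj: "grp g \<inter> grp h = {}" if gh: "g \<in> V" "h \<in> V" "g \<noteq> h" for g h
  proof -
    have RR: "grp (Inr x) \<inter> grp (Inr y) = {}" if "x \<in> Up \<union> Fp" "y \<in> Up \<union> Fp" "x \<noteq> y" for x y
    proof -
      have "x \<noteq> p y" "y \<noteq> p x" using splus smin pin that by (metis one_neq_neg_one)+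
      moreover have "p x \<noteq> p y" using pinj that by simp
      ultimately show ?thesis using that unfolding grpR by auto
    qed
    have LR: "grp (Inl (j, b)) \<inter> grp (Inr y) = {}" if "j \<in> N" "y \<in> Up \<union> Fp" for j b y
    proof -
      have "Y j \<inter> F = {}" using YNC[of j] NT that F(1) by blast
      then show ?thesis using grpRel[OF that(2)] YN[OF that(1)] unfolding grpL by blast
    qed
    have LL: "grp (Inl (j, b)) \<inter> grp (Inl (k, c)) = {}" if "j \<in> N" "k \<in> N" "(j, b) \<noteq> (k, c)" for j b k c
    proof (cases "j = k")
      case True then show ?thesis using that unfolding grpL by auto
    next
      case False
      then have "Y j \<inter> Y k = {}" using Ydisj that NT TT0 by blast
      then show ?thesis unfolding grpL by blast
    qed
    show ?thesis
    proof (cases "\<exists>x. g = Inr x \<and> x \<in> Up \<union> Fp")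
      case True
      then obtain x where x: "g = Inr x" "x \<in> Up \<union> Fp" by blast
      show ?thesis
      proof (cases "\<exists>y. h = Inr y \<and> y \<in> Up \<union> Fp")
        case True
        then obtain y where y: "h = Inr y" "y \<in> Up \<union> Fp" by blast
        then show ?thesis using RR[OF x(2) y(2)] x(1) gh(3) by simp
      next
        case False
        then obtain k c where "h = Inl (k, c)" "k \<in> N" using Vcases[OF gh(2)] by blast
        then show ?thesis using LR[of k x c] x by (simp add: Int_commute)
      qed
    next
      case False
      then obtain j b where jb: "g = Inl (j, b)" "j \<in> N" using Vcases[OF gh(1)] by blast
      show ?thesis
      proof (cases "\<exists>y. h = Inr y \<and> y \<in> Up \<union> Fp")
        case True
        then show ?thesis using LR[OF jb(2)] jb by blast
      next
        case False
        then obtain k c where kc: "h = Inl (k, c)" "k \<in> N" using Vcases[OF gh(2)] by blast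
        then show ?thesis using LL[OF jb(2) kc(2), of b c] jb gh(3) by simp
      qed
    qed
  qed
  have grp_carr: "grp g \<subseteq> carr T - R" if "g \<in> V" for g
  proof -
    have L: "grp (Inl (j, b)) \<subseteq> carr T - R" if "j \<in> N" for j b
      using that NT YNC[of j] R(1) unfolding grpL carr_def by blast
    have Rr: "grp (Inr x) \<subseteq> carr T - R" if "x \<in> Up \<union> Fp" for x
    proof -
      have "U j \<subseteq> carr T - R" if "j \<in> Act T s" for j
      proof -
        have "Y j \<subseteq> carr T" using that SgC0 unfolding Act_def carr_def by blast
        then show ?thesis using UY[OF that] R(3)[OF that] by blast
      qed
      moreover have "F \<subseteq> carr T - R" using F(1) R(2) unfolding carr_def by blast
      ultimately show ?thesis using grpRel[OF that] by blast
    qed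
    show ?thesis using Vcases[OF that] L Rr by blast
  qed
  have grp_imb: "imb (grp g) s = 0" if "g \<in> V" for g
  proof -
    \<comment> \<open>If \<open>P\<close> is the part of \<open>Y j\<close> where the two signings
      agree and \<open>Q\<close> the rest, the two balance conditions read
      \<open>imb P + imb Q = 0\<close> and \<open>imb P - imb Q = 0\<close>.\<close>
    have L: "imb (grp (Inl (j, b))) s = 0" if j: "j \<in> N" for j b
    proof -
      have jT0: "j \<in> T0" using that NT TT0 by auto
      have fY: "finite (Y j)" using finY jT0 by auto
      have sj: "signing (sig j)" and z1: "imb (Y j) (sig j) = 0" using sig[OF jT0] by (auto simp: good_def)
      have z2: "imb (Y j) s = 0" using that by (simp add: N_def Null_def)
      let ?P = "{x \<in> Y j. (s x = sig j x) = True}" and ?Q = "{x \<in> Y j. (s x = sig j x) = False}"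
      have PQ: "Y j = ?P \<union> ?Q" "?P \<inter> ?Q = {}" by auto
      have f: "finite ?P" "finite ?Q" using fY by auto
      have a: "imb (Y j) s = imb ?P s + imb ?Q s" "imb (Y j) (sig j) = imb ?P (sig j) + imb ?Q (sig j)"
        using imb_Un[OF f PQ(2)] PQ(1) by metis+
      have opp: "sig j i = - s i" if "s i \<noteq> sig j i" for i
        using signingD[OF sg, of i] signingD[OF sj, of i] that by auto
      have "imb ?P (sig j) = imb ?P s" by (rule imb_cong) auto
      moreover have "imb ?Q (sig j) = - imb ?Q s"
        by (rule imb_minus) (use opp in auto)
      ultimately have "imb ?P s = 0" "imb ?Q s = 0" using a z1 z2 by linarith+
      then show ?thesis unfolding grpL by (cases b) auto
    qed
    have Rr: "imb (grp (Inr x)) s = 0" if "x \<in> Up \<union> Fp" for x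
    proof -
      have "x \<noteq> p x" using splus smin pin that by (metis one_neq_neg_one)
      moreover have "{x, p x} \<inter> Rf = {x, p x}" using URf that pin by blast
      ultimately show ?thesis unfolding grpR imb_def using splus[OF that] smin[OF pin[OF that]] by simp
    qed
    show ?thesis using Vcases[OF that] L Rr by blast
  qed
  have fin_grp: "finite (grp g)" if "g \<in> V" for g
    using grp_carr[OF that] fin_carr[OF TT0] by (meson Diff_subset finite_subset subset_trans)
  define share where "share g h \<longleftrightarrow> cls g \<inter> cls h \<noteq> {}" for g h :: "'j \<times> bool + 'i"
  \<comment> \<open>A half has the other half as partner. For a pair, \<open>2 <= card (U j)\<close>
    supplies a second surplus term of the same block; it has the same sign, while the members of a
    pair have opposite signs, so it lies in another pair.\<close>
  have nbs: "\<exists>h\<in>V. h \<noteq> g \<and> share g h" if g: "g \<in> V" for g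
  proof (cases "\<exists>x. g = Inr x \<and> x \<in> Up \<union> Fp")
    case False
    then obtain j b where jb: "g = Inl (j, b)" "j \<in> N" using Vcases[OF g] by blast
    then have "Inl (j, \<not> b) \<in> V" unfolding V_def by auto
    moreover have "share g (Inl (j, \<not> b))" unfolding share_def jb clsL by simp
    moreover have "Inl (j, \<not> b) \<noteq> g" unfolding jb by simp
    ultimately show ?thesis by blast
  next
    case True
    then obtain x where x: "g = Inr x" "x \<in> Up \<union> Fp" by blast
    have "x \<in> Up \<or> p x \<in> Um" using x(2) p(2) by blast
    then obtain j y where j: "j \<in> Act T s" "y \<in> U j" "y \<in> {x, p x}" unfolding Up Um by blast
    have "2 \<le> card (U j)" using U(2)[OF j(1)] j(2) by auto
    then have "card (U j - {y}) \<noteq> 0" using j(2) finU[OF j(1)] by simp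
    then obtain y' where y': "y' \<in> U j" "y' \<noteq> y" by (metis DiffD1 DiffD2 card.empty ex_in_conv singletonI)
    have same: "s y' = s y" using Phi(3)[OF j(1)] U(1)[OF j(1)] y' j by (metis subsetD)
    have gj: "j \<in> cls g" unfolding x clsR using j by auto
    show ?thesis
    proof (cases "y = x")
      case True
      then have "s y' = 1" using same splus x by simp
      then have "y' \<in> Up" unfolding Up using y' j by auto
      then have "Inr y' \<in> V" unfolding V_def by auto
      moreover have "share g (Inr y')" unfolding share_def using gj j y' clsR by blast
      moreover have "Inr y' \<noteq> g" using y' True x by simp
      ultimately show ?thesis by blast
    next
      case False
      then have yp: "y = p x" using j by auto
      then have "s y' = -1" using same smin pin x by simp
      then have "y' \<in> Um" unfolding Um using y' j by auto
      then have "y' \<in> p ` (Up \<union> Fp)" using p(1) by (simp add: bij_betw_def)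
      then obtain x' where x': "x' \<in> Up \<union> Fp" "y' = p x'" by blast
      then have "Inr x' \<in> V" unfolding V_def by auto
      moreover have "share g (Inr x')" unfolding share_def using gj j y' x' clsR by blast
      moreover have "Inr x' \<noteq> g" using y' yp x x' by auto
      ultimately show ?thesis by blast
    qed
  qed
  define Z where "Z = (\<lambda>z. (wt R z - wt R s) mod int n) ` Zs"
  have "card Z + card V \<le> n + 1"
  proof (rule share_bound[OF n_pos _ _ finV _ nbs, where t = t])
    show "Z \<subseteq> {0..<int n}" unfolding Z_def using n_pos by auto
    show "0 \<in> Z" unfolding Z_def using Zs(1) by force
    show "share y x" if "share x y" for x y using that unfolding share_def by blast
    fix S z' g h assume S: "S \<subseteq> V" "g \<in> S" "h \<in> V - S" "share g h" and z': "z' \<in> Z"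
    obtain z where z: "z \<in> Zs" "z' = (wt R z - wt R s) mod int n" using z' unfolding Z_def by auto
    have sz: "signing z" using Zs z by blast
    show "\<not> int n dvd z' + sum t S"
    proof
      assume dv: "int n dvd z' + sum t S"
      \<comment> \<open>The competing state: all groups of \<open>S\<close> are flipped,
        \<open>R\<close> is re-signed by \<open>z\<close>, the rest is kept. It is balanced since
        every group is, and its weight is still 0 modulo \<open>n\<close>; the remainder of the
        proof shows that it, or the state obtained by dropping a block, has a smaller
        measure.\<close>
      define D where "D = \<Union>(grp ` S)"
      define s' where "s' i = (if i \<in> D then - s i else if i \<in> R then z i else s i)" for i
      have finS: "finite S" using S finV finite_subset by blast
      have ss': "signing s'" unfolding signing_def
      proof
        fix i show "s' i = 1 \<or> s' i = -1"
          unfolding s'_def using signingD[OF sg, of i] signingD[OF sz, of i] by auto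
      qed
      have Dc: "D \<subseteq> carr T - R" unfolding D_def using grp_carr S by blast
      have Dfin: "finite D" using Dc fin_carr[OF TT0] by (meson Diff_subset finite_subset subset_trans)
      have Rfin: "finite R" using R(1) finC0 finite_subset by blast
      have DR: "D \<inter> R = {}" using Dc by auto
      have Sdisj: "grp f \<inter> grp f' = {}" if "f \<in> S" "f' \<in> S" "f \<noteq> f'" for f f'
        by (rule grp_disj) (use that S(1) in auto)
      have Sfin: "finite (grp f)" if "f \<in> S" for f using fin_grp S(1) that by blast
      have "imb D s = (\<Sum>f\<in>S. imb (grp f) s)" unfolding D_def
        by (rule imb_UN[OF finS Sfin Sdisj])
      also have "\<dots> = 0" by (rule sum.neutral) (use grp_imb S(1) in blast)
      finally have Dimb: "imb D s = 0" .
      have "wt D s = (\<Sum>f\<in>S. wt (grp f) s)" unfolding D_def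
        by (rule wt_UN[OF finS Sfin Sdisj])
      then have Dwt: "sum t S = - 2 * wt D s" unfolding t_def by (simp add: sum_distrib_left)
      define E where "E = carr T - (D \<union> R)"
      have RC: "R \<subseteq> carr T" using R(1) unfolding carr_def by blast
      have cE: "carr T = E \<union> (D \<union> R)" unfolding E_def using Dc RC by auto
      have fE: "finite E" unfolding E_def using fin_carr[OF TT0] by simp
      have ED: "E \<inter> (D \<union> R) = {}" unfolding E_def by auto
      have split_imb: "imb (carr T) f = imb E f + (imb D f + imb R f)" for f
        unfolding cE using imb_Un[OF fE _ ED] imb_Un[OF Dfin Rfin DR] Dfin Rfin by simp
      have split_wt: "wt (carr T) f = wt E f + (wt D f + wt R f)" for f
        unfolding cE using wt_Un[OF fE _ ED] wt_Un[OF Dfin Rfin DR] Dfin Rfin by simp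
      have sD: "s' i = - s i" if "i \<in> D" for i using that by (simp add: s'_def)
      have sR: "s' i = z i" if "i \<in> R" for i using that DR by (auto simp: s'_def)
      have sE: "s' i = s i" if "i \<in> E" for i using that by (simp add: s'_def E_def)
      have im': "imb (carr T) s' = 0"
      proof -
        have "imb E s' = imb E s" "imb R s' = imb R z" by (auto intro!: imb_cong sE sR)
        moreover have "imb D s' = - imb D s" by (rule imb_minus) (rule sD)
        moreover have "imb (carr T) s = 0" using gs by (simp add: good_def)
        ultimately show ?thesis using split_imb[of s'] split_imb[of s] Dimb Zs(3)[OF z(1)] by simp
      qed
      have wt': "int n dvd wt (carr T) s'"
      proof -
        have "wt E s' = wt E s" "wt R s' = wt R z" by (auto intro!: wt_cong sE sR)
        moreover have "wt D s' = - wt D s" by (rule wt_minus) (rule sD)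
        ultimately have e: "wt (carr T) s' = wt (carr T) s + ((wt R z - wt R s) + sum t S)"
          using split_wt[of s'] split_wt[of s] Dwt by simp
        have "(z' + sum t S) mod int n = ((wt R z - wt R s) + sum t S) mod int n" unfolding z(2) by (simp add: mod_simps)
        then have "int n dvd (wt R z - wt R s) + sum t S" using dv by (simp add: dvd_eq_mod_eq_0)
        moreover have "int n dvd wt (carr T) s" using gs by (simp add: good_def)
        ultimately show ?thesis unfolding e by (rule dvd_add[rotated])
      qed
      have good': "good (carr T) s'" using ss' im' wt' by (simp add: good_def)
      have nullD: "imb (Y k) s' = 0" if k: "k \<in> N" for k
      proof -
        have kT: "k \<in> T" "k \<in> T0" using k NT TT0 by auto
        have fY: "finite (Y k)" using finY kT by auto
        have kR: "Y k \<inter> R = {}" using YNC[OF kT(1)] R(1) by blast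
        define B where "B = {b. Inl (k, b) \<in> S}"
        have YD: "Y k \<inter> D = \<Union>((\<lambda>b. grp (Inl (k, b))) ` B)"
        proof
          show "\<Union>((\<lambda>b. grp (Inl (k, b))) ` B) \<subseteq> Y k \<inter> D"
          proof
            fix x assume "x \<in> \<Union>((\<lambda>b. grp (Inl (k, b))) ` B)"
            then obtain b where b: "Inl (k, b) \<in> S" "x \<in> grp (Inl (k, b))" unfolding B_def by blast
            then show "x \<in> Y k \<inter> D" unfolding D_def using grpL[of k b] by blast
          qed
          show "Y k \<inter> D \<subseteq> \<Union>((\<lambda>b. grp (Inl (k, b))) ` B)"
          proof
            fix x assume x: "x \<in> Y k \<inter> D"
            then obtain g' where g': "g' \<in> S" "x \<in> grp g'" unfolding D_def by auto
            show "x \<in> \<Union>((\<lambda>b. grp (Inl (k, b))) ` B)"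
            proof (cases "\<exists>y. g' = Inr y \<and> y \<in> Up \<union> Fp")
              case True
              then have "x \<in> F \<union> \<Union>(U ` Act T s)" using grpRel g'(2) by blast
              moreover have "x \<notin> F" using x YNC[OF kT(1)] F(1) by blast
              ultimately show ?thesis using YN[OF k] x by blast
            next
              case False
              then obtain j b where jb: "g' = Inl (j, b)" "j \<in> N" using Vcases[of g'] g' S by blast
              have "x \<in> Y j" using g'(2) unfolding jb grpL by simp
              then have "j = k" using Ydisj[of j k] x jb NT TT0 kT by blast
              then show ?thesis using g' jb unfolding B_def by blast
            qed
          qed
        qed
        have "imb (Y k \<inter> D) s = (\<Sum>b\<in>B. imb (grp (Inl (k, b))) s)" unfolding YD
        proof (rule imb_UN)
          show "finite B" by simp
          show "finite (grp (Inl (k, b)))" if "b \<in> B" for b using Sfin that unfolding B_def by blast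
          show "grp (Inl (k, b)) \<inter> grp (Inl (k, c)) = {}" if "b \<in> B" "c \<in> B" "b \<noteq> c" for b c
            by (rule Sdisj) (use that in \<open>auto simp: B_def\<close>)
        qed
        also have "\<dots> = 0"
        proof (rule sum.neutral, rule ballI)
          fix b assume "b \<in> B"
          then have "Inl (k, b) \<in> V" using S(1) unfolding B_def by blast
          then show "imb (grp (Inl (k, b))) s = 0" by (rule grp_imb)
        qed
        finally have "imb (Y k \<inter> D) s = 0" .
        moreover have spl: "imb (Y k) f = imb (Y k - D) f + imb (Y k \<inter> D) f" for f
        proof -
          have "(Y k - D) \<inter> (Y k \<inter> D) = {}" by blast
          then have "imb ((Y k - D) \<union> (Y k \<inter> D)) f = imb (Y k - D) f + imb (Y k \<inter> D) f"
            by (intro imb_Un) (use fY in auto)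
          moreover have "(Y k - D) \<union> (Y k \<inter> D) = Y k" by blast
          ultimately show ?thesis by simp
        qed
        moreover have "imb (Y k - D) s' = imb (Y k - D) s" using kR by (intro imb_cong) (auto simp: s'_def)
        moreover have "imb (Y k \<inter> D) s' = - imb (Y k \<inter> D) s" by (rule imb_minus) (simp add: s'_def)
        moreover have "imb (Y k) s = 0" using k by (simp add: N_def Null_def)
        ultimately show ?thesis using spl[of s] spl[of s'] by simp
      qed
      \<comment> \<open>If only surplus terms of \<open>k\<close> change sign, the imbalance moves
        by \<open>2 * card (X k)\<close> towards its negative. As \<open>card (Phi k)\<close> is its
        absolute value, it does not grow in absolute value, and it shrinks unless \<open>X k\<close>
        is empty or all of \<open>Phi k\<close>.\<close>
      define X where "X k = {x \<in> Y k \<inter> Rf. s' x \<noteq> s x}" for k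
      have imbX: "imb (Y k) s' = imb (Y k) s - 2 * (sgn (imb (Y k) s) * int (card (X k)))"
        if k: "k \<in> Act T s" "X k \<subseteq> Phi k" for k
      proof -
        have fY: "finite (Y k \<inter> Rf)" using finY[OF Asub[OF k(1)]] by simp
        have XY: "X k \<subseteq> Y k \<inter> Rf" unfolding X_def by auto
        have "imb (Y k) s' = sum s' (Y k \<inter> Rf - X k) + sum s' (X k)" unfolding imb_def by (rule sum.subset_diff[OF XY fY])
        also have "sum s' (Y k \<inter> Rf - X k) = sum s (Y k \<inter> Rf - X k)" by (rule sum.cong) (auto simp: X_def)
        also have "sum s' (X k) = - sum s (X k)" unfolding sum_negf[symmetric]
        proof (rule sum.cong[OF refl])
          fix x assume "x \<in> X k"
          then show "s' x = - s x" using signingD[OF sg, of x] signingD[OF ss', of x] unfolding X_def by auto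
        qed
        also have "sum s (Y k \<inter> Rf - X k) = imb (Y k) s - sum s (X k)" unfolding imb_def using sum.subset_diff[OF XY fY, of s] by simp
        also have "sum s (X k) = sgn (imb (Y k) s) * int (card (X k))" using k Phi(3)[OF k(1)] by (simp add: subset_iff)
        finally show ?thesis by simp
      qed
      have alt: "(k \<in> Sg \<and> Y k \<subseteq> R \<and> Y k \<inter> D = {} \<and> \<bar>imb (Y k) s'\<bar> \<le> \<bar>imb (Y k) s\<bar> \<and> (k \<in> Act T s \<longrightarrow> U k = {}))
          \<or> (k \<in> Act T s \<and> X k \<subseteq> Phi k) \<or> (k \<notin> Act T s \<and> X k = {})" if k: "k \<in> T \<union> Sg" "k \<notin> N" for k
      proof (cases "k \<in> Sg \<and> Y k \<subseteq> R \<and> (k \<in> Act T s \<longrightarrow> U k = {}) \<and> \<bar>imb (Y k) z\<bar> \<le> \<bar>imb (Y k) s\<bar>")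
        case True
        have "imb (Y k) s' = imb (Y k) z" by (rule imb_cong) (use True sR in blast)
        then show ?thesis using True DR by auto
      next
        case False
        have xR: "k \<in> Act T s \<and> x \<in> Phi k" if x: "x \<in> X k" "x \<in> R" for x
        proof -
          have "k \<in> Sg" using x k R(1) YNC[of k] unfolding X_def by blast
          then have "\<forall>x\<in>Y k \<inter> R \<inter> Rf. z x \<noteq> s x \<longrightarrow> k \<in> Act T s \<and> x \<in> Phi k" using Zs(4)[OF z(1)] False by blast
          then show ?thesis using x sR[OF x(2)] unfolding X_def by auto
        qed
        have xD: "k \<in> Act T s \<and> x \<in> Phi k" if x: "x \<in> X k" "x \<in> D" for x
        proof -
          obtain g' where g': "g' \<in> S" "x \<in> grp g'" using x unfolding D_def by auto
          show ?thesis
          proof (cases "\<exists>y. g' = Inr y \<and> y \<in> Up \<union> Fp")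
            case True
            then have "x \<in> F \<union> \<Union>(U ` Act T s)" using grpRel g'(2) by blast
            then show ?thesis
            proof
              assume xF: "x \<in> F"
              then have "k \<in> Sg" using x k F(1) YNC[of k] unfolding X_def by blast
              then show ?thesis using xF F(3) F(4) x unfolding X_def by blast
            next
              assume "x \<in> \<Union>(U ` Act T s)"
              then obtain j where j: "j \<in> Act T s" "x \<in> U j" by blast
              have "j = k" using Ydisj[of j k] UY[OF j(1)] j x k Asub TT0 unfolding X_def by blast
              then show ?thesis using j U(1) by blast
            qed
          next
            case False
            then obtain j b where jb: "g' = Inl (j, b)" "j \<in> N" using Vcases[of g'] g' S by blast
            have "x \<in> Y j" using g'(2) unfolding jb grpL by simp
            then have "j = k" using Ydisj[of j k] x jb NT TT0 k unfolding X_def by blast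
            then show ?thesis using k jb by simp
          qed
        qed
        have "k \<in> Act T s \<and> x \<in> Phi k" if "x \<in> X k" for x
          using xR[OF that] xD[OF that] that by (cases "x \<in> D"; cases "x \<in> R") (auto simp: X_def s'_def)
        then show ?thesis by blast
      qed
      have mono: "\<bar>imb (Y k) s'\<bar> \<le> \<bar>imb (Y k) s\<bar>" if k: "k \<in> T \<union> Sg" for k
      proof (cases "k \<in> N")
        case True then show ?thesis using nullD by simp
      next
        case False
        from alt[OF k this] consider "\<bar>imb (Y k) s'\<bar> \<le> \<bar>imb (Y k) s\<bar>" | "k \<in> Act T s" "X k \<subseteq> Phi k"
          | "k \<notin> Act T s" "X k = {}" by blast
        then show ?thesis
        proof cases
          case 2
          have "card (X k) \<le> card (Phi k)" using 2 Phi(1)[OF 2(1)] finY[OF Asub[OF 2(1)]]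
            by (meson card_mono finite_Int finite_subset)
          then have "int (card (X k)) \<le> \<bar>imb (Y k) s\<bar>" using Phi(2)[OF 2(1)] by linarith
          then show ?thesis unfolding imbX[OF 2] by (cases "imb (Y k) s" "0 :: int" rule: linorder_cases) auto
        next
          case 3
          then have "imb (Y k) s' = imb (Y k) s" by (intro imb_cong) (auto simp: X_def)
          then show ?thesis by simp
        qed auto
      qed
      obtain j where j: "j \<in> cls g" "j \<in> cls h" using S(4) unfolding share_def by blast
      have gV: "g \<in> V" and hV: "h \<in> V" using S by auto
      show False
      proof (cases "j \<in> N")
        case True
        have inl: "\<exists>b. f = Inl (j, b)" if f: "f \<in> V" "j \<in> cls f" for f
        proof (cases "\<exists>x. f = Inr x \<and> x \<in> Up \<union> Fp")
          case True
          then show ?thesis using f(2) clsR NAct[OF \<open>j \<in> N\<close>] by auto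
        next
          case False then show ?thesis using Vcases[OF f(1) False] f(2) clsL by auto
        qed
        obtain b where b: "g = Inl (j, b)" using inl[OF gV j(1)] by blast
        obtain c where c: "h = Inl (j, c)" using inl[OF hV j(2)] by blast
        \<comment> \<open>Exactly one half of \<open>Y j\<close> is flipped. On \<open>Y j\<close>
          the new signing then agrees with \<open>sig j\<close> up to a global sign, so
          \<open>Y j\<close> is good by itself and can be taken out of \<open>T\<close>.\<close>
        have "c \<noteq> b" using b c S(2,3) by blast
        then have bc: "c = (\<not> b)" by auto
        have jT: "j \<in> T" "j \<in> T0" using True NT TT0 by auto
        have sj: "signing (sig j)" using sig[OF jT(2)] by (simp add: good_def)
        have inD: "x \<in> D \<longleftrightarrow> (s x = sig j x) = b" if x: "x \<in> Y j" for x
        proof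
          assume "(s x = sig j x) = b"
          then have "x \<in> grp g" unfolding b grpL using x by simp
          then show "x \<in> D" unfolding D_def using S(2) by blast
        next
          assume "x \<in> D"
          then obtain g' where g': "g' \<in> S" "x \<in> grp g'" unfolding D_def by auto
          show "(s x = sig j x) = b"
          proof (rule ccontr)
            assume "\<not> ?thesis"
            then have "x \<in> grp h" unfolding c grpL bc using x by auto
            then have "g' = h" using grp_disj[of g' h] g' S hV by blast
            then show False using g' S by blast
          qed
        qed
        have kR: "Y j \<inter> R = {}" using YNC[OF jT(1)] R(1) by blast
        have sj': "s' x = (if b then - sig j x else sig j x)" if x: "x \<in> Y j" for x
        proof -
          have "x \<notin> R" using kR x by blast
          then show ?thesis using inD[OF x] signingD[OF sg, of x] signingD[OF sj, of x] unfolding s'_def by auto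
        qed
        have wtj: "int n dvd wt (Y j) s'"
        proof -
          have "wt (Y j) s' = (if b then - wt (Y j) (sig j) else wt (Y j) (sig j))"
            using sj' by (auto intro: wt_minus wt_cong)
          then show ?thesis using sig[OF jT(2)] by (simp add: good_def)
        qed
        have ca: "carr (T - {j}) = carr T - Y j"
        proof -
          have "Y k \<inter> Y j = {}" if "k \<in> T - {j}" for k using Ydisj that jT TT0 by blast
          then show ?thesis unfolding carr_def using YNC[OF jT(1)] jT(1) by blast
        qed
        have Yc: "Y j \<subseteq> carr T" unfolding carr_def using jT by blast
        have "good (carr (T - {j})) s'" unfolding ca good_def
          using good' nullD[OF True] wtj imb_Diff[OF fin_carr[OF TT0] Yc] wt_Diff[OF fin_carr[OF TT0] Yc]
          by (simp add: good_def)
        then have "mu T s \<le> mu (T - {j}) s'" using mn TT0 by blast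
        moreover have "mu (T - {j}) s' < mu T s"
        proof -
          have "(\<Sum>k\<in>T - {j}. 1 + \<bar>imb (Y k) s'\<bar>) \<le> (\<Sum>k\<in>T - {j}. 1 + \<bar>imb (Y k) s\<bar>)"
            by (rule sum_mono) (use mono in auto)
          moreover have "(\<Sum>k\<in>Sg. \<bar>imb (Y k) s'\<bar>) \<le> (\<Sum>k\<in>Sg. \<bar>imb (Y k) s\<bar>)"
            by (rule sum_mono) (use mono in auto)
          moreover have "(\<Sum>k\<in>T. 1 + \<bar>imb (Y k) s\<bar>) = (1 + \<bar>imb (Y j) s\<bar>) + (\<Sum>k\<in>T - {j}. 1 + \<bar>imb (Y k) s\<bar>)"
            by (rule sum.remove[OF fT jT(1)])
          ultimately show ?thesis unfolding mu_def by linarith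
        qed
        ultimately show False by simp
      next
        case False
        have inr: "\<exists>x. f = Inr x \<and> x \<in> Up \<union> Fp \<and> j \<in> Act T s \<and> U j \<inter> grp f \<noteq> {}" if f: "f \<in> V" "j \<in> cls f" for f
        proof (cases "\<exists>x. f = Inr x \<and> x \<in> Up \<union> Fp")
          case True
          then show ?thesis using f(2) clsR grpR by auto
        next
          case F: False then show ?thesis using Vcases[OF f(1) F] f(2) clsL False by auto
        qed
        \<comment> \<open>The surplus term \<open>y\<close> of block \<open>j\<close> is flipped and
          the surplus term \<open>w\<close> is not; hence \<open>X j\<close> is a nonempty proper
          part of \<open>Phi j\<close>.\<close>
        obtain x where x: "g = Inr x" "x \<in> Up \<union> Fp" "j \<in> Act T s" "U j \<inter> grp g \<noteq> {}" using inr[OF gV j(1)] by blast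
        have hj: "U j \<inter> grp h \<noteq> {}" using inr[OF hV j(2)] by blast
        obtain y where y: "y \<in> U j" "y \<in> grp g" using x by blast
        obtain w where w: "w \<in> U j" "w \<in> grp h" using hj by blast
        have jTS: "j \<in> T \<union> Sg" using x(3) unfolding Act_def by auto
        have yD: "y \<in> D" using y S(2) unfolding D_def by blast
        have yX: "y \<in> X j" using y(1) UY[OF x(3)] yD signingD[OF sg, of y] unfolding X_def s'_def by auto
        have wnD: "w \<notin> D"
        proof
          assume "w \<in> D"
          then obtain g' where g': "g' \<in> S" "w \<in> grp g'" unfolding D_def by auto
          then have "g' = h" using grp_disj[of g' h] S hV w by blast
          then show False using g' S by blast
        qed
        have "w \<notin> R" using R(3)[OF x(3)] w by blast
        then have wX: "w \<notin> X j" using wnD unfolding X_def s'_def by auto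
        have Xsub: "X j \<subseteq> Phi j" using alt[OF jTS False] yD y UY[OF x(3)] x(3) by blast
        have wP: "w \<in> Phi j" using w U(1)[OF x(3)] by blast
        have fP: "finite (Phi j)" using Phi(1)[OF x(3)] finY[OF Asub[OF x(3)]] by (meson finite_Int finite_subset)
        have "card (X j) < card (Phi j)" by (rule psubset_card_mono[OF fP]) (use Xsub wP wX in blast)
        then have c1: "int (card (X j)) < \<bar>imb (Y j) s\<bar>" using Phi(2)[OF x(3)] by linarith
        have "finite (X j)" by (rule finite_subset[OF Xsub fP])
        then have c2: "card (X j) > 0" using yX by (auto simp: card_gt_0_iff)
        have strict: "\<bar>imb (Y j) s'\<bar> < \<bar>imb (Y j) s\<bar>"
          unfolding imbX[OF x(3) Xsub] using c1 c2 by (cases "imb (Y j) s" "0 :: int" rule: linorder_cases) auto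
        have "mu T s' < mu T s"
        proof (cases "j \<in> T")
          case True
          have "(\<Sum>k\<in>T. 1 + \<bar>imb (Y k) s'\<bar>) < (\<Sum>k\<in>T. 1 + \<bar>imb (Y k) s\<bar>)"
            by (rule sum_strict_mono_ex1[OF fT]) (use mono strict True in auto)
          moreover have "(\<Sum>k\<in>Sg. \<bar>imb (Y k) s'\<bar>) \<le> (\<Sum>k\<in>Sg. \<bar>imb (Y k) s\<bar>)"
            by (rule sum_mono) (use mono in auto)
          ultimately show ?thesis unfolding mu_def by linarith
        next
          case F: False
          have "(\<Sum>k\<in>T. 1 + \<bar>imb (Y k) s'\<bar>) \<le> (\<Sum>k\<in>T. 1 + \<bar>imb (Y k) s\<bar>)"
            by (rule sum_mono) (use mono in auto)
          moreover have "(\<Sum>k\<in>Sg. \<bar>imb (Y k) s'\<bar>) < (\<Sum>k\<in>Sg. \<bar>imb (Y k) s\<bar>)"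
            by (rule sum_strict_mono_ex1[OF finSg]) (use mono strict F jTS in auto)
          ultimately show ?thesis unfolding mu_def by linarith
        qed
        moreover have "mu T s \<le> mu T s'" using mn[OF TT0 good'] .
        ultimately show False by simp
      qed
    qed
  qed
  moreover have "card V = 2 * card N + (card Up + card Fp)"
  proof -
    have "card V = card (Inl ` (N \<times> (UNIV :: bool set)) :: ('j \<times> bool + 'i) set) + card (Inr ` (Up \<union> Fp) :: ('j \<times> bool + 'i) set)"
      unfolding V_def by (rule card_Un_disjoint) (use finN finUU finFF in auto)
    also have "\<dots> = card (N \<times> (UNIV :: bool set)) + card (Up \<union> Fp)" by (simp add: card_image)
    also have "\<dots> = 2 * card N + (card Up + card Fp)"
      using finUU finFF disjs by (simp add: card_Un_disjoint card_cartesian_product)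
    finally show ?thesis .
  qed
  ultimately show ?thesis unfolding Z_def N_def by simp
qed

end

text \<open>The supply \<open>C\<close> is used as far as pairs with surplus terms allow. Either all
  of it is used and every term is paired, so that the pairs number half of all terms, or it is so
  large that each surplus term gets its own partner from it and the pairs number
  \<open>wp + wm\<close>.\<close>

lemma (in signed_index) choose_supply:
  assumes fin: "finite C" and s: "signing s"
    and eq: "wp + card (C \<inter> {x. s x = 1}) = wm + card (C \<inter> {x. s x = -1})"
  obtains F where "F \<subseteq> C" "card (F \<inter> {x. s x = 1}) \<le> wm" "card (F \<inter> {x. s x = -1}) \<le> wp"
    "wp + card (F \<inter> {x. s x = 1}) = wm + card (F \<inter> {x. s x = -1})"
    "2 * (wp + card (F \<inter> {x. s x = 1})) = wp + wm + card C \<or> card (F \<inter> {x. s x = 1}) = wm"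
proof (cases "card (C \<inter> {x. s x = 1}) \<le> wm")
  case True
  have "C = (C \<inter> {x. s x = 1}) \<union> (C \<inter> {x. s x = -1})" using signingD[OF s] by auto
  also have "card \<dots> = card (C \<inter> {x. s x = 1}) + card (C \<inter> {x. s x = -1})"
    by (rule card_Un_disjoint) (use fin in auto)
  finally have "card C = card (C \<inter> {x. s x = 1}) + card (C \<inter> {x. s x = -1})" .
  then show ?thesis by (intro that[of C]) (use True eq in auto)
next
  case False
  then obtain A where A: "A \<subseteq> C \<inter> {x. s x = 1}" "card A = wm" by (metis nat_le_linear obtain_subset_with_card_n)
  have "wp \<le> card (C \<inter> {x. s x = -1})" using False eq by simp
  then obtain B where B: "B \<subseteq> C \<inter> {x. s x = -1}" "card B = wp" by (metis obtain_subset_with_card_n)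
  have "(A \<union> B) \<inter> {x. s x = 1} = A" "(A \<union> B) \<inter> {x. s x = -1} = B" using A B by auto
  then show ?thesis by (intro that[of "A \<union> B"]) (use A B in auto)
qed

text \<open>Reversing the signs of the items in a prefix changes the weight by minus twice the
  prefix sum of \<open>w\<close>. As \<open>n\<close> is odd, the factor 2 cancels, so zero-sum
  freeness makes these values distinct; they supply the residues of re-signings in
  \<open>pair_bound\<close>.\<close>

lemma (in signed_index) chain_card:
  fixes w :: "'k \<Rightarrow> int" and h :: "'k set \<Rightarrow> int"
  assumes L: "distinct L" and zf: "\<And>B. B \<noteq> {} \<Longrightarrow> B \<subseteq> set L \<Longrightarrow> \<not> int n dvd sum w B"
    and h: "\<And>B. B \<subseteq> set L \<Longrightarrow> int n dvd h B - (c - 2 * sum w B)"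
  shows "card ((\<lambda>l. h (set (take l L)) mod int n) ` {..length L}) = length L + 1"
proof -
  have *: "h (set (take i L)) mod int n \<noteq> h (set (take j L)) mod int n" if ij: "i < j" "j \<le> length L" for i j
  proof
    assume "h (set (take i L)) mod int n = h (set (take j L)) mod int n"
    then have d: "int n dvd h (set (take i L)) - h (set (take j L))" by (simp add: mod_eq_dvd_iff)
    define B where "B = set (take j L) - set (take i L)"
    have sub: "set (take i L) \<subseteq> set (take j L)" using ij by (simp add: set_take_subset_set_take)
    have dB: "sum w B = sum w (set (take j L)) - sum w (set (take i L))" unfolding B_def using sub by (simp add: sum_diff)
    have s1: "set (take k L) \<subseteq> set L" for k by (rule set_take_subset)
    have "int n dvd 2 * sum w B"
      using dvd_add[OF dvd_diff[OF h[OF s1[of j]] h[OF s1[of i]]] d] unfolding dB by (simp add: algebra_simps)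
    then have "int n dvd sum w B" by (simp add: dvd_double)
    moreover have "B \<noteq> {}"
    proof -
      have "card (set (take i L)) = i" "card (set (take j L)) = j" using ij L by (simp_all add: distinct_card)
      then show ?thesis unfolding B_def using ij sub by (metis Diff_eq_empty_iff less_irrefl subset_antisym)
    qed
    moreover have "B \<subseteq> set L" unfolding B_def using s1 by blast
    ultimately show False using zf by blast
  qed
  have "inj_on (\<lambda>l. h (set (take l L)) mod int n) {..length L}"
  proof (rule inj_onI)
    fix i j assume "i \<in> {..length L}" "j \<in> {..length L}" "h (set (take i L)) mod int n = h (set (take j L)) mod int n"
    then show "i = j" using *[of i j] *[of j i] by (metis atMost_iff linorder_neqE_nat)
  qed
  then show ?thesis by (simp add: card_image)
qed

lemma (in signed_index) ex_balanced:
  assumes "finite Q" "Q \<subseteq> Rf" "even (card Q)"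
  obtains g where "signing g" "imb Q g = 0"
proof -
  obtain P where P: "P \<subseteq> Q" "card P = card Q div 2" by (metis div_le_dividend obtain_subset_with_card_n)
  define g where "g i = (if i \<in> P then 1 else -1 :: int)" for i
  have "imb Q g = sum g P + sum g (Q - P)" unfolding imb_def using assms P
    by (metis Int_absorb2 add.commute sum.subset_diff)
  also have "sum g P = int (card P)" by (simp add: g_def)
  also have "sum g (Q - P) = - int (card (Q - P))" by (simp add: g_def)
  also have "card (Q - P) = card Q - card P" using P assms by (meson card_Diff_subset finite_subset)
  finally have "imb Q g = 0" using P assms by auto
  moreover have "signing g" by (simp add: signing_def g_def)
  ultimately show ?thesis using that by blast
qed

lemma (in signed_index) even_card_good: "finite X \<Longrightarrow> good X s \<Longrightarrow> even (card (X \<inter> Rf))"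
  using imb_card[of X s] card_Rf_split[of X s] by (auto simp: good_def)

lemma (in signed_index) even_imb: "finite X \<Longrightarrow> signing s \<Longrightarrow> even (imb X s) \<longleftrightarrow> even (card (X \<inter> Rf))"
  using imb_card[of X s] card_Rf_split[of X s] by (auto simp: even_diff_iff)

text \<open>
  A block of odd imbalance keeps one surplus reflection, its \<open>core\<close>, out of \<open>U\<close>. \<open>Cf\<close> below consists of
  the reflections of \<open>C0\<close> outside all \<open>U j\<close> that may change sign without increasing any imbalance.
\<close>
locale minimal_flip_state = flip_state n val Rf C0 T0 Sg Y
  for n :: nat and val :: "'i \<Rightarrow> int" and Rf C0 and T0 Sg :: "'j set" and Y +
  fixes T :: "'j set" and s :: "'i \<Rightarrow> int" and Phi U :: "'j \<Rightarrow> 'i set" and core :: "'j \<Rightarrow> 'i"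
  assumes st: "minimal_state T s"
    and Phi: "j \<in> Act T s \<Longrightarrow> Phi j \<subseteq> Y j \<inter> Rf"
      "j \<in> Act T s \<Longrightarrow> int (card (Phi j)) = \<bar>imb (Y j) s\<bar>"
      "j \<in> Act T s \<Longrightarrow> x \<in> Phi j \<Longrightarrow> s x = sgn (imb (Y j) s)"
    and Ueven: "j \<in> Act T s \<Longrightarrow> even (imb (Y j) s) \<Longrightarrow> U j = Phi j"
    and Uodd: "j \<in> Act T s \<Longrightarrow> odd (imb (Y j) s) \<Longrightarrow> core j \<in> Phi j \<and> U j = Phi j - {core j}"
begin

definition Up where "Up = \<Union>(U ` Act T s) \<inter> {x. s x = 1}"
definition Um where "Um = \<Union>(U ` Act T s) \<inter> {x. s x = -1}"
definition Od where "Od = {j \<in> Sg. odd (imb (Y j) s)}"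
definition Cf where "Cf = (C0 \<inter> Rf - \<Union>(Y ` Sg)) \<union> core ` Od"

lemma TT0: "T \<subseteq> T0" and gs: "good (carr T) s" using st by (auto simp: minimal_state_def)
lemma sg: "signing s" using gs by (simp add: good_def)
lemma fT: "finite T" using finT[OF TT0] .
lemma fA: "finite (Act T s)" unfolding Act_def using fT finSg by simp
lemma Asub: "j \<in> Act T s \<Longrightarrow> j \<in> T0 \<union> Sg" using TT0 unfolding Act_def by auto

lemma OdA: "j \<in> Od \<Longrightarrow> j \<in> Act T s" unfolding Od_def Act_def by auto

lemma UPhi: "j \<in> Act T s \<Longrightarrow> U j \<subseteq> Phi j" using Ueven Uodd by (cases "even (imb (Y j) s)") auto

lemma UY: "j \<in> Act T s \<Longrightarrow> U j \<subseteq> Y j \<inter> Rf" using UPhi Phi(1) by blast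

lemma finPhi: "j \<in> Act T s \<Longrightarrow> finite (Phi j)"
  using Phi(1) finY[OF Asub] by (meson finite_Int finite_subset)

lemma finU: "j \<in> Act T s \<Longrightarrow> finite (U j)" using UPhi finPhi finite_subset by blast

lemma cardU: "j \<in> Act T s \<Longrightarrow> int (card (U j)) = \<bar>imb (Y j) s\<bar> - (if odd (imb (Y j) s) then 1 else 0)"
proof (cases "odd (imb (Y j) s)")
  case True
  assume j: "j \<in> Act T s"
  have c: "core j \<in> Phi j" "U j = Phi j - {core j}" using Uodd[OF j True] by auto
  have "card (Phi j) = Suc (card (U j))" using c finPhi[OF j] by (metis card.remove)
  then show ?thesis using Phi(2)[OF j] True by simp
next
  case False
  assume j: "j \<in> Act T s"
  then show ?thesis using Ueven[OF j] Phi(2)[OF j] False by simp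
qed

text \<open>Leaving out the core makes \<open>card (U j)\<close> even, so no \<open>U j\<close> is a
  singleton, as \<open>pair_bound\<close> demands.\<close>

lemma U2: "j \<in> Act T s \<Longrightarrow> U j = {} \<or> 2 \<le> card (U j)"
proof -
  assume j: "j \<in> Act T s"
  have "even (int (card (U j)))" unfolding cardU[OF j] by auto
  then have "even (card (U j))" by simp
  then have "card (U j) \<noteq> 1" by auto
  then have "card (U j) = 0 \<or> 2 \<le> card (U j)" by linarith
  then show ?thesis using finU[OF j] by simp
qed

lemma evenT: "j \<in> T \<Longrightarrow> even (imb (Y j) s)"
proof -
  assume "j \<in> T"
  then have j: "j \<in> T0" using TT0 by auto
  then obtain s' where "good (Y j) s'" using T0good by blast
  then show ?thesis using even_card_good even_imb[OF _ sg] finY j by blast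
qed

lemma Udisj: "j \<in> Act T s \<Longrightarrow> k \<in> Act T s \<Longrightarrow> j \<noteq> k \<Longrightarrow> U j \<inter> U k = {}"
  using Ydisj[OF Asub Asub] UY by blast

lemma core_in: "j \<in> Od \<Longrightarrow> core j \<in> Phi j" using Uodd OdA unfolding Od_def by blast

lemma core_Y: "j \<in> Od \<Longrightarrow> core j \<in> Y j \<inter> Rf" using core_in Phi(1) OdA by blast

lemma core_sgn: "j \<in> Od \<Longrightarrow> s (core j) = sgn (imb (Y j) s)" using core_in Phi(3) OdA by blast

lemma core_inj: "inj_on core Od"
proof (rule inj_onI)
  fix j k assume jk: "j \<in> Od" "k \<in> Od" "core j = core k"
  then have "core j \<in> Y j \<inter> Y k" using core_Y by fastforce
  then show "j = k" using Ydisj[of j k] jk unfolding Od_def by blast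
qed

lemma Cf_C0: "Cf \<subseteq> C0 \<inter> Rf"
  unfolding Cf_def using core_Y SgC0 unfolding Od_def by blast

lemma finCf: "finite Cf" using Cf_C0 finC0 by (meson finite_Int finite_subset)

lemma Cf_U: "j \<in> Act T s \<Longrightarrow> Cf \<inter> U j = {}"
proof -
  assume j: "j \<in> Act T s"
  have "x \<notin> U j" if x: "x \<in> C0 \<inter> Rf - \<Union>(Y ` Sg)" for x
  proof
    assume "x \<in> U j"
    then have xY: "x \<in> Y j" using UY[OF j] by blast
    then have "j \<notin> Sg" using x by blast
    then have "j \<in> T0" using Asub[OF j] by blast
    then show False using T0C0 xY x by blast
  qed
  moreover have "core k \<notin> U j" if k: "k \<in> Od" for k
  proof (cases "k = j")
    case True then show ?thesis using Uodd[OF j] k unfolding Od_def by blast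
  next
    case False
    then have "Y k \<inter> Y j = {}" using Ydisj[OF _ Asub[OF j]] k unfolding Od_def by blast
    then show ?thesis using core_Y[OF k] UY[OF j] by blast
  qed
  ultimately show ?thesis unfolding Cf_def by blast
qed

lemma Cf_Y: "j \<in> Sg \<Longrightarrow> x \<in> Cf \<Longrightarrow> x \<in> Y j \<Longrightarrow> j \<in> Act T s \<and> j \<in> Od \<and> x = core j \<and> x \<in> Phi j"
proof -
  assume j: "j \<in> Sg" and x: "x \<in> Cf" "x \<in> Y j"
  then obtain k where k: "k \<in> Od" "x = core k" unfolding Cf_def by blast
  then have "k = j" using Ydisj[of k j] core_Y[OF k(1)] x j unfolding Od_def by blast
  then show ?thesis using k OdA core_in by blast
qed

lemma finUp: "finite Up" "finite Um" unfolding Up_def Um_def using fA finU by auto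

lemma Usum: "card Up + card Um = (\<Sum>j\<in>Act T s. card (U j))"
  "int (card Up) - int (card Um) = (\<Sum>j\<in>Act T s. sgn (imb (Y j) s) * int (card (U j)))"
proof -
  have e: "\<Union>(U ` Act T s) = Up \<union> Um" unfolding Up_def Um_def using signingD[OF sg] by auto
  have d: "Up \<inter> Um = {}" unfolding Up_def Um_def by auto
  have dis: "\<forall>i\<in>Act T s. \<forall>j\<in>Act T s. i \<noteq> j \<longrightarrow> U i \<inter> U j = {}" using Udisj by blast
  have "card (\<Union>(U ` Act T s)) = (\<Sum>j\<in>Act T s. card (U j))"
    by (rule card_UN_disjoint) (use fA finU dis in auto)
  then show "card Up + card Um = (\<Sum>j\<in>Act T s. card (U j))"
    unfolding e using finUp d by (simp add: card_Un_disjoint)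
  have "sum s (\<Union>(U ` Act T s)) = sum s Up + sum s Um"
    unfolding e using finUp d by (simp add: sum.union_disjoint)
  also have "sum s Up = int (card Up)" by (simp add: Up_def)
  also have "sum s Um = - int (card Um)" by (simp add: Um_def)
  finally have a: "sum s (\<Union>(U ` Act T s)) = int (card Up) - int (card Um)" by simp
  have "sum s (\<Union>(U ` Act T s)) = (\<Sum>j\<in>Act T s. sum s (U j))"
    by (rule sum.UNION_disjoint) (use fA finU dis in auto)
  also have "\<dots> = (\<Sum>j\<in>Act T s. sgn (imb (Y j) s) * int (card (U j)))"
  proof (rule sum.cong[OF refl])
    fix j assume j: "j \<in> Act T s"
    have "sum s (U j) = (\<Sum>x\<in>U j. sgn (imb (Y j) s))"
      by (rule sum.cong[OF refl]) (use Phi(3)[OF j] UPhi[OF j] in blast)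
    then show "sum s (U j) = sgn (imb (Y j) s) * int (card (U j))" by simp
  qed
  finally show "int (card Up) - int (card Um) = (\<Sum>j\<in>Act T s. sgn (imb (Y j) s) * int (card (U j)))" using a by simp
qed

lemma imb_Y: "j \<in> T \<union> Sg \<Longrightarrow> imb (Y j) s = (if j \<in> Act T s then sgn (imb (Y j) s) * int (card (U j)) else 0)
    + (if j \<in> Od then s (core j) else 0)"
proof -
  assume j: "j \<in> T \<union> Sg"
  show ?thesis
  proof (cases "j \<in> Act T s")
    case False
    then have z: "imb (Y j) s = 0" using j unfolding Act_def by blast
    then have "j \<notin> Od" unfolding Od_def by simp
    then show ?thesis using False z by simp
  next
    case True
    have "odd (imb (Y j) s) \<longleftrightarrow> j \<in> Od"
      using j evenT unfolding Od_def by auto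
    then show ?thesis using True cardU[OF True] core_sgn[of j]
      by (auto simp: sgn_if abs_if)
  qed
qed

text \<open>The signs of the reflections of \<open>carr T\<close> sum to 0. A block contributes the
  signed size of its \<open>U j\<close> and, if its imbalance is odd, the sign of its core; the
  reflections of \<open>C0\<close> outside the blocks contribute the rest. So surplus and supply
  together are balanced, which is what the matching requires.\<close>

lemma balance: "card Up + card (Cf \<inter> {x. s x = 1}) = card Um + card (Cf \<inter> {x. s x = -1})"
proof -
  let ?B = "C0 - \<Union>(Y ` Sg)"
  have fB: "finite ?B" using finC0 by simp
  have fS: "finite (\<Union>(Y ` Sg))" using finSg finY by auto
  have fTY: "finite (\<Union>(Y ` T))" using fT finY TT0 by auto
  have d1: "C0 \<inter> \<Union>(Y ` T) = {}" using T0C0 TT0 by blast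
  have "imb (carr T) s = imb C0 s + imb (\<Union>(Y ` T)) s" unfolding carr_def
    by (rule imb_Un[OF finC0 fTY d1])
  moreover have "imb (\<Union>(Y ` T)) s = (\<Sum>j\<in>T. imb (Y j) s)"
    by (rule imb_UN[OF fT]) (use finY TT0 Ydisj in blast)+
  moreover have "imb C0 s = imb ?B s + imb (\<Union>(Y ` Sg)) s"
  proof -
    have "C0 = ?B \<union> \<Union>(Y ` Sg)" using SgC0 by blast
    then show ?thesis using imb_Un[OF fB fS, of s] by (metis Diff_disjoint Int_commute)
  qed
  moreover have "imb (\<Union>(Y ` Sg)) s = (\<Sum>j\<in>Sg. imb (Y j) s)"
    by (rule imb_UN[OF finSg]) (use finY Ydisj in blast)+
  moreover have "imb (carr T) s = 0" using gs by (simp add: good_def)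
  ultimately have z: "imb ?B s + ((\<Sum>j\<in>T. imb (Y j) s) + (\<Sum>j\<in>Sg. imb (Y j) s)) = 0" by simp
  have TS: "T \<inter> Sg = {}" using T0Sg TT0 by blast
  have "(\<Sum>j\<in>T. imb (Y j) s) + (\<Sum>j\<in>Sg. imb (Y j) s) = (\<Sum>j\<in>T \<union> Sg. imb (Y j) s)"
    by (rule sum.union_disjoint[symmetric, OF fT finSg TS])
  also have "\<dots> = (\<Sum>j\<in>T \<union> Sg. (if j \<in> Act T s then sgn (imb (Y j) s) * int (card (U j)) else 0)
    + (if j \<in> Od then s (core j) else 0))"
    by (rule sum.cong[OF refl]) (rule imb_Y)
  also have "\<dots> = (\<Sum>j\<in>Act T s. sgn (imb (Y j) s) * int (card (U j))) + (\<Sum>j\<in>Od. s (core j))"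
  proof -
    have e: "(T \<union> Sg) \<inter> Act T s = Act T s" "(T \<union> Sg) \<inter> Od = Od" by (auto simp: Act_def Od_def)
    have f: "finite (T \<union> Sg)" using fT finSg by simp
    show ?thesis unfolding sum.distrib sum.inter_restrict[OF f, symmetric] e by simp
  qed
  finally have q: "(\<Sum>j\<in>T. imb (Y j) s) + (\<Sum>j\<in>Sg. imb (Y j) s)
      = int (card Up) - int (card Um) + (\<Sum>j\<in>Od. s (core j))" using Usum(2) by simp
  have fOd: "finite Od" unfolding Od_def using finSg by simp
  have "imb Cf s = sum s Cf" unfolding imb_def using Cf_C0 by (simp add: Int_absorb2)
  also have "\<dots> = sum s (C0 \<inter> Rf - \<Union>(Y ` Sg)) + sum s (core ` Od)" unfolding Cf_def
    by (rule sum.union_disjoint) (use finC0 fOd core_Y in \<open>auto simp: Od_def\<close>)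
  also have "sum s (C0 \<inter> Rf - \<Union>(Y ` Sg)) = imb ?B s" unfolding imb_def by (rule sum.cong) auto
  also have "sum s (core ` Od) = (\<Sum>j\<in>Od. s (core j))" by (rule sum.reindex_cong[OF core_inj]) auto
  finally have "int (card Up) - int (card Um) + imb Cf s = 0" using z q by simp
  moreover have "imb Cf s = int (card (Cf \<inter> {x. s x = 1})) - int (card (Cf \<inter> {x. s x = -1}))"
    using imb_card[OF finCf sg] Cf_C0 by (simp add: Int_absorb2)
  ultimately show ?thesis by linarith
qed

lemma U_lower: "2 * card {j \<in> Act T s. U j \<noteq> {}} \<le> card Up + card Um"
proof -
  have "2 * card {j \<in> Act T s. U j \<noteq> {}} = (\<Sum>j\<in>{j \<in> Act T s. U j \<noteq> {}}. 2)" by simp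
  also have "\<dots> \<le> (\<Sum>j\<in>{j \<in> Act T s. U j \<noteq> {}}. card (U j))" by (rule sum_mono) (use U2 in blast)
  also have "\<dots> \<le> (\<Sum>j\<in>Act T s. card (U j))" by (rule sum_mono2) (use fA in auto)
  finally show ?thesis using Usum(1) by simp
qed

text \<open>The blocks of \<open>Sg\<close> whose imbalance is at least 2 in absolute value. They
  cannot be re-signed as a whole, because \<open>R\<close> has to avoid the surplus terms, but
  \<open>U_lower'\<close> makes them count through their pairs.\<close>

definition big where "big = {j \<in> Sg. j \<in> Act T s \<and> U j \<noteq> {}}"

lemma card_T: "card T = card (Null T s) + card (T \<inter> Act T s)"
proof -
  have "T = Null T s \<union> (T \<inter> Act T s)" "Null T s \<inter> (T \<inter> Act T s) = {}" unfolding Null_def Act_def by auto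
  then show ?thesis using fT by (metis card_Un_disjoint finite_Un)
qed

lemma U_lower': "2 * card (T \<inter> Act T s) + 2 * card big \<le> card Up + card Um"
proof -
  have "U j \<noteq> {}" if "j \<in> T \<inter> Act T s" for j
  proof -
    have "\<bar>imb (Y j) s\<bar> > 0" "U j = Phi j" using that Ueven evenT unfolding Act_def by auto
    then show ?thesis using Phi(2)[of j] that by auto
  qed
  then have "(T \<inter> Act T s) \<union> big \<subseteq> {j \<in> Act T s. U j \<noteq> {}}" unfolding big_def by auto
  then have "card ((T \<inter> Act T s) \<union> big) \<le> card {j \<in> Act T s. U j \<noteq> {}}" using fA by (intro card_mono) auto
  moreover have "card ((T \<inter> Act T s) \<union> big) = card (T \<inter> Act T s) + card big"
    by (rule card_Un_disjoint) (use fT finSg T0Sg TT0 in \<open>auto simp: big_def\<close>)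
  ultimately show ?thesis using U_lower by linarith
qed

text \<open>An instance of \<open>pair_bound\<close> in which \<open>R\<close> collects the blocks
  of \<open>V\<close>, re-signed as wholes, and the supply left over by \<open>F\<close>. A leftover
  core may change sign since it belongs to the surplus of its block, and a leftover reflection
  outside the blocks since it affects no block.\<close>

lemma bound:
  assumes V: "V \<subseteq> Sg" "V \<inter> big = {}" and F: "F \<subseteq> Cf" "F \<inter> \<Union>(Y ` V) = {}"
    and R: "R = \<Union>(Y ` V) \<union> (Cf - F)"
    and Zs: "\<And>z. z \<in> Zs \<Longrightarrow> signing z \<and> imb R z = imb R s \<and> (\<forall>j\<in>V. \<bar>imb (Y j) z\<bar> \<le> \<bar>imb (Y j) s\<bar>)"
    and le: "card (F \<inter> {x. s x = 1}) \<le> card Um" "card (F \<inter> {x. s x = -1}) \<le> card Up"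
    and eq: "card Up + card (F \<inter> {x. s x = 1}) = card Um + card (F \<inter> {x. s x = -1})"
  shows "card ((\<lambda>z. (wt R z - wt R s) mod int n) ` insert s Zs) + 2 * card (Null T s) + card Up + card (F \<inter> {x. s x = 1}) \<le> n + 1"
proof (rule pair_bound[OF st Phi UPhi U2, where F = F and R = R])
  show "F \<subseteq> C0 \<inter> Rf" using F Cf_C0 by blast
  show "F \<inter> U j = {}" if "j \<in> Act T s" for j using Cf_U[OF that] F by blast
  show "F \<inter> Y j \<subseteq> Phi j" if "j \<in> Sg" "j \<in> Act T s" for j using Cf_Y[OF that(1)] F by blast
  show "F \<inter> Y j = {}" if "j \<in> Sg" "j \<notin> Act T s" for j using Cf_Y[OF that(1)] F that(2) by blast
  show "R \<subseteq> C0" unfolding R using V(1) SgC0 Cf_C0 by blast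
  show "R \<inter> F = {}" unfolding R using F by blast
  show "R \<inter> U j = {}" if j: "j \<in> Act T s" for j
  proof -
    have "Y k \<inter> U j = {}" if k: "k \<in> V" for k
    proof (cases "k = j")
      case True then show ?thesis using V k j unfolding big_def by blast
    next
      case False
      then have "Y k \<inter> Y j = {}" using Ydisj[OF _ Asub[OF j]] k V by blast
      then show ?thesis using UY[OF j] by blast
    qed
    then show ?thesis unfolding R using Cf_U[OF j] by blast
  qed
  show "signing z" "imb R z = imb R s" if "z \<in> insert s Zs" for z using that Zs sg by auto
  fix z j assume z: "z \<in> insert s Zs" and j: "j \<in> Sg"
  show "(Y j \<subseteq> R \<and> (j \<in> Act T s \<longrightarrow> U j = {}) \<and> \<bar>imb (Y j) z\<bar> \<le> \<bar>imb (Y j) s\<bar>)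
         \<or> (\<forall>x\<in>Y j \<inter> R \<inter> Rf. z x \<noteq> s x \<longrightarrow> j \<in> Act T s \<and> x \<in> Phi j)"
  proof (cases "j \<in> V")
    case True
    then have "\<bar>imb (Y j) z\<bar> \<le> \<bar>imb (Y j) s\<bar>" using z Zs by auto
    moreover have "j \<in> Act T s \<longrightarrow> U j = {}" using True V j unfolding big_def by blast
    ultimately show ?thesis using True unfolding R by blast
  next
    case False
    have "x \<in> Cf" if xj: "x \<in> Y j \<inter> R" for x
    proof (rule ccontr)
      assume "x \<notin> Cf"
      then obtain k where "k \<in> V" "x \<in> Y k" using xj unfolding R by blast
      then show False using Ydisj[of j k] False j V xj by blast
    qed
    then show ?thesis using Cf_Y[OF j] by blast
  qed
qed (use le eq Up_def Um_def in auto)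

end

section \<open>Bounds on the number of blocks in a minimal state\<close>

context flip_state begin

lemma ex_minimal_flip_state:
  assumes st: "minimal_state T s"
  obtains Phi U core where "minimal_flip_state n val Rf C0 T0 Sg Y T s Phi U core"
proof -
  have TT0: "T \<subseteq> T0" and gs: "good (carr T) s" using st by (auto simp: minimal_state_def)
  have sg: "signing s" using gs by (simp add: good_def)
  have "\<exists>P. P \<subseteq> Y j \<inter> Rf \<and> int (card P) = \<bar>imb (Y j) s\<bar> \<and> (\<forall>x\<in>P. s x = sgn (imb (Y j) s))" if j: "j \<in> Act T s" for j
  proof -
    have fY: "finite (Y j)" using finY j TT0 unfolding Act_def by auto
    let ?p = "Y j \<inter> Rf \<inter> {i. s i = 1}" and ?m = "Y j \<inter> Rf \<inter> {i. s i = -1}"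
    have e: "imb (Y j) s = int (card ?p) - int (card ?m)" by (rule imb_card[OF fY sg])
    have nz: "imb (Y j) s \<noteq> 0" using j unfolding Act_def by simp
    show ?thesis
    proof (cases "imb (Y j) s > 0")
      case True
      then have "nat (imb (Y j) s) \<le> card ?p" using e by simp
      then obtain P where "P \<subseteq> ?p" "card P = nat (imb (Y j) s)" by (metis obtain_subset_with_card_n)
      then show ?thesis using True by (intro exI[of _ P]) auto
    next
      case False
      then have "nat (- imb (Y j) s) \<le> card ?m" using e by simp
      then obtain P where "P \<subseteq> ?m" "card P = nat (- imb (Y j) s)" by (metis obtain_subset_with_card_n)
      then show ?thesis using False nz by (intro exI[of _ P]) auto
    qed
  qed
  then obtain Phi where Phi: "\<And>j. j \<in> Act T s \<Longrightarrow> Phi j \<subseteq> Y j \<inter> Rf \<and> int (card (Phi j)) = \<bar>imb (Y j) s\<bar> \<and> (\<forall>x\<in>Phi j. s x = sgn (imb (Y j) s))"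
    by metis
  define core where "core j = (SOME x. x \<in> Phi j)" for j
  define U where "U j = (if odd (imb (Y j) s) then Phi j - {core j} else Phi j)" for j
  have core: "core j \<in> Phi j" if "j \<in> Act T s" for j
  proof -
    have "card (Phi j) \<noteq> 0" using Phi[OF that] that unfolding Act_def by auto
    then have "\<exists>x. x \<in> Phi j" by (metis all_not_in_conv card.empty)
    then show ?thesis unfolding core_def by (rule someI_ex)
  qed
  have "minimal_flip_state n val Rf C0 T0 Sg Y T s Phi U core"
    by unfold_locales (use st Phi core in \<open>auto simp: U_def\<close>)
  then show ?thesis using that by blast
qed

text \<open>Each unbalanced block has at least two surplus terms. If every surplus term has a
  partner from the supply, every block of \<open>T\<close> therefore accounts for two groups and
  \<open>2 * card T <= n\<close>. If the supply is used up instead, the pairs number half of all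
  terms; this alone gives one pair for each unbalanced block, and the reflection in
  \<open>C0\<close> makes the inequality strict.\<close>

lemma card_minimal_state:
  assumes st: "minimal_state T s" and Sg: "Sg = {}" and C0: "C0 \<inter> Rf \<noteq> {}"
  shows "card T < n"
proof -
  obtain Phi U core where "minimal_flip_state n val Rf C0 T0 Sg Y T s Phi U core" using ex_minimal_flip_state[OF st] .
  then interpret minimal_flip_state n val Rf C0 T0 Sg Y T s Phi U core .
  have Cf: "Cf = C0 \<inter> Rf" unfolding Cf_def Od_def by (simp add: Sg)
  obtain F where F: "F \<subseteq> Cf" "card (F \<inter> {x. s x = 1}) \<le> card Um" "card (F \<inter> {x. s x = -1}) \<le> card Up"
    "card Up + card (F \<inter> {x. s x = 1}) = card Um + card (F \<inter> {x. s x = -1})"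
    "2 * (card Up + card (F \<inter> {x. s x = 1})) = card Up + card Um + card Cf \<or> card (F \<inter> {x. s x = 1}) = card Um"
    using choose_supply[OF finCf sg balance] by blast
  have "card ((\<lambda>z. (wt (\<Union>(Y ` {}) \<union> (Cf - F)) z - wt (\<Union>(Y ` {}) \<union> (Cf - F)) s) mod int n) ` insert s {})
      + 2 * card (Null T s) + card Up + card (F \<inter> {x. s x = 1}) \<le> n + 1"
    by (rule bound[of "{}" F]) (use F in auto)
  then have b: "2 * card (Null T s) + card Up + card (F \<inter> {x. s x = 1}) \<le> n" by simp
  have "card Cf > 0" using C0 Cf finCf by (auto simp: card_gt_0_iff)
  have arith: "t < k" if "2 * a + u + f \<le> k" "t = a + b" "2 * b + 2 * g \<le> u + m"
    "2 * (u + f) = u + m + c \<or> f = m" "c > 0" "k > 0" for a b c f g k m t u :: nat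
    using that by auto
  show ?thesis by (rule arith[OF b card_T U_lower' F(5) \<open>card Cf > 0\<close> n_pos])
qed

text \<open>\<open>virt\<close> signs each block \<open>Y j\<close> with \<open>j \<in> V\<close> by \<open>\<plusminus> sig j\<close>, so that the block acts like a single term.\<close>
definition own :: "'j set \<Rightarrow> 'i \<Rightarrow> 'j" where "own V i = (SOME j. j \<in> V \<and> i \<in> Y j)"

definition virt :: "'j set \<Rightarrow> ('j \<Rightarrow> 'i \<Rightarrow> int) \<Rightarrow> ('i \<Rightarrow> int) \<Rightarrow> ('j \<Rightarrow> int) \<Rightarrow> 'i \<Rightarrow> int" where
  "virt V sig g tau i = (if i \<in> \<Union>(Y ` V) then tau (own V i) * sig (own V i) i else g i)"

lemma own: "V \<subseteq> Sg \<Longrightarrow> j \<in> V \<Longrightarrow> i \<in> Y j \<Longrightarrow> own V i = j"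
proof -
  assume V: "V \<subseteq> Sg" and j: "j \<in> V" "i \<in> Y j"
  have "own V i \<in> V \<and> i \<in> Y (own V i)" unfolding own_def by (rule someI[of _ j]) (use j in simp)
  then show ?thesis using Ydisj[of "own V i" j] V j by blast
qed

lemma virt_block: "V \<subseteq> Sg \<Longrightarrow> j \<in> V \<Longrightarrow> i \<in> Y j \<Longrightarrow> virt V sig g tau i = tau j * sig j i"
  using own unfolding virt_def by auto

lemma virt_imb: "V \<subseteq> Sg \<Longrightarrow> j \<in> V \<Longrightarrow> imb (Y j) (virt V sig g tau) = tau j * imb (Y j) (sig j)"
  unfolding imb_def sum_distrib_left by (rule sum.cong) (auto simp: virt_block)

lemma virt_wt: "V \<subseteq> Sg \<Longrightarrow> j \<in> V \<Longrightarrow> wt (Y j) (virt V sig g tau) = tau j * wt (Y j) (sig j)"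
  unfolding wt_def sum_distrib_left by (rule sum.cong) (auto simp: virt_block mult.assoc)

lemma virt_signing: "V \<subseteq> Sg \<Longrightarrow> (\<And>j. j \<in> V \<Longrightarrow> signing (sig j)) \<Longrightarrow> signing g \<Longrightarrow>
    (\<And>j. j \<in> V \<Longrightarrow> tau j = 1 \<or> tau j = -1) \<Longrightarrow> signing (virt V sig g tau)"
proof -
  assume V: "V \<subseteq> Sg" and s: "\<And>j. j \<in> V \<Longrightarrow> signing (sig j)" and g: "signing g" and t: "\<And>j. j \<in> V \<Longrightarrow> tau j = 1 \<or> tau j = -1"
  show ?thesis unfolding signing_def
  proof
    fix i show "virt V sig g tau i = 1 \<or> virt V sig g tau i = - 1"
    proof (cases "i \<in> \<Union>(Y ` V)")
      case True
      then obtain j where j: "j \<in> V" "i \<in> Y j" by blast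
      show ?thesis unfolding virt_block[OF V j] using t[OF j(1)] signingD[OF s[OF j(1)], of i] by auto
    next
      case False then show ?thesis unfolding virt_def using signingD[OF g, of i] by auto
    qed
  qed
qed

lemma virt_total:
  assumes V: "V \<subseteq> Sg" and Q: "finite Q" "Q \<inter> \<Union>(Y ` V) = {}"
  shows "imb (\<Union>(Y ` V) \<union> Q) (virt V sig g tau) = (\<Sum>j\<in>V. tau j * imb (Y j) (sig j)) + imb Q g"
    and "wt (\<Union>(Y ` V) \<union> Q) (virt V sig g tau) = (\<Sum>j\<in>V. tau j * wt (Y j) (sig j)) + wt Q g"
proof -
  have fV: "finite V" using V finSg finite_subset by blast
  have fY: "finite (Y j)" if "j \<in> V" for j using finY that V by blast
  have dis: "Y j \<inter> Y k = {}" if "j \<in> V" "k \<in> V" "j \<noteq> k" for j k using Ydisj that V by blast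
  have f: "finite (\<Union>(Y ` V))" using fV fY by auto
  have d: "\<Union>(Y ` V) \<inter> Q = {}" using Q by blast
  let ?z = "virt V sig g tau"
  have "imb Q ?z = imb Q g" by (rule imb_cong) (use d in \<open>auto simp: virt_def\<close>)
  moreover have "imb (\<Union>(Y ` V)) ?z = (\<Sum>j\<in>V. tau j * imb (Y j) (sig j))"
  proof -
    have "imb (\<Union>(Y ` V)) ?z = (\<Sum>j\<in>V. imb (Y j) ?z)" by (rule imb_UN[OF fV]) (use fY dis in blast)+
    then show ?thesis using virt_imb[OF V] by simp
  qed
  ultimately show "imb (\<Union>(Y ` V) \<union> Q) ?z = (\<Sum>j\<in>V. tau j * imb (Y j) (sig j)) + imb Q g"
    using imb_Un[OF f Q(1) d] by simp
  have "wt Q ?z = wt Q g" by (rule wt_cong) (use d in \<open>auto simp: virt_def\<close>)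
  moreover have "wt (\<Union>(Y ` V)) ?z = (\<Sum>j\<in>V. tau j * wt (Y j) (sig j))"
  proof -
    have "wt (\<Union>(Y ` V)) ?z = (\<Sum>j\<in>V. wt (Y j) ?z)" by (rule wt_UN[OF fV]) (use fY dis in blast)+
    then show ?thesis using virt_wt[OF V] by simp
  qed
  ultimately show "wt (\<Union>(Y ` V) \<union> Q) ?z = (\<Sum>j\<in>V. tau j * wt (Y j) (sig j)) + wt Q g"
    using wt_Un[OF f Q(1) d] by simp
qed

end

text \<open>For \<open>reflection_bound\<close>: the blocks come in two classes and their cores in
  two signs, in numbers \<open>pp\<close>, \<open>pm\<close>, \<open>mp\<close>, \<open>mm\<close>.
  From each class \<open>r\<close> blocks are taken such that at most \<open>c\<close> cores of each
  sign are used. The number of plus cores must lie between \<open>2 * r - c\<close> and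
  \<open>c\<close>; its least possible value \<open>lP + lM\<close> is at most \<open>c\<close>, its
  greatest \<open>hP + hM\<close> at least \<open>2 * r - c\<close>, and the three cases raise first
  one class and then the other.\<close>

lemma split_counts:
  fixes pp pm mp mm up um c r :: nat
  assumes "pp + mp \<le> c + um" "pm + mm \<le> c + up" "r \<le> pp + pm" "r \<le> mp + mm"
    and "2 * r + (up + um) \<le> pp + pm + mp + mm"
  obtains a1 a2 a3 a4 where "a1 \<le> pp" "a2 \<le> pm" "a3 \<le> mp" "a4 \<le> mm"
    "a1 + a2 = r" "a3 + a4 = r" "a1 + a3 \<le> c" "a2 + a4 \<le> c"
proof -
  define lP lM hP hM where "lP = r - pm" and "lM = r - mm" and "hP = min r pp" and "hM = min r mp"
  have rc: "r \<le> c" using assms by linarith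
  have b: "lP \<le> hP" "lM \<le> hM" "hP \<le> r" "hM \<le> r" "hP \<le> pp" "hM \<le> mp" "r - lP \<le> pm" "r - lM \<le> mm"
    unfolding lP_def lM_def hP_def hM_def using assms by auto
  have lo: "lP + lM \<le> c" unfolding lP_def lM_def using assms rc by linarith
  have hi: "2 * r \<le> hP + hM + c" unfolding hP_def hM_def using assms rc by linarith
  consider "2 * r \<le> lP + lM + c" | "lP + lM + c < 2 * r" "2 * r \<le> lP + hM + c" | "lP + hM + c < 2 * r" by linarith
  then show ?thesis
  proof cases
    case 1
    show ?thesis by (rule that[of lP "r - lP" lM "r - lM"]) (use 1 b lo in linarith)+
  next
    case 2
    show ?thesis by (rule that[of lP "r - lP" "2 * r - c - lP" "r - (2 * r - c - lP)"]) (use 2 b lo hi rc in linarith)+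
  next
    case 3
    show ?thesis by (rule that[of "2 * r - c - hM" "r - (2 * r - c - hM)" hM "r - hM"]) (use 3 b lo hi rc in linarith)+
  qed
qed

context flip_state begin

text \<open>A global change of sign gives the missing term \<open>x\<close> the sign
  \<open>c\<close>; the remaining terms then have to cancel its imbalance and its weight.\<close>

lemma ex_normal_sig:
  assumes j: "j \<in> Sg" "x \<notin> Y j" "good (insert x (Y j)) sg" and c: "c = 1 \<or> c = -1"
  obtains s' where "signing s'" "imb (Y j) s' = (if x \<in> Rf then - c else 0)" "int n dvd wt (Y j) s' + c * val x"
proof -
  have fY: "finite (Y j)" using finY j by auto
  have s: "signing sg" using j by (simp add: good_def)
  define e where "e = c * sg x"
  define s' where "s' i = e * sg i" for i
  have e: "e = 1 \<or> e = -1" using c signingD[OF s, of x] unfolding e_def by auto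
  have sx: "s' x = c" using signingD[OF s, of x] unfolding s'_def e_def by auto
  have s's: "signing s'" unfolding signing_def
  proof
    fix i show "s' i = 1 \<or> s' i = -1" using e signingD[OF s, of i] unfolding s'_def by auto
  qed
  have dj: "{x} \<inter> Y j = {}" using j by auto
  have "imb (insert x (Y j)) s' = e * imb (insert x (Y j)) sg" unfolding imb_def s'_def by (simp add: sum_distrib_left)
  then have i0: "imb (insert x (Y j)) s' = 0" using j by (simp add: good_def)
  have "imb ({x} \<union> Y j) s' = imb {x} s' + imb (Y j) s'" by (rule imb_Un) (use fY dj in auto)
  moreover have "imb {x} s' = (if x \<in> Rf then c else 0)" by (simp add: imb_def sx)
  ultimately have 1: "imb (Y j) s' = (if x \<in> Rf then - c else 0)" using i0 by (simp split: if_splits)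
  have "wt (insert x (Y j)) s' = e * wt (insert x (Y j)) sg" unfolding wt_def s'_def by (simp add: sum_distrib_left mult.assoc)
  then have w0: "int n dvd wt (insert x (Y j)) s'" using j by (simp add: good_def)
  have "wt ({x} \<union> Y j) s' = wt {x} s' + wt (Y j) s'" by (rule wt_Un) (use fY dj in auto)
  then have "int n dvd wt (Y j) s' + c * val x" using w0 by (simp add: wt_def sx add.commute)
  then show ?thesis using that s's 1 by blast
qed

lemma rotation_bound:
  assumes st: "minimal_state T s" and T: "T \<noteq> {}"
    and x: "\<And>j. j \<in> Sg \<Longrightarrow> x j \<notin> Rf" "\<And>j. j \<in> Sg \<Longrightarrow> x j \<notin> Y j" "\<And>j. j \<in> Sg \<Longrightarrow> good (insert (x j) (Y j)) (sg0 j)"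
    and P: "P \<subseteq> Sg" "\<And>B. B \<noteq> {} \<Longrightarrow> B \<subseteq> P \<Longrightarrow> \<not> int n dvd (\<Sum>j\<in>B. val (x j))"
  shows "card {j \<in> P. imb (Y j) s = 0} + card T + card {j \<in> Sg. imb (Y j) s \<noteq> 0}
    + (if C0 \<inter> Rf - \<Union>(Y ` Sg) = {} then 0 else 1) \<le> n"
proof -
  obtain Phi U core where "minimal_flip_state n val Rf C0 T0 Sg Y T s Phi U core" using ex_minimal_flip_state[OF st] .
  then interpret minimal_flip_state n val Rf C0 T0 Sg Y T s Phi U core .
  have fY: "finite (Y j)" if "j \<in> Sg" for j using finY that by blast
  have "even (imb (Y j) s)" if j: "j \<in> Sg" for j
  proof -
    have "even (card (insert (x j) (Y j) \<inter> Rf))" using even_card_good[OF _ x(3)[OF j]] fY[OF j] by simp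
    moreover have "insert (x j) (Y j) \<inter> Rf = Y j \<inter> Rf" using x(1)[OF j] by auto
    ultimately show ?thesis using even_imb[OF fY[OF j] sg] by simp
  qed
  then have Od: "Od = {}" unfolding Od_def by auto
  have Cf: "Cf = C0 \<inter> Rf - \<Union>(Y ` Sg)" unfolding Cf_def Od by simp
  have big: "big = {j \<in> Sg. imb (Y j) s \<noteq> 0}"
  proof -
    have "U j \<noteq> {}" if j: "j \<in> Sg" "imb (Y j) s \<noteq> 0" for j
    proof -
      have a: "j \<in> Act T s" using j unfolding Act_def by simp
      have "even (imb (Y j) s)" using Od j unfolding Od_def by auto
      then have "int (card (U j)) = \<bar>imb (Y j) s\<bar>" using cardU[OF a] by simp
      then show ?thesis using j by auto
    qed
    then show ?thesis unfolding big_def Act_def by auto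
  qed
  have "\<exists>s'. signing s' \<and> imb (Y j) s' = 0 \<and> int n dvd wt (Y j) s' + val (x j)" if "j \<in> Sg" for j
    using ex_normal_sig[OF that x(2,3)[OF that], of 1] x(1)[OF that] by auto
  then obtain sig where sig: "\<And>j. j \<in> Sg \<Longrightarrow> signing (sig j)" "\<And>j. j \<in> Sg \<Longrightarrow> imb (Y j) (sig j) = 0"
    "\<And>j. j \<in> Sg \<Longrightarrow> int n dvd wt (Y j) (sig j) + val (x j)" by metis
  obtain F where F: "F \<subseteq> Cf" "card (F \<inter> {x. s x = 1}) \<le> card Um" "card (F \<inter> {x. s x = -1}) \<le> card Up"
    "card Up + card (F \<inter> {x. s x = 1}) = card Um + card (F \<inter> {x. s x = -1})"
    "2 * (card Up + card (F \<inter> {x. s x = 1})) = card Up + card Um + card Cf \<or> card (F \<inter> {x. s x = 1}) = card Um"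
    using choose_supply[OF finCf sg balance] by blast
  define V where "V = {j \<in> P. imb (Y j) s = 0}"
  have VS: "V \<subseteq> Sg" using P(1) unfolding V_def by auto
  have fV: "finite V" using VS finSg finite_subset by blast
  obtain L where L: "set L = V" "distinct L" using finite_distinct_list[OF fV] by blast
  define Q where "Q = Cf - F"
  have fQ: "finite Q" unfolding Q_def using finCf by simp
  have QV: "Q \<inter> \<Union>(Y ` V) = {}" unfolding Q_def Cf using VS by blast
  define R where "R = \<Union>(Y ` V) \<union> Q"
  define z where "z B = virt V sig s (\<lambda>j. if j \<in> B then -1 else 1)" for B
  define Zs where "Zs = (\<lambda>l. z (set (take l L))) ` {..length L}"
  have imbRs: "imb R s = imb Q s"
  proof -
    have "imb R s = imb (\<Union>(Y ` V)) s + imb Q s" unfolding R_def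
      by (rule imb_Un) (use fV fY VS fQ QV in auto)
    moreover have "imb (\<Union>(Y ` V)) s = (\<Sum>j\<in>V. imb (Y j) s)"
      by (rule imb_UN[OF fV]) (use fY VS Ydisj in blast)+
    ultimately show ?thesis unfolding V_def by simp
  qed
  have zprop: "signing (z B) \<and> imb R (z B) = imb R s \<and> (\<forall>j\<in>V. \<bar>imb (Y j) (z B)\<bar> \<le> \<bar>imb (Y j) s\<bar>)" for B
  proof (intro conjI ballI)
    show "signing (z B)" unfolding z_def by (rule virt_signing[OF VS]) (use sig VS sg in auto)
    show "imb R (z B) = imb R s" unfolding imbRs unfolding R_def z_def virt_total(1)[OF VS fQ QV]
      by (simp add: sig(2) subset_iff[THEN iffD1, OF VS])
    fix j assume j: "j \<in> V"
    show "\<bar>imb (Y j) (z B)\<bar> \<le> \<bar>imb (Y j) s\<bar>" unfolding z_def virt_imb[OF VS j] using sig(2) VS j by auto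
  qed
  have cardZ: "card ((\<lambda>l. (wt R (z (set (take l L))) - wt R s) mod int n) ` {..length L}) = length L + 1"
  proof (rule chain_card[where w = "\<lambda>j. - val (x j)" and c = "(\<Sum>j\<in>V. - val (x j)) + wt Q s - wt R s"])
    fix B assume B: "B \<noteq> {}" "B \<subseteq> set L"
    have "\<not> int n dvd (\<Sum>j\<in>B. val (x j))" by (rule P(2)) (use B L in \<open>auto simp: V_def\<close>)
    then show "\<not> int n dvd (\<Sum>j\<in>B. - val (x j))" by (simp add: sum_negf)
  next
    fix B assume B: "B \<subseteq> set L"
    have BV: "B \<subseteq> V" using B L by simp
    define tau where "tau j = (if j \<in> B then -1 else 1 :: int)" for j
    have w: "wt R (z B) = (\<Sum>j\<in>V. tau j * wt (Y j) (sig j)) + wt Q s"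
      unfolding R_def z_def tau_def by (rule virt_total(2)[OF VS fQ QV])
    have tt: "(\<Sum>j\<in>V. - val (x j)) - 2 * (\<Sum>j\<in>B. - val (x j)) = (\<Sum>j\<in>V. tau j * (- val (x j)))"
    proof -
      have "(\<Sum>j\<in>V. tau j * (- val (x j))) = (\<Sum>j\<in>V. - val (x j) - 2 * (if j \<in> B then - val (x j) else 0))"
        by (rule sum.cong) (auto simp: tau_def)
      also have "\<dots> = (\<Sum>j\<in>V. - val (x j)) - 2 * (\<Sum>j\<in>V. if j \<in> B then - val (x j) else 0)"
        by (simp only: sum_subtractf sum_distrib_left)
      also have "(\<Sum>j\<in>V. if j \<in> B then - val (x j) else 0) = (\<Sum>j\<in>B. - val (x j))"
        using BV fV by (simp add: sum.inter_restrict[symmetric] Int_absorb1)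
      finally show ?thesis by simp
    qed
    have "wt R (z B) - wt R s - ((\<Sum>j\<in>V. - val (x j)) + wt Q s - wt R s - 2 * (\<Sum>j\<in>B. - val (x j)))
        = (\<Sum>j\<in>V. tau j * wt (Y j) (sig j)) - ((\<Sum>j\<in>V. - val (x j)) - 2 * (\<Sum>j\<in>B. - val (x j)))"
      unfolding w by simp
    also have "\<dots> = (\<Sum>j\<in>V. tau j * (wt (Y j) (sig j) + val (x j)))"
      unfolding tt sum_subtractf[symmetric] by (rule sum.cong) (auto simp: algebra_simps)
    finally show "int n dvd wt R (z B) - wt R s - ((\<Sum>j\<in>V. - val (x j)) + wt Q s - wt R s - 2 * (\<Sum>j\<in>B. - val (x j)))"
      using sig(3) VS by (auto intro!: dvd_sum dvd_mult)
  qed (rule L)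
  have "(\<lambda>l. (wt R (z (set (take l L))) - wt R s) mod int n) ` {..length L} \<subseteq> (\<lambda>z. (wt R z - wt R s) mod int n) ` insert s Zs"
    unfolding Zs_def by auto
  then have "length L + 1 \<le> card ((\<lambda>z. (wt R z - wt R s) mod int n) ` insert s Zs)"
    unfolding cardZ[symmetric] by (rule card_mono[rotated]) (simp add: Zs_def)
  moreover have "card ((\<lambda>z. (wt R z - wt R s) mod int n) ` insert s Zs) + 2 * card (Null T s) + card Up + card (F \<inter> {x. s x = 1}) \<le> n + 1"
  proof (rule bound[OF VS _ F(1) _ _ _ F(2-4)])
    show "V \<inter> big = {}" unfolding V_def big by auto
    show "F \<inter> \<Union>(Y ` V) = {}" using F(1) VS unfolding Cf by blast
    show "R = \<Union>(Y ` V) \<union> (Cf - F)" unfolding R_def Q_def ..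
    show "signing y \<and> imb R y = imb R s \<and> (\<forall>j\<in>V. \<bar>imb (Y j) y\<bar> \<le> \<bar>imb (Y j) s\<bar>)" if "y \<in> Zs" for y
      using that zprop unfolding Zs_def by blast
  qed
  moreover have "length L = card V" using L by (metis distinct_card)
  ultimately have b: "card V + 2 * card (Null T s) + card Up + card (F \<inter> {x. s x = 1}) \<le> n" by linarith
  have Tpos: "card T > 0" using T fT by (simp add: card_gt_0_iff)
  have dC: "Cf = {} \<or> card Cf > 0" using finCf by (simp add: card_gt_0_iff)
  have arith: "v + t + g + d \<le> k" if "v + 2 * a + u + f \<le> k" "t = a + b" "2 * b + 2 * g \<le> u + m"
    "2 * (u + f) = u + m + c \<or> f = m" "t > 0" "d \<le> c" "d \<le> 1" for a b c d f g k m t u v :: nat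
    using that by auto
  have "card V + card T + card big + (if Cf = {} then 0 else 1) \<le> n"
    by (rule arith[OF b card_T U_lower' F(5) Tpos]) (use dC in auto)
  then show ?thesis unfolding V_def big Cf .
qed

text \<open>As \<open>x j\<close> is a reflection, each \<open>Y j\<close> has odd imbalance, so it
  has a core, and signed by \<open>sig j\<close> it acts like one reflection. Its core can serve as
  a supply term, or the block can be re-signed as a whole. For the latter, blocks of
  \<open>P\<close> and \<open>M\<close> are reversed in pairs, one from each class, to keep the
  balance, and \<open>zf\<close> makes the weights along a chain of such pairs distinct.\<close>

lemma reflection_bound:
  assumes st: "minimal_state T s"
    and x: "\<And>j. j \<in> Sg \<Longrightarrow> x j \<in> Rf" "\<And>j. j \<in> Sg \<Longrightarrow> x j \<notin> Y j" "\<And>j. j \<in> Sg \<Longrightarrow> good (insert (x j) (Y j)) (sg0 j)"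
    and PM: "P \<union> M = Sg" "P \<inter> M = {}" "card P \<le> b" "card M \<le> b" "b \<le> n"
    and f: "2 * f \<le> card Sg" "n < card T + f"
    and zf: "\<And>B B'. B \<subseteq> P \<Longrightarrow> B' \<subseteq> M \<Longrightarrow> card B = card B' \<Longrightarrow> B \<noteq> {} \<Longrightarrow> card B < b \<Longrightarrow>
       \<not> int n dvd (\<Sum>j\<in>B. val (x j)) - (\<Sum>j\<in>B'. val (x j))"
  shows False
proof -
  obtain Phi U core where "minimal_flip_state n val Rf C0 T0 Sg Y T s Phi U core" using ex_minimal_flip_state[OF st] .
  then interpret minimal_flip_state n val Rf C0 T0 Sg Y T s Phi U core .
  have fY: "finite (Y j)" if "j \<in> Sg" for j using finY that by blast
  have odd_imb: "odd (imb (Y j) s)" if j: "j \<in> Sg" for j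
  proof -
    have "even (card (insert (x j) (Y j) \<inter> Rf))" using even_card_good[OF _ x(3)[OF j]] fY[OF j] by simp
    moreover have "insert (x j) (Y j) \<inter> Rf = insert (x j) (Y j \<inter> Rf)" using x(1)[OF j] by auto
    ultimately have "odd (card (Y j \<inter> Rf))" using x(2)[OF j] fY[OF j] by simp
    then show ?thesis using even_imb[OF fY[OF j] sg] by simp
  qed
  then have Od: "Od = Sg" unfolding Od_def by auto
  have SgA: "j \<in> Act T s" if "j \<in> Sg" for j using OdA Od that by blast
  have unit: "imb (Y j) s = s (core j)" if j: "j \<in> Sg" "j \<notin> big" for j
  proof -
    have "U j = {}" using j SgA unfolding big_def by blast
    then have "\<bar>imb (Y j) s\<bar> = 1" using cardU[OF SgA[OF j(1)]] odd_imb[OF j(1)] by simp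
    then show ?thesis using core_sgn[of j] j Od by (auto simp: sgn_if abs_if split: if_splits)
  qed
  have bigS: "big \<subseteq> Sg" unfolding big_def by auto
  let ?pl = "{y. s y = 1}" and ?mi = "{y. s y = -1}"
  have cC: "card Sg \<le> card Cf"
  proof -
    have "card (core ` Sg) = card Sg" using core_inj unfolding Od by (rule card_image)
    moreover have "core ` Sg \<subseteq> Cf" unfolding Cf_def Od by blast
    ultimately show ?thesis using card_mono[OF finCf] by metis
  qed
  have cCs: "card Cf = card (Cf \<inter> ?pl) + card (Cf \<inter> ?mi)"
    using card_Rf_split[OF finCf sg] Cf_C0 by (simp add: Int_absorb2)
  have arithT: "card (Null T s) + card (T \<inter> Act T s) + f > n" using f(2) card_T by simp
  show False
  proof (cases "card (Cf \<inter> ?pl) \<le> card Um")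
    \<comment> \<open>The supply does not exceed what the surplus can pair: all cores are used in
      pairs and nothing is re-signed. There are \<open>card Sg\<close> cores, at least
      \<open>2 * f\<close>, which add at least \<open>f\<close> to the number of pairs.\<close>
    case True
    have "card ((\<lambda>z. (wt (\<Union>(Y ` {}) \<union> (Cf - Cf)) z - wt (\<Union>(Y ` {}) \<union> (Cf - Cf)) s) mod int n) ` insert s {})
      + 2 * card (Null T s) + card Up + card (Cf \<inter> ?pl) \<le> n + 1"
      by (rule bound[of "{}" Cf]) (use True balance in auto)
    then have b: "2 * card (Null T s) + card Up + card (Cf \<inter> ?pl) \<le> n" by simp
    show False using b balance cCs cC f(1) arithT U_lower' by linarith
  next
    case False
    \<comment> \<open>The number of supply terms of either sign that remain when every surplus term
      has a partner from the supply.\<close>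
    define c where "c = card (Cf \<inter> ?pl) - card Um"
    have cp: "card (Cf \<inter> ?pl) = c + card Um" using False c_def by simp
    have cm: "card (Cf \<inter> ?mi) = c + card Up" using balance cp by simp
    have fP: "finite P" "finite M" using PM finSg by (metis finite_Un)+
    define Pu Mu where "Pu = P - big" and "Mu = M - big"
    have fu: "finite Pu" "finite Mu" unfolding Pu_def Mu_def using fP by auto
    have PuS: "Pu \<subseteq> Sg" "Mu \<subseteq> Sg" "Pu \<inter> Mu = {}" unfolding Pu_def Mu_def using PM by auto
    let ?Pp = "{j \<in> Pu. s (core j) = 1}" and ?Pm = "{j \<in> Pu. s (core j) = -1}"
    let ?Mp = "{j \<in> Mu. s (core j) = 1}" and ?Mm = "{j \<in> Mu. s (core j) = -1}"
    have spl: "card X = card {j \<in> X. s (core j) = 1} + card {j \<in> X. s (core j) = -1}" if "finite X" for X :: "'j set"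
    proof -
      have "X = {j \<in> X. s (core j) = 1} \<union> {j \<in> X. s (core j) = -1}" using signingD[OF sg] by auto
      moreover have "card ({j \<in> X. s (core j) = 1} \<union> {j \<in> X. s (core j) = -1}) = card {j \<in> X. s (core j) = 1} + card {j \<in> X. s (core j) = -1}"
        by (rule card_Un_disjoint) (use that in auto)
      ultimately show ?thesis by simp
    qed
    have core_count: "card A + card B \<le> card (Cf \<inter> {y. s y = e})"
      if "A \<subseteq> {j \<in> Pu. s (core j) = e}" "B \<subseteq> {j \<in> Mu. s (core j) = e}" for A B e
    proof -
      have d: "A \<inter> B = {}" "A \<union> B \<subseteq> Sg" using that PuS by auto
      have "finite A" "finite B" using that fu by (auto intro: finite_subset)
      then have "card A + card B = card (A \<union> B)" using d by (simp add: card_Un_disjoint)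
      also have "\<dots> = card (core ` (A \<union> B))" using core_inj d(2) unfolding Od by (metis card_image inj_on_subset)
      also have "\<dots> \<le> card (Cf \<inter> {y. s y = e})"
        by (rule card_mono) (use finCf d(2) that in \<open>auto simp: Cf_def Od\<close>)
      finally show ?thesis .
    qed
    have n1: "card ?Pp + card ?Mp \<le> c + card Um" using core_count[of ?Pp 1 ?Mp] cp by simp
    have n2: "card ?Pm + card ?Mm \<le> c + card Up" using core_count[of ?Pm "-1" ?Mm] cm by simp
    define W where "W = card Up + card Um"
    \<comment> \<open>The number of blocks to be re-signed in each class: no more than there are,
      the third entry is the last condition of \<open>split_counts\<close>, and \<open>b - 1\<close>
      is the range of \<open>zf\<close>. The third entry is 0 if the surplus outnumbers the blocks;
      then nothing is re-signed.\<close>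
    define r where "r = min (min (card Pu) (card Mu)) (min ((card Pu + card Mu - W) div 2) (b - 1))"
    have r: "r \<le> card Pu" "r \<le> card Mu" "r \<le> b - 1" "r = 0 \<or> 2 * r + W \<le> card Pu + card Mu"
    proof -
      show "r \<le> card Pu" "r \<le> card Mu" "r \<le> b - 1"
        unfolding r_def by (meson min.cobounded1 min.cobounded2 min.coboundedI1 min.coboundedI2)+
      have "r \<le> (card Pu + card Mu - W) div 2"
        unfolding r_def by (meson min.cobounded1 min.coboundedI2)
      then have "2 * r \<le> card Pu + card Mu - W" by linarith
      then show "r = 0 \<or> 2 * r + W \<le> card Pu + card Mu" by linarith
    qed
    obtain a1 a2 a3 a4 where a: "a1 \<le> card ?Pp" "a2 \<le> card ?Pm" "a3 \<le> card ?Mp" "a4 \<le> card ?Mm"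
      "a1 + a2 = r" "a3 + a4 = r" "a1 + a3 \<le> c" "a2 + a4 \<le> c"
    proof (cases "r = 0")
      case True then show ?thesis using that[of 0 0 0 0] by simp
    next
      case F: False
      have r1: "r \<le> card ?Pp + card ?Pm" "r \<le> card ?Mp + card ?Mm" using r(1,2) spl[OF fu(1)] spl[OF fu(2)] by auto
      have r2: "2 * r + (card Up + card Um) \<le> card ?Pp + card ?Pm + card ?Mp + card ?Mm"
        using r(4) F spl[OF fu(1)] spl[OF fu(2)] unfolding W_def by linarith
      show ?thesis by (rule split_counts[OF n1 n2 r1 r2]) (rule that)
    qed
    obtain V1 where V1: "V1 \<subseteq> ?Pp" "card V1 = a1" using obtain_subset_with_card_n[OF a(1)] by blast
    obtain V2 where V2: "V2 \<subseteq> ?Pm" "card V2 = a2" using obtain_subset_with_card_n[OF a(2)] by blast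
    obtain V3 where V3: "V3 \<subseteq> ?Mp" "card V3 = a3" using obtain_subset_with_card_n[OF a(3)] by blast
    obtain V4 where V4: "V4 \<subseteq> ?Mm" "card V4 = a4" using obtain_subset_with_card_n[OF a(4)] by blast
    define VP VM where "VP = V1 \<union> V2" and "VM = V3 \<union> V4"
    define V where "V = VP \<union> VM"
    have "finite ?Pp" "finite ?Pm" "finite ?Mp" "finite ?Mm" using fu by simp_all
    then have fVi: "finite V1" "finite V2" "finite V3" "finite V4"
      using V1(1) V2(1) V3(1) V4(1) by (simp_all add: finite_subset)
    have "?Pp \<inter> ?Pm = {}" "?Mp \<inter> ?Mm = {}" by auto
    then have dVi: "V1 \<inter> V2 = {}" "V3 \<inter> V4 = {}" using V1(1) V2(1) V3(1) V4(1) by blast+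
    have VPu: "VP \<subseteq> Pu" "VM \<subseteq> Mu" unfolding VP_def VM_def using V1 V2 V3 V4 by auto
    have cVP: "card VP = r" unfolding VP_def card_Un_disjoint[OF fVi(1,2) dVi(1)] V1(2) V2(2) by (rule a(5))
    have cVM: "card VM = r" unfolding VM_def card_Un_disjoint[OF fVi(3,4) dVi(2)] V3(2) V4(2) by (rule a(6))
    have fVV: "finite VP" "finite VM" "finite V" unfolding V_def VP_def VM_def using fVi by auto
    have dV: "VP \<inter> VM = {}" using VPu PuS by blast
    have VS: "V \<subseteq> Sg" using VPu PuS unfolding V_def by blast
    have Vbig: "V \<inter> big = {}" using VPu unfolding V_def Pu_def Mu_def by blast
    have VPP: "VP \<subseteq> P" "VM \<subseteq> M" using VPu unfolding Pu_def Mu_def by auto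
    have cVpl: "card (core ` V \<inter> ?pl) \<le> c" "card (core ` V \<inter> ?mi) \<le> c"
    proof -
      have "core ` V \<inter> ?pl \<subseteq> core ` (V1 \<union> V3)" unfolding V_def VP_def VM_def using V2 V4 by auto
      then have "card (core ` V \<inter> ?pl) \<le> card (core ` (V1 \<union> V3))" using fVi by (intro card_mono) auto
      also have "\<dots> \<le> card (V1 \<union> V3)" using fVi by (intro card_image_le) auto
      also have "\<dots> \<le> a1 + a3" using card_Un_le[of V1 V3] V1 V3 by simp
      finally show "card (core ` V \<inter> ?pl) \<le> c" using a by simp
      have "core ` V \<inter> ?mi \<subseteq> core ` (V2 \<union> V4)" unfolding V_def VP_def VM_def using V1 V3 by auto
      then have "card (core ` V \<inter> ?mi) \<le> card (core ` (V2 \<union> V4))" using fVi by (intro card_mono) auto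
      also have "\<dots> \<le> card (V2 \<union> V4)" using fVi by (intro card_image_le) auto
      also have "\<dots> \<le> a2 + a4" using card_Un_le[of V2 V4] V2 V4 by simp
      finally show "card (core ` V \<inter> ?mi) \<le> c" using a by simp
    qed
    have avail: "k \<le> card (Cf \<inter> X - core ` V)" if "card (Cf \<inter> X) = c + k" "card (core ` V \<inter> X) \<le> c" for X k
    proof -
      have "Cf \<inter> X - core ` V = Cf \<inter> X - (core ` V \<inter> X)" by blast
      then have "card (Cf \<inter> X) - card (core ` V \<inter> X) \<le> card (Cf \<inter> X - core ` V)"
        using fVV by (simp add: diff_card_le_card_Diff)
      then show ?thesis using that by linarith
    qed
    obtain Fp where Fp: "Fp \<subseteq> Cf \<inter> ?pl - core ` V" "card Fp = card Um"
      by (rule obtain_subset_with_card_n[OF avail[OF cp cVpl(1)]])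
    obtain Fm where Fm: "Fm \<subseteq> Cf \<inter> ?mi - core ` V" "card Fm = card Up"
      by (rule obtain_subset_with_card_n[OF avail[OF cm cVpl(2)]])
    define F where "F = Fp \<union> Fm"
    have Fpl: "F \<inter> ?pl = Fp" "F \<inter> ?mi = Fm" unfolding F_def using Fp Fm by auto
    have FC: "F \<subseteq> Cf" "F \<inter> core ` V = {}" unfolding F_def using Fp Fm by auto
    have fF: "finite F" using FC finCf finite_subset by blast
    \<comment> \<open>The remaining supply apart from the cores of \<open>V\<close>. Under
      \<open>s\<close> it balances only together with these cores, whereas the new signs of the
      blocks of \<open>V\<close> cancel among themselves. So \<open>Q\<close> gets a balanced
      signing \<open>g\<close> of its own, the same for all re-signings; this requires its size to
      be even.\<close>
    define Q where "Q = (Cf - F) - core ` V"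
    have fQ: "finite Q" unfolding Q_def using finCf by simp
    have CfV: "y \<in> core ` V" if "y \<in> Cf" "j \<in> V" "y \<in> Y j" for y j
      using Cf_Y[of j y] that VS by blast
    have QV: "Q \<inter> \<Union>(Y ` V) = {}" unfolding Q_def using CfV by blast
    have FV: "F \<inter> \<Union>(Y ` V) = {}" using FC CfV by blast
    have coreV: "core ` V \<subseteq> Cf" "core ` V \<subseteq> \<Union>(Y ` V)" using VS core_Y unfolding Cf_def Od by blast+
    define R where "R = \<Union>(Y ` V) \<union> Q"
    have R: "R = \<Union>(Y ` V) \<union> (Cf - F)" unfolding R_def Q_def using coreV by blast
    have cV: "card (core ` V) = 2 * r"
    proof -
      have "card (core ` V) = card V" using core_inj VS unfolding Od by (metis card_image inj_on_subset)
      then show ?thesis unfolding V_def using fVV dV cVP cVM by (simp add: card_Un_disjoint)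
    qed
    have "finite Fp" "finite Fm" using fF unfolding F_def by auto
    moreover have "Fp \<inter> Fm = {}"
    proof -
      have "?pl \<inter> ?mi = {}" by auto
      then show ?thesis using Fp(1) Fm(1) by blast
    qed
    ultimately have cF: "card F = card Um + card Up" unfolding F_def using Fp(2) Fm(2)
      by (simp add: card_Un_disjoint)
    have "card Q + 2 * r = 2 * c"
    proof -
      have "card (Cf - F) = card Cf - card F" using FC fF by (simp add: card_Diff_subset)
      then have "card (Cf - F) = 2 * c" using cCs cp cm cF by simp
      moreover have "core ` V \<subseteq> Cf - F" using coreV FC by blast
      then have "card Q = card (Cf - F) - card (core ` V)" "card (core ` V) \<le> card (Cf - F)"
        unfolding Q_def using finCf fVV by (auto simp: card_Diff_subset intro!: card_mono)
      ultimately show ?thesis using cV by simp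
    qed
    then have evQ: "even (card Q)" by presburger
    have QR: "Q \<subseteq> Rf" unfolding Q_def using Cf_C0 by blast
    obtain g where g: "signing g" "imb Q g = 0" using ex_balanced[OF fQ QR evQ] .
    have imbRs: "imb R s = 0"
    proof -
      have "imb R s = imb (\<Union>(Y ` V)) s + imb Q s" unfolding R_def
        by (rule imb_Un) (use fVV fY VS fQ QV in auto)
      moreover have "imb (\<Union>(Y ` V)) s = (\<Sum>j\<in>V. imb (Y j) s)"
        by (rule imb_UN[OF fVV(3)]) (use fY VS Ydisj in blast)+
      moreover have "(\<Sum>j\<in>V. imb (Y j) s) = (\<Sum>j\<in>V. s (core j))"
        by (rule sum.cong[OF refl]) (use unit VS Vbig in blast)
      moreover have "(\<Sum>j\<in>V. s (core j)) = sum s (core ` V)"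
        by (rule sum.reindex_cong[symmetric, of core]) (use core_inj VS in \<open>auto simp: Od intro: inj_on_subset\<close>)
      moreover have "sum s (core ` V) = imb (core ` V) s"
      proof -
        have "core ` V \<inter> Rf = core ` V" using coreV Cf_C0 by blast
        then show ?thesis unfolding imb_def by simp
      qed
      moreover have "imb (core ` V \<union> Q) s = imb (core ` V) s + imb Q s"
        by (rule imb_Un) (use fVV fQ in \<open>auto simp: Q_def\<close>)
      moreover have "core ` V \<union> Q = Cf - F" unfolding Q_def using coreV FC by blast
      moreover have "imb (Cf - F) s = imb Cf s - imb F s" by (rule imb_Diff[OF finCf FC(1)])
      moreover have "imb Cf s = int (card (Cf \<inter> ?pl)) - int (card (Cf \<inter> ?mi))"
        using imb_card[OF finCf sg] Cf_C0 by (simp add: Int_absorb2)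
      moreover have "imb F s = int (card (F \<inter> ?pl)) - int (card (F \<inter> ?mi))"
      proof -
        have "F \<inter> Rf = F" using FC Cf_C0 by blast
        then show ?thesis using imb_card[OF fF sg] by simp
      qed
      ultimately show ?thesis using cp cm Fpl Fp(2) Fm(2) by simp
    qed
    have "\<exists>s'. signing s' \<and> imb (Y j) s' = 1 \<and> int n dvd wt (Y j) s' - val (x j)" if "j \<in> Sg" for j
      using ex_normal_sig[OF that x(2,3)[OF that], of "-1"] x(1)[OF that] by auto
    then obtain sig where sig: "\<And>j. j \<in> Sg \<Longrightarrow> signing (sig j)" "\<And>j. j \<in> Sg \<Longrightarrow> imb (Y j) (sig j) = 1"
      "\<And>j. j \<in> Sg \<Longrightarrow> int n dvd wt (Y j) (sig j) - val (x j)" by metis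
    obtain p where p: "bij_betw p VP VM" using finite_same_card_bij[OF fVV(1,2)] cVP cVM by auto
    obtain L where L: "set L = VP" "distinct L" using finite_distinct_list[OF fVV(1)] by blast
    \<comment> \<open>By default \<open>VP\<close> has sign 1 and \<open>VM\<close> sign -1; the
      pairs given by \<open>B\<close> exchange their signs, so the signs always sum to 0.\<close>
    define tau where "tau B j = (if j \<in> VP then (if j \<in> B then -1 else 1) else (if j \<in> p ` B then 1 else -1 :: int))" for B j
    define z where "z B = virt V sig g (tau B)" for B
    define Zs where "Zs = (\<lambda>l. z (set (take l L))) ` {..length L}"
    have tau_sum: "(\<Sum>j\<in>V. tau B j * h j) = (\<Sum>j\<in>VP. h j) - (\<Sum>j\<in>VM. h j) - 2 * (\<Sum>j\<in>B. h j - h (p j))"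
      if B: "B \<subseteq> VP" for B and h :: "'j \<Rightarrow> int"
    proof -
      have pB: "p ` B \<subseteq> VM" "inj_on p B" using p B by (auto simp: bij_betw_def intro: inj_on_subset)
      have fB: "finite B" using B fVV finite_subset by blast
      have "(\<Sum>j\<in>V. tau B j * h j) = (\<Sum>j\<in>VP. tau B j * h j) + (\<Sum>j\<in>VM. tau B j * h j)"
        unfolding V_def by (rule sum.union_disjoint[OF fVV(1,2) dV])
      also have "(\<Sum>j\<in>VP. tau B j * h j) = (\<Sum>j\<in>VP. h j - 2 * (if j \<in> B then h j else 0))"
        by (rule sum.cong) (auto simp: tau_def)
      also have "\<dots> = (\<Sum>j\<in>VP. h j) - 2 * (\<Sum>j\<in>VP. if j \<in> B then h j else 0)"
        by (simp only: sum_subtractf sum_distrib_left)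
      also have "(\<Sum>j\<in>VP. if j \<in> B then h j else 0) = (\<Sum>j\<in>B. h j)"
        using B fVV by (simp add: sum.inter_restrict[symmetric] Int_absorb1)
      also have "(\<Sum>j\<in>VM. tau B j * h j) = (\<Sum>j\<in>VM. 2 * (if j \<in> p ` B then h j else 0) - h j)"
        by (rule sum.cong) (use dV in \<open>auto simp: tau_def\<close>)
      also have "\<dots> = 2 * (\<Sum>j\<in>VM. if j \<in> p ` B then h j else 0) - (\<Sum>j\<in>VM. h j)"
        by (simp only: sum_subtractf sum_distrib_left)
      also have "(\<Sum>j\<in>VM. if j \<in> p ` B then h j else 0) = (\<Sum>j\<in>p ` B. h j)"
        using pB fVV by (simp add: sum.inter_restrict[symmetric] Int_absorb1)
      also have "(\<Sum>j\<in>p ` B. h j) = (\<Sum>j\<in>B. h (p j))" by (rule sum.reindex_cong[OF pB(2)]) auto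
      finally show ?thesis by (simp add: sum_subtractf algebra_simps)
    qed
    have zprop: "signing (z B) \<and> imb R (z B) = imb R s \<and> (\<forall>j\<in>V. \<bar>imb (Y j) (z B)\<bar> \<le> \<bar>imb (Y j) s\<bar>)" if B: "B \<subseteq> VP" for B
    proof (intro conjI ballI)
      show "signing (z B)" unfolding z_def by (rule virt_signing[OF VS]) (use sig VS g in \<open>auto simp: tau_def\<close>)
      have "imb R (z B) = (\<Sum>j\<in>V. tau B j * imb (Y j) (sig j)) + imb Q g"
        unfolding R_def z_def by (rule virt_total(1)[OF VS fQ QV])
      also have "(\<Sum>j\<in>V. tau B j * imb (Y j) (sig j)) = (\<Sum>j\<in>V. tau B j * 1)"
        by (rule sum.cong[OF refl]) (use sig(2) VS in auto)
      also have "\<dots> = 0" unfolding tau_sum[OF B] using cVP cVM by simp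
      finally show "imb R (z B) = imb R s" using g imbRs by simp
      fix j assume j: "j \<in> V"
      then have "imb (Y j) s = s (core j)" using unit[of j] VS Vbig by blast
      then have "\<bar>imb (Y j) s\<bar> = 1" using signingD[OF sg, of "core j"] by auto
      then show "\<bar>imb (Y j) (z B)\<bar> \<le> \<bar>imb (Y j) s\<bar>" unfolding z_def virt_imb[OF VS j] using sig(2) VS j by (auto simp: tau_def)
    qed
    have cardZ: "card ((\<lambda>l. (wt R (z (set (take l L))) - wt R s) mod int n) ` {..length L}) = length L + 1"
    proof (rule chain_card[where w = "\<lambda>j. val (x j) - val (x (p j))"
          and c = "(\<Sum>j\<in>VP. val (x j)) - (\<Sum>j\<in>VM. val (x j)) + wt Q g - wt R s"])
      fix B assume B: "B \<noteq> {}" "B \<subseteq> set L"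
      have BV: "B \<subseteq> VP" using B L by simp
      have pB: "p ` B \<subseteq> VM" "inj_on p B" using p BV by (auto simp: bij_betw_def intro: inj_on_subset)
      have "finite B" using BV fVV finite_subset by blast
      then have "card B > 0" using B by (simp add: card_gt_0_iff)
      moreover have "card B \<le> r" using card_mono[OF fVV(1) BV] cVP by simp
      ultimately have "card B < b" using r(3) by linarith
      then have "\<not> int n dvd (\<Sum>j\<in>B. val (x j)) - (\<Sum>j\<in>p ` B. val (x j))"
        using zf[of B "p ` B"] B BV pB VPP card_image[OF pB(2)] by auto
      moreover have "(\<Sum>j\<in>p ` B. val (x j)) = (\<Sum>j\<in>B. val (x (p j)))" by (rule sum.reindex_cong[OF pB(2)]) auto
      ultimately show "\<not> int n dvd (\<Sum>j\<in>B. val (x j) - val (x (p j)))" by (simp add: sum_subtractf)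
    next
      fix B assume "B \<subseteq> set L"
      then have B: "B \<subseteq> VP" using L by simp
      have w: "wt R (z B) = (\<Sum>j\<in>V. tau B j * wt (Y j) (sig j)) + wt Q g"
        unfolding R_def z_def by (rule virt_total(2)[OF VS fQ QV])
      have "wt R (z B) - wt R s - ((\<Sum>j\<in>VP. val (x j)) - (\<Sum>j\<in>VM. val (x j)) + wt Q g - wt R s
            - 2 * (\<Sum>j\<in>B. val (x j) - val (x (p j))))
          = (\<Sum>j\<in>V. tau B j * wt (Y j) (sig j)) - (\<Sum>j\<in>V. tau B j * val (x j))"
        unfolding w tau_sum[OF B] by simp
      also have "\<dots> = (\<Sum>j\<in>V. tau B j * (wt (Y j) (sig j) - val (x j)))"
        by (simp add: sum_subtractf right_diff_distrib)
      finally show "int n dvd wt R (z B) - wt R s - ((\<Sum>j\<in>VP. val (x j)) - (\<Sum>j\<in>VM. val (x j)) + wt Q g - wt R s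
            - 2 * (\<Sum>j\<in>B. val (x j) - val (x (p j))))"
        using sig(3) VS by (auto intro!: dvd_sum dvd_mult)
    qed (rule L)
    have sub: "set (take l L) \<subseteq> VP" for l using set_take_subset[of l L] L by simp
    have "(\<lambda>l. (wt R (z (set (take l L))) - wt R s) mod int n) ` {..length L} \<subseteq> (\<lambda>z. (wt R z - wt R s) mod int n) ` insert s Zs"
      unfolding Zs_def by auto
    then have "length L + 1 \<le> card ((\<lambda>z. (wt R z - wt R s) mod int n) ` insert s Zs)"
      unfolding cardZ[symmetric] by (rule card_mono[rotated]) (simp add: Zs_def)
    moreover have "card ((\<lambda>z. (wt R z - wt R s) mod int n) ` insert s Zs) + 2 * card (Null T s) + card Up + card (F \<inter> ?pl) \<le> n + 1"
    proof (rule bound[OF VS Vbig FC(1) FV R])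
      show "signing y \<and> imb R y = imb R s \<and> (\<forall>j\<in>V. \<bar>imb (Y j) y\<bar> \<le> \<bar>imb (Y j) s\<bar>)" if "y \<in> Zs" for y
        using that zprop[OF sub] unfolding Zs_def by blast
    qed (use Fpl Fp Fm in auto)
    moreover have "length L = r" using L cVP by (metis distinct_card)
    ultimately have bd: "r + 2 * card (Null T s) + W \<le> n" using Fpl Fp(2) unfolding W_def by simp
    have cb: "card Pu + card Mu + card big = card Sg" "card Pu + card big \<ge> card P" "card Mu + card big \<ge> card M"
    proof -
      have fb: "finite big" using bigS finSg finite_subset by blast
      have e: "Sg = (Pu \<union> Mu) \<union> big" "(Pu \<union> Mu) \<inter> big = {}" unfolding Pu_def Mu_def using PM bigS by auto
      have "card ((Pu \<union> Mu) \<union> big) = card (Pu \<union> Mu) + card big" by (rule card_Un_disjoint) (use fu fb e(2) in auto)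
      then have "card Sg = card (Pu \<union> Mu) + card big" by (subst (1) e(1))
      then show "card Pu + card Mu + card big = card Sg" using card_Un_disjoint[OF fu PuS(3)] by simp
      show "card Pu + card big \<ge> card P" "card Mu + card big \<ge> card M"
        unfolding Pu_def Mu_def using diff_card_le_card_Diff[OF fb, of P] diff_card_le_card_Diff[OF fb, of M] by linarith+
    qed
    have cPM: "card P + card M = card Sg" using PM fP by (metis card_Un_disjoint)
    have Wl: "2 * card (T \<inter> Act T s) + 2 * card big \<le> W" unfolding W_def by (rule U_lower')
    \<comment> \<open>Each of the four bounds that may determine \<open>r\<close> contradicts
      \<open>bd\<close>. If a class is exhausted, the other one still has at most
      \<open>b <= n\<close> blocks, so \<open>2 * f <= card Sg\<close> limits \<open>f\<close>; if
      \<open>r = b - 1\<close>, both classes have at most \<open>b\<close> blocks and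
      \<open>f <= b\<close>.\<close>
    have "min (min a b) (min c d) = a \<or> min (min a b) (min c d) = b \<or> min (min a b) (min c d) = c
        \<or> min (min a b) (min c d) = d" for a b c d :: nat by (auto simp: min_def)
    then consider "r = card Pu" | "r = card Mu" | "r = (card Pu + card Mu - W) div 2" | "r = b - 1"
      unfolding r_def by blast
    then show False
    proof cases
      case 1 then show False using bd cb cPM Wl PM f(1) arithT by linarith
    next
      case 2 then show False using bd cb cPM Wl PM f(1) arithT by linarith
    next
      case 3
      then have "card Pu + card Mu \<le> 2 * r + W + 1" by linarith
      then show False using bd cb Wl f(1) arithT by linarith
    next
      case 4
      then show False using bd cb cPM Wl PM f(1) arithT by linarith
    qed
  qed
qed

end

section \<open>Small covers of an atom\<close>

locale atom_cover = signed_index n val Rf for n :: nat and val :: "'i \<Rightarrow> int" and Rf :: "'i set" +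
  fixes K :: "'j set" and Bl :: "'j \<Rightarrow> 'i set" and A :: "'i set"
  assumes finK: "finite K" and finBl: "j \<in> K \<Longrightarrow> finite (Bl j)"
    and Bldisj: "j \<in> K \<Longrightarrow> k \<in> K \<Longrightarrow> j \<noteq> k \<Longrightarrow> Bl j \<inter> Bl k = {}"
    and Bl_product_one: "j \<in> K \<Longrightarrow> product_one (Bl j)"
    and A: "atom A" "A \<subseteq> \<Union>(Bl ` K)" and C: "product_one (\<Union>(Bl ` K) - A)"
begin

section \<open>Blocks that meet the atom\<close>

definition I where "I = {j \<in> K. Bl j \<inter> A \<noteq> {}}"
definition Y where "Y j = Bl j - A"
definition Sr where "Sr = {j \<in> I. card (Bl j \<inter> A) = 1 \<and> Bl j \<inter> A \<subseteq> Rf}"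
definition So where "So = {j \<in> I. card (Bl j \<inter> A) = 1 \<and> Bl j \<inter> A \<inter> Rf = {}}"
definition elt where "elt j = the_elem (Bl j \<inter> A)"

lemma IK: "I \<subseteq> K" unfolding I_def by auto
lemma finI: "finite I" using IK finK finite_subset by blast
lemma SI: "Sr \<subseteq> I" "So \<subseteq> I" unfolding Sr_def So_def by auto
lemma finS: "finite Sr" "finite So" using SI finI finite_subset by blast+
lemma finA: "finite A" using A by (simp add: atom_def)
lemma A_I: "A = \<Union>((\<lambda>j. Bl j \<inter> A) ` I)" using A(2) unfolding I_def by blast
lemma notI: "j \<in> K \<Longrightarrow> j \<notin> I \<Longrightarrow> Bl j \<inter> A = {}" unfolding I_def by auto

lemma elt: "j \<in> Sr \<union> So \<Longrightarrow> Bl j \<inter> A = {elt j}"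
proof -
  assume "j \<in> Sr \<union> So"
  then have "card (Bl j \<inter> A) = 1" unfolding Sr_def So_def by auto
  then obtain x where "Bl j \<inter> A = {x}" by (metis card_1_singletonE)
  then show ?thesis unfolding elt_def by simp
qed

lemma elt_A: "j \<in> Sr \<union> So \<Longrightarrow> elt j \<in> A" using elt by blast

lemma elt_notY: "j \<in> Sr \<union> So \<Longrightarrow> elt j \<notin> Y j" using elt_A unfolding Y_def by blast

lemma elt_Sr: "j \<in> Sr \<Longrightarrow> elt j \<in> Rf"
proof -
  assume j: "j \<in> Sr"
  then have "Bl j \<inter> A \<subseteq> Rf" unfolding Sr_def by blast
  then show ?thesis using elt[of j] j by blast
qed

lemma elt_So: "j \<in> So \<Longrightarrow> elt j \<notin> Rf"
proof -
  assume j: "j \<in> So"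
  then have "Bl j \<inter> A \<inter> Rf = {}" unfolding So_def by blast
  then show ?thesis using elt[of j] j by blast
qed

lemma ex_al: "\<exists>al. good A al"
proof -
  have "product_one A" using A(1) unfolding atom_def by blast
  then show ?thesis by (rule product_one_good)
qed

lemma elt_inj: "inj_on elt (Sr \<union> So)"
proof (rule inj_onI)
  fix j k assume jk: "j \<in> Sr \<union> So" "k \<in> Sr \<union> So" "elt j = elt k"
  then have "elt j \<in> Bl j \<inter> Bl k" using elt[OF jk(1)] elt[OF jk(2)] by auto
  then show "j = k" using Bldisj[of j k] jk SI IK by blast
qed

lemma insert_elt: "j \<in> Sr \<union> So \<Longrightarrow> insert (elt j) (Y j) = Bl j" using elt unfolding Y_def by blast

lemma card_A: "card A = (\<Sum>j\<in>I. card (Bl j \<inter> A))" "card (A \<inter> Rf) = (\<Sum>j\<in>I. card (Bl j \<inter> A \<inter> Rf))"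
proof -
  have d: "\<forall>i\<in>I. \<forall>j\<in>I. i \<noteq> j \<longrightarrow> Bl i \<inter> A \<inter> (Bl j \<inter> A) = {}" using Bldisj IK by blast
  have d': "\<forall>i\<in>I. \<forall>j\<in>I. i \<noteq> j \<longrightarrow> Bl i \<inter> A \<inter> Rf \<inter> (Bl j \<inter> A \<inter> Rf) = {}" using Bldisj IK by blast
  have "card (\<Union>((\<lambda>j. Bl j \<inter> A) ` I)) = (\<Sum>j\<in>I. card (Bl j \<inter> A))"
    by (rule card_UN_disjoint[OF finI _ d]) (use finA in simp)
  then show "card A = (\<Sum>j\<in>I. card (Bl j \<inter> A))" using A_I by simp
  have "card (\<Union>((\<lambda>j. Bl j \<inter> A \<inter> Rf) ` I)) = (\<Sum>j\<in>I. card (Bl j \<inter> A \<inter> Rf))"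
    by (rule card_UN_disjoint[OF finI _ d']) (use finA in simp)
  moreover have "\<Union>((\<lambda>j. Bl j \<inter> A \<inter> Rf) ` I) = A \<inter> Rf" using A_I by blast
  ultimately show "card (A \<inter> Rf) = (\<Sum>j\<in>I. card (Bl j \<inter> A \<inter> Rf))" by simp
qed

lemma card_I_pos: "j \<in> I \<Longrightarrow> card (Bl j \<inter> A) \<ge> 1"
proof -
  assume "j \<in> I"
  then have "Bl j \<inter> A \<noteq> {}" unfolding I_def by auto
  then have "card (Bl j \<inter> A) > 0" using finA by (simp add: card_gt_0_iff)
  then show ?thesis by simp
qed

lemma card_I: "card I \<le> card A"
proof -
  have "card I = (\<Sum>j\<in>I. 1)" by simp
  also have "\<dots> \<le> card A" unfolding card_A(1) by (rule sum_mono) (rule card_I_pos)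
  finally show ?thesis .
qed

text \<open>Blockwise: if a block contains \<open>k\<close> terms of \<open>A\<close>,
  \<open>q\<close> of them reflections, then \<open>q + 2 <= 2 * k\<close> holds for
  \<open>k >= 2\<close>; for \<open>k = 1\<close> it fails only if the term is a reflection, and
  then by exactly 1.\<close>

lemma count_reflections: "card (A \<inter> Rf) + 2 * card I \<le> card Sr + 2 * card A"
proof -
  have "card (A \<inter> Rf) + 2 * card I = (\<Sum>j\<in>I. card (Bl j \<inter> A \<inter> Rf) + 2)"
    unfolding card_A(2) sum.distrib by simp
  also have "\<dots> \<le> (\<Sum>j\<in>I. (if j \<in> Sr then 1 else 0) + 2 * card (Bl j \<inter> A))"
  proof (rule sum_mono)
    fix j assume j: "j \<in> I"
    have le: "card (Bl j \<inter> A \<inter> Rf) \<le> card (Bl j \<inter> A)" by (rule card_mono) (use finA in auto)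
    show "card (Bl j \<inter> A \<inter> Rf) + 2 \<le> (if j \<in> Sr then 1 else 0) + 2 * card (Bl j \<inter> A)"
    proof (cases "card (Bl j \<inter> A) = 1")
      case True
      then obtain x where x: "Bl j \<inter> A = {x}" by (metis card_1_singletonE)
      show ?thesis
      proof (cases "x \<in> Rf")
        case True then show ?thesis using x j unfolding Sr_def by simp
      next
        case False then show ?thesis using x by simp
      qed
    next
      case False then show ?thesis using card_I_pos[OF j] le by linarith
    qed
  qed
  also have "\<dots> = card Sr + 2 * card A"
  proof -
    have "(\<Sum>j\<in>I. if j \<in> Sr then 1 else 0) = card (I \<inter> Sr)" using finI by (simp add: sum.inter_restrict[symmetric])
    moreover have "I \<inter> Sr = Sr" using SI by auto
    ultimately show ?thesis unfolding card_A(1) by (simp add: sum.distrib sum_distrib_left)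
  qed
  finally show ?thesis .
qed

text \<open>A block of \<open>I\<close> outside \<open>So\<close> and \<open>Sr\<close> uses at
  least two terms of \<open>A\<close>, so a large \<open>I\<close> forces many blocks with a single
  one.\<close>

lemma count_singles: "2 * card I \<le> card So + card Sr + card A"
proof -
  have "2 * card I = (\<Sum>j\<in>I. 2)" by simp
  also have "\<dots> \<le> (\<Sum>j\<in>I. ((if j \<in> So then 1 else 0) + (if j \<in> Sr then 1 else 0)) + card (Bl j \<inter> A))"
  proof (rule sum_mono)
    fix j assume j: "j \<in> I"
    show "2 \<le> ((if j \<in> So then 1 else 0) + (if j \<in> Sr then 1 else 0)) + card (Bl j \<inter> A)"
    proof (cases "card (Bl j \<inter> A) = 1")
      case True
      then obtain x where x: "Bl j \<inter> A = {x}" by (metis card_1_singletonE)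
      show ?thesis
      proof (cases "x \<in> Rf")
        case True then show ?thesis using x j unfolding Sr_def by simp
      next
        case False then show ?thesis using x j unfolding So_def by simp
      qed
    next
      case False then show ?thesis using card_I_pos[OF j] by linarith
    qed
  qed
  also have "\<dots> = card So + card Sr + card A"
  proof -
    have e: "(\<Sum>j\<in>I. if j \<in> X then 1 else 0) = card X" if "X \<subseteq> I" for X
    proof -
      have "(\<Sum>j\<in>I. if j \<in> X then 1 else 0) = card (I \<inter> X)" using finI by (simp add: sum.inter_restrict[symmetric])
      moreover have "I \<inter> X = X" using that by auto
      ultimately show ?thesis by simp
    qed
    show ?thesis unfolding card_A(1) sum.distrib e[OF SI(1)] e[OF SI(2)] ..
  qed
  finally show ?thesis .
qed

text \<open>A product-one block has an even number of reflections, so taking away a single one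
  leaves another.\<close>

lemma Sr_leftover: "j \<in> Sr \<Longrightarrow> Y j \<inter> Rf \<noteq> {}"
proof
  assume j: "j \<in> Sr" and e: "Y j \<inter> Rf = {}"
  have jK: "j \<in> K" using j SI IK by auto
  have "elt j \<in> Rf" using elt_Sr[OF j] .
  then have "Bl j \<inter> Rf = {elt j}" using insert_elt[of j] e j by blast
  moreover obtain s where "good (Bl j) s" using Bl_product_one[OF jK] product_one_good by blast
  ultimately show False using even_card_good[OF finBl[OF jK]] by fastforce
qed

section \<open>From covers of the atom to minimal states\<close>

lemma flip: "I \<subseteq> I0 \<Longrightarrow> I0 \<subseteq> K \<Longrightarrow> Sg \<subseteq> I0 \<Longrightarrow> flip_state n val Rf (\<Union>(Bl ` I0) - A) (K - I0) Sg Y"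
proof
  assume a: "I \<subseteq> I0" "I0 \<subseteq> K" "Sg \<subseteq> I0"
  show "finite (\<Union>(Bl ` I0) - A)" using a finK finBl by (meson finite_Diff finite_UN_I finite_subset subsetD)
  show "finite (K - I0)" "finite Sg" using a finK by (auto intro: finite_subset)
  show "finite (Y j)" if "j \<in> K - I0 \<union> Sg" for j using that a finBl unfolding Y_def by blast
  show "(K - I0) \<inter> Sg = {}" using a by blast
  show "Y j \<inter> Y k = {}" if "j \<in> K - I0 \<union> Sg" "k \<in> K - I0 \<union> Sg" "j \<noteq> k" for j k
    using Bldisj[of j k] that a unfolding Y_def by blast
  show "Y j \<subseteq> \<Union>(Bl ` I0) - A" if "j \<in> Sg" for j using that a unfolding Y_def by blast
  show "Y j \<inter> (\<Union>(Bl ` I0) - A) = {}" if "j \<in> K - I0" for j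
    using Bldisj[of j] that a unfolding Y_def by blast
  show "\<exists>s. good (Y j) s" if "j \<in> K - I0" for j
  proof -
    have "Y j = Bl j" using notI[of j] that a unfolding Y_def by blast
    then show ?thesis using Bl_product_one product_one_good that by auto
  qed
qed

lemma finish:
  assumes a: "I \<subseteq> I0" "I0 \<subseteq> K" "T \<subseteq> K - I0" and g: "good ((\<Union>(Bl ` I0) - A) \<union> \<Union>(Y ` T)) s"
    and ne: "(\<Union>(Bl ` I0) - A) \<inter> Rf \<noteq> {}" and c: "card I0 + card T \<le> m"
  shows "\<exists>Om\<subseteq>K. card Om \<le> m \<and> A \<subseteq> \<Union>(Bl ` Om) \<and> product_one (\<Union>(Bl ` Om) - A)"
proof (intro exI conjI)
  show "I0 \<union> T \<subseteq> K" using a by blast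
  show "card (I0 \<union> T) \<le> m" using card_Un_le[of I0 T] c by linarith
  show "A \<subseteq> \<Union>(Bl ` (I0 \<union> T))" using A_I a by blast
  have "\<Union>(Bl ` (I0 \<union> T)) - A = (\<Union>(Bl ` I0) - A) \<union> \<Union>(Y ` T)" unfolding Y_def by blast
  then show "product_one (\<Union>(Bl ` (I0 \<union> T)) - A)" using good_product_one[OF g] ne by auto
qed

lemma initial: "I0 \<subseteq> K \<Longrightarrow> \<exists>s. good ((\<Union>(Bl ` I0) - A) \<union> \<Union>(Y ` (K - I0))) s"
proof -
  assume "I0 \<subseteq> K"
  then have "(\<Union>(Bl ` I0) - A) \<union> \<Union>(Y ` (K - I0)) = \<Union>(Bl ` K) - A" unfolding Y_def by blast
  then show ?thesis using product_one_good[OF C] by simp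
qed

lemma case_plain:
  assumes a: "I \<subseteq> I0" "I0 \<subseteq> K" and ne: "(\<Union>(Bl ` I0) - A) \<inter> Rf \<noteq> {}" and c: "card I0 \<le> n + 1"
  shows "\<exists>Om\<subseteq>K. card Om \<le> 2 * n \<and> A \<subseteq> \<Union>(Bl ` Om) \<and> product_one (\<Union>(Bl ` Om) - A)"
proof -
  interpret fl: flip_state n val Rf "\<Union>(Bl ` I0) - A" "K - I0" "{}" Y by (rule flip) (use a in auto)
  obtain s0 where "good (fl.carr (K - I0)) s0" using initial[OF a(2)] unfolding fl.carr_def by blast
  then obtain T s where st: "fl.minimal_state T s" using fl.ex_minimal_state[of "K - I0"] by blast
  have "card T < n" by (rule fl.card_minimal_state[OF st]) (use ne in auto)
  then show ?thesis
    by (intro finish[OF a, of T s]) (use st c ne in \<open>auto simp: fl.minimal_state_def fl.carr_def\<close>)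
qed

text \<open>The rotations \<open>elt j\<close> with the same sign in \<open>al\<close> are zero-sum
  free by \<open>atom_no_rotations\<close>. Adding the results of \<open>rotation_bound\<close> for
  the two sign classes gives \<open>card So + 2 * card T + 2 * d <= 2 * n\<close>, where
  \<open>d\<close> is 1 if a reflection is available outside the blocks of \<open>So\<close> and 0
  otherwise. The assumption \<open>num\<close> says that a cover with more than \<open>2 * n\<close>
  blocks violates this.\<close>

lemma case_rotations:
  assumes a: "I \<subseteq> I0" "I0 \<subseteq> K" and ne: "(\<Union>(Bl ` I0) - A) \<inter> Rf \<noteq> {}" and AR: "A \<inter> Rf \<noteq> {}"
    and c: "card I0 \<le> 2 * n"
    and num: "\<And>t. 2 * n < card I0 + t \<Longrightarrow> 2 * n < card So + 2 * t +
       (if (\<Union>(Bl ` I0) - A) \<inter> Rf - \<Union>(Y ` So) = {} then 0 else 2)"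
  shows "\<exists>Om\<subseteq>K. card Om \<le> 2 * n \<and> A \<subseteq> \<Union>(Bl ` Om) \<and> product_one (\<Union>(Bl ` Om) - A)"
proof -
  interpret fl: flip_state n val Rf "\<Union>(Bl ` I0) - A" "K - I0" So Y by (rule flip) (use a SI in auto)
  obtain s0 where "good (fl.carr (K - I0)) s0" using initial[OF a(2)] unfolding fl.carr_def by blast
  then obtain T s where st: "fl.minimal_state T s" using fl.ex_minimal_state[of "K - I0"] by blast
  have "card I0 + card T \<le> 2 * n"
  proof (rule ccontr)
    assume "\<not> ?thesis"
    then have gt: "2 * n < card I0 + card T" by simp
    then have T: "T \<noteq> {}" using c by auto
    obtain al where al: "good A al" using ex_al by blast
    have sal: "signing al" using al by (simp add: good_def)
    define g where "g j = (SOME s. good (Bl j) s)" for j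
    have g: "good (Bl j) (g j)" if "j \<in> K" for j unfolding g_def using product_one_good[OF Bl_product_one[OF that]] by (rule someI_ex)
    let ?d = "if (\<Union>(Bl ` I0) - A) \<inter> Rf - \<Union>(Y ` So) = {} then 0 else 1 :: nat"
    let ?J = "{j \<in> So. imb (Y j) s \<noteq> 0}"
    have main: "card {j \<in> {j \<in> So. al (elt j) = e}. imb (Y j) s = 0} + card T + card ?J + ?d \<le> n" for e
    proof (rule fl.rotation_bound[OF st T, where x = elt and ?sg0.0 = g])
      fix j assume j: "j \<in> So"
      show "elt j \<notin> Rf" "elt j \<notin> Y j" using elt_So elt_notY j by blast+
      show "good (insert (elt j) (Y j)) (g j)" using insert_elt[of j] g[of j] j SI IK by auto
    next
      fix B assume B: "B \<noteq> {}" "B \<subseteq> {j \<in> So. al (elt j) = e}"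
      have inj: "inj_on elt B" by (rule inj_on_subset[OF elt_inj]) (use B in auto)
      have "elt ` B \<subseteq> A - Rf"
      proof
        fix y assume "y \<in> elt ` B"
        then obtain j where j: "j \<in> So" "y = elt j" using B by auto
        then show "y \<in> A - Rf" using elt_So elt_A by blast
      qed
      then have "\<not> int n dvd sum val (elt ` B)"
        by (rule atom_no_rotations[OF A(1) al AR, of _ e]) (use B in auto)
      moreover have "sum val (elt ` B) = (\<Sum>j\<in>B. val (elt j))" by (rule sum.reindex_cong[OF inj]) auto
      ultimately show "\<not> int n dvd (\<Sum>j\<in>B. val (elt j))" by simp
    qed auto
    have "card So = card {j \<in> {j \<in> So. al (elt j) = 1}. imb (Y j) s = 0}
        + card {j \<in> {j \<in> So. al (elt j) = -1}. imb (Y j) s = 0} + card ?J"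
    proof -
      have e: "So = ({j \<in> {j \<in> So. al (elt j) = 1}. imb (Y j) s = 0}
        \<union> {j \<in> {j \<in> So. al (elt j) = -1}. imb (Y j) s = 0}) \<union> ?J" using signingD[OF sal] by auto
      have "card (({j \<in> {j \<in> So. al (elt j) = 1}. imb (Y j) s = 0}
        \<union> {j \<in> {j \<in> So. al (elt j) = -1}. imb (Y j) s = 0}) \<union> ?J) = card {j \<in> {j \<in> So. al (elt j) = 1}. imb (Y j) s = 0}
        + card {j \<in> {j \<in> So. al (elt j) = -1}. imb (Y j) s = 0} + card ?J"
        by (subst card_Un_disjoint, use finS in auto)+ 
      then show ?thesis using e by simp
    qed
    then have "card So + 2 * card T + 2 * ?d \<le> 2 * n" using main[of 1] main[of "-1"] by linarith
    then show False using num[OF gt] by (auto split: if_splits)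
  qed
  then show ?thesis
    by (intro finish[OF a, of T s]) (use st ne in \<open>auto simp: fl.minimal_state_def fl.carr_def\<close>)
qed

text \<open>The reflections \<open>elt j\<close> are divided by their sign in \<open>al\<close>.
  Equally many from both classes, fewer than \<open>b\<close>, form a balanced part of the atom with
  a reflection left outside, so \<open>atom_no_balanced\<close> yields the hypothesis
  \<open>zf\<close> of \<open>reflection_bound\<close>.\<close>

lemma case_reflections:
  assumes ne: "(\<Union>(Bl ` I) - A) \<inter> Rf \<noteq> {}" and b: "card (A \<inter> Rf) = 2 * b" "b \<ge> 2" and c: "n + 2 \<le> card I"
  shows "\<exists>Om\<subseteq>K. card Om \<le> 2 * n \<and> A \<subseteq> \<Union>(Bl ` Om) \<and> product_one (\<Union>(Bl ` Om) - A)"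
proof -
  have a: "I \<subseteq> I" "I \<subseteq> K" using IK by auto
  interpret fl: flip_state n val Rf "\<Union>(Bl ` I) - A" "K - I" Sr Y by (rule flip) (use a SI in auto)
  obtain s0 where "good (fl.carr (K - I)) s0" using initial[OF a(2)] unfolding fl.carr_def by blast
  then obtain T s where st: "fl.minimal_state T s" using fl.ex_minimal_state[of "K - I"] by blast
  obtain al where al: "good A al" using ex_al by blast
  have sal: "signing al" using al by (simp add: good_def)
  have ab: "card (A - Rf) + b \<le> n" by (rule atom_card_pairs[OF A(1) al b])
  have cA: "card A = card (A \<inter> Rf) + card (A - Rf)"
    using finA by (metis card_Diff_subset_Int card_mono finite_Int inf_le1 le_add_diff_inverse)
  have half: "card (A \<inter> Rf \<inter> {i. al i = 1}) = b" "card (A \<inter> Rf \<inter> {i. al i = -1}) = b"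
    using imb_card[OF finA sal] al card_Rf_split[OF finA sal] b unfolding good_def by auto
  have "card I + card T \<le> 2 * n"
  proof (rule ccontr)
    assume "\<not> ?thesis"
    then have gt: "2 * n < card I + card T" by simp
    define g where "g j = (SOME s. good (Bl j) s)" for j
    have g: "good (Bl j) (g j)" if "j \<in> K" for j unfolding g_def using product_one_good[OF Bl_product_one[OF that]] by (rule someI_ex)
    \<comment> \<open>With this \<open>f\<close>, \<open>count_reflections\<close> reads
      \<open>2 * f <= card Sr\<close>; and since \<open>card A = 2 * b + card (A - Rf)\<close> and
      \<open>card (A - Rf) + b <= n\<close>, the assumption \<open>2 * n < card I + card T\<close>
      becomes \<open>n < card T + f\<close>.\<close>
    define f where "f = b + card I - card A"
    have fb: "f + card A = b + card I" unfolding f_def using cA b ab c by linarith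
    have Sre: "elt j \<in> A \<inter> Rf" if "j \<in> Sr" for j using elt_Sr elt_A that by blast
    have cls: "card {j \<in> Sr. al (elt j) = e} \<le> card (A \<inter> Rf \<inter> {i. al i = e})" for e
    proof -
      have "card {j \<in> Sr. al (elt j) = e} = card (elt ` {j \<in> Sr. al (elt j) = e})"
        by (rule card_image[symmetric]) (rule inj_on_subset[OF elt_inj], auto)
      also have "\<dots> \<le> card (A \<inter> Rf \<inter> {i. al i = e})" by (rule card_mono) (use finA Sre in auto)
      finally show ?thesis .
    qed
    show False
    proof (rule fl.reflection_bound[OF st, where x = elt and ?sg0.0 = g and b = b and f = f
          and P = "{j \<in> Sr. al (elt j) = 1}" and M = "{j \<in> Sr. al (elt j) = -1}"])
      fix j assume j: "j \<in> Sr"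
      show "elt j \<in> Rf" using Sre j by auto
      show "elt j \<notin> Y j" using elt_notY j by blast
      show "good (insert (elt j) (Y j)) (g j)" using insert_elt[of j] g[of j] j SI IK by auto
    next
      show "{j \<in> Sr. al (elt j) = 1} \<union> {j \<in> Sr. al (elt j) = -1} = Sr" using signingD[OF sal] by auto
      show "card {j \<in> Sr. al (elt j) = 1} \<le> b" "card {j \<in> Sr. al (elt j) = -1} \<le> b" using cls half by metis+
      show "b \<le> n" using ab by simp
      show "2 * f \<le> card Sr" using count_reflections b fb by linarith
      show "n < card T + f" using gt fb cA b ab by linarith
    next
      fix B B' assume B: "B \<subseteq> {j \<in> Sr. al (elt j) = 1}" "B' \<subseteq> {j \<in> Sr. al (elt j) = -1}" "card B = card B'"
        "B \<noteq> {}" "card B < b"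
      have inj: "inj_on elt B" "inj_on elt B'" using B by (auto intro!: inj_on_subset[OF elt_inj])
      have fB: "finite B" "finite B'" using B finS by (auto intro: finite_subset)
      let ?X = "elt ` B" and ?X' = "elt ` B'"
      have X: "?X \<subseteq> A \<inter> Rf" "?X' \<subseteq> A \<inter> Rf" using B Sre by blast+
      have s1: "\<forall>y\<in>?X. al y = 1" "\<forall>y\<in>?X'. al y = -1" using B by auto
      have d: "?X \<inter> ?X' = {}" using s1 by fastforce
      have fX: "finite ?X" "finite ?X'" using fB by auto
      have R: "?X \<inter> Rf = ?X" "?X' \<inter> Rf = ?X'" using X by blast+
      have "imb (?X \<union> ?X') al = imb ?X al + imb ?X' al" by (rule imb_Un[OF fX d])
      also have "\<dots> = sum al ?X + sum al ?X'" unfolding imb_def R ..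
      also have "sum al ?X = (\<Sum>y\<in>?X. 1)" by (rule sum.cong[OF refl]) (use s1 in blast)
      also have "\<dots> = int (card B)" using card_image[OF inj(1)] by simp
      also have "sum al ?X' = (\<Sum>y\<in>?X'. -1)" by (rule sum.cong[OF refl]) (use s1 in blast)
      also have "\<dots> = - int (card B')" using card_image[OF inj(2)] by simp
      finally have "imb (?X \<union> ?X') al = 0" using B by simp
      moreover have "?X \<union> ?X' \<subseteq> A" using X by blast
      moreover have "(?X \<union> ?X') \<inter> Rf \<noteq> {}" using B R by blast
      moreover have "(A - (?X \<union> ?X')) \<inter> Rf \<noteq> {}"
      proof
        assume "(A - (?X \<union> ?X')) \<inter> Rf = {}"
        then have "A \<inter> Rf \<subseteq> ?X \<union> ?X'" by blast
        then have "card (A \<inter> Rf) \<le> card (?X \<union> ?X')" using fX by (intro card_mono) auto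
        also have "\<dots> \<le> card ?X + card ?X'" by (rule card_Un_le)
        also have "\<dots> = card B + card B'" using card_image[OF inj(1)] card_image[OF inj(2)] by simp
        finally show False using B b by linarith
      qed
      ultimately have nd: "\<not> int n dvd wt (?X \<union> ?X') al" using atom_no_balanced[OF A(1) al] by blast
      have "wt (?X \<union> ?X') al = wt ?X al + wt ?X' al" by (rule wt_Un[OF fX d])
      also have "\<dots> = (\<Sum>y\<in>?X. al y * val y) + (\<Sum>y\<in>?X'. al y * val y)" unfolding wt_def ..
      also have "(\<Sum>y\<in>?X. al y * val y) = (\<Sum>j\<in>B. val (elt j))"
        by (rule sum.reindex_cong[OF inj(1)]) (use s1 in auto)
      also have "(\<Sum>y\<in>?X'. al y * val y) = (\<Sum>j\<in>B'. - val (elt j))"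
        by (rule sum.reindex_cong[OF inj(2)]) (use s1 in auto)
      finally show "\<not> int n dvd (\<Sum>j\<in>B. val (elt j)) - (\<Sum>j\<in>B'. val (elt j))" using nd by (simp add: sum_negf)
    qed auto
  qed
  then show ?thesis
    by (intro finish[OF a, of T s]) (use st ne in \<open>auto simp: fl.minimal_state_def fl.carr_def\<close>)
qed

text \<open>The cases depend on whether the blocks of \<open>I\<close> leave over a reflection and
  on the number \<open>2 * b\<close> of reflections of the atom. For \<open>b = 0\<close> the atom
  has at most \<open>n\<close> terms. For \<open>b >= 2\<close> a large \<open>I\<close> forces many
  blocks in \<open>Sr\<close>. For \<open>b = 1\<close> the rotations may be numerous, but
  \<open>Sr\<close> has at most two blocks, so the blocks with a single term are mostly in
  \<open>So\<close>.\<close>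

lemma small_cover: "\<exists>Om\<subseteq>K. card Om \<le> 2 * n \<and> A \<subseteq> \<Union>(Bl ` Om) \<and> product_one (\<Union>(Bl ` Om) - A)"
proof -
  have cA2: "card A \<le> 2 * n" by (rule atom_card_le[OF A(1)])
  have cA: "card A = card (A \<inter> Rf) + card (A - Rf)"
    using finA by (metis card_Diff_subset_Int card_mono finite_Int inf_le1 le_add_diff_inverse)
  obtain al where al: "good A al" using ex_al by blast
  obtain b where b: "card (A \<inter> Rf) = 2 * b" using even_card_good[OF finA al] by (auto elim: evenE)
  have b0: "card A \<le> n" if "b = 0"
    by (rule atom_rotations_card[OF A(1)]) (use that b finA in simp)
  have bne: "A \<inter> Rf \<noteq> {}" if "b \<noteq> 0" using that b by auto
  have disjI: "Y j \<inter> \<Union>(Y ` So) = {}" if "j \<in> K" "j \<notin> So" for j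
    using Bldisj[of j] that SI IK unfolding Y_def by blast
  show ?thesis
  proof (cases "(\<Union>(Bl ` I) - A) \<inter> Rf = {}")
    case noR: True
    have Sr0: "Sr = {}"
    proof (rule ccontr)
      assume "Sr \<noteq> {}"
      then obtain j where j: "j \<in> Sr" by blast
      then have "Y j \<subseteq> \<Union>(Bl ` I) - A" using SI unfolding Y_def by blast
      then show False using Sr_leftover[OF j] noR by blast
    qed
    show ?thesis
    proof (cases "\<forall>j\<in>K - I. Bl j \<inter> Rf = {}")
      case True
      have e: "\<Union>(Bl ` K) - A = (\<Union>(Bl ` I) - A) \<union> \<Union>(Bl ` (K - I))" using IK notI by blast
      have d: "(\<Union>(Bl ` I) - A) \<inter> \<Union>(Bl ` (K - I)) = {}" using Bldisj IK by blast
      have f: "finite (\<Union>(Bl ` I) - A)" "finite (\<Union>(Bl ` (K - I)))" using finI finK finBl IK by auto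
      have "(\<Union>(Bl ` K) - A) \<inter> Rf = {}" unfolding e using noR True by blast
      then have "int n dvd sum val (\<Union>(Bl ` K) - A)" using C by (simp add: product_one_def)
      then have 1: "int n dvd sum val (\<Union>(Bl ` I) - A) + sum val (\<Union>(Bl ` (K - I)))"
        unfolding e sum.union_disjoint[OF f d] .
      have "sum val (\<Union>(Bl ` (K - I))) = (\<Sum>j\<in>K - I. sum val (Bl j))"
        by (rule sum.UNION_disjoint) (use finK finBl Bldisj in blast)+
      moreover have "int n dvd (\<Sum>j\<in>K - I. sum val (Bl j))"
        by (rule dvd_sum) (use True Bl_product_one in \<open>auto simp: product_one_def\<close>)
      ultimately have "int n dvd sum val (\<Union>(Bl ` I) - A)" using 1 by (simp add: dvd_add_left_iff)
      then have "product_one (\<Union>(Bl ` I) - A)" using noR by (simp add: product_one_def)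
      moreover have "A \<subseteq> \<Union>(Bl ` I)" using A_I by blast
      moreover have "card I \<le> 2 * n" using card_I cA2 by linarith
      ultimately show ?thesis using IK by blast
    next
      \<comment> \<open>Only a block outside \<open>I\<close> can provide the reflection that the
        kept part needs; one such block is added to it.\<close>
      case False
      then obtain j0 where j0: "j0 \<in> K" "j0 \<notin> I" "Bl j0 \<inter> Rf \<noteq> {}" by blast
      let ?I0 = "insert j0 I"
      have a: "I \<subseteq> ?I0" "?I0 \<subseteq> K" using IK j0 by auto
      have Y0: "Y j0 = Bl j0" using notI[OF j0(1,2)] unfolding Y_def by blast
      then have ne: "(\<Union>(Bl ` ?I0) - A) \<inter> Rf \<noteq> {}" using j0 unfolding Y_def by blast
      have cI0: "card ?I0 = card I + 1" using finI j0 by simp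
      show ?thesis
      proof (cases "b = 1")
        case False
        have "card I \<le> n"
        proof (cases "b = 0")
          case True then show ?thesis using b0 card_I by linarith
        next
          case F: False
          then have "card (A - Rf) + b \<le> n" using atom_card_pairs[OF A(1) al b] False by simp
          then show ?thesis using count_reflections Sr0 b cA by simp
        qed
        then show ?thesis by (intro case_plain[OF a ne]) (use cI0 in simp)
      next
        \<comment> \<open>The added block costs 1 in \<open>card ?I0\<close>, hence 2 after
          doubling; its reflection lies outside the blocks of \<open>So\<close> and gains exactly
          this 2.\<close>
        case True
        have cI: "card I + 1 \<le> card A" using count_reflections Sr0 b True by simp
        have "j0 \<notin> So" using j0 SI by blast
        then have dj: "Y j0 \<inter> \<Union>(Y ` So) = {}" using disjI[OF j0(1)] by blast
        have "Y j0 \<inter> Rf \<noteq> {}" using Y0 j0 by simp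
        then obtain y where y: "y \<in> Y j0" "y \<in> Rf" by blast
        have "y \<notin> \<Union>(Y ` So)" using dj y(1) by blast
        moreover have "y \<in> \<Union>(Bl ` ?I0) - A" using y(1) unfolding Y_def by simp
        ultimately have ne': "(\<Union>(Bl ` ?I0) - A) \<inter> Rf - \<Union>(Y ` So) \<noteq> {}" using y(2) by (metis DiffI IntI empty_iff)
        show ?thesis
        proof (rule case_rotations[OF a ne])
          show "A \<inter> Rf \<noteq> {}" using bne True by simp
          show "card ?I0 \<le> 2 * n" using cI0 cI cA2 by linarith
          fix t assume "2 * n < card ?I0 + t"
          then have "2 * n < card So + 2 * t + 2" using cI0 count_singles Sr0 cA2 by simp
          then show "2 * n < card So + 2 * t + (if (\<Union>(Bl ` ?I0) - A) \<inter> Rf - \<Union>(Y ` So) = {} then 0 else 2)"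
            using ne' by simp
        qed
      qed
    qed
  next
    case ne: False
    show ?thesis
    proof (cases "card I \<le> n + 1")
      case True
      then show ?thesis by (intro case_plain[OF _ IK ne]) auto
    next
      case False
      then have cI: "n + 2 \<le> card I" by simp
      have bn0: "b \<noteq> 0" using b0 cI card_I by auto
      show ?thesis
      proof (cases "b \<ge> 2")
        case True then show ?thesis by (rule case_reflections[OF ne b _ cI])
      next
        case F: False
        then have b1: "b = 1" using bn0 by simp
        have cSr: "card Sr \<le> 2"
        proof -
          have "card Sr = card (elt ` Sr)" by (rule card_image[symmetric]) (rule inj_on_subset[OF elt_inj], blast)
          also have "elt ` Sr \<subseteq> A \<inter> Rf" using elt_Sr elt_A by blast
          then have "card (elt ` Sr) \<le> card (A \<inter> Rf)" by (rule card_mono[rotated]) (use finA in simp)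
          finally show ?thesis using b b1 by simp
        qed
        \<comment> \<open>The blocks of \<open>Sr\<close> spoil the count by at most 2 in total, and
          as soon as there is one, its leftover reflection lies outside the blocks of
          \<open>So\<close> and gains 2.\<close>
        have Sr0: "Sr = {}" if e: "(\<Union>(Bl ` I) - A) \<inter> Rf - \<Union>(Y ` So) = {}"
        proof (rule ccontr)
          assume "Sr \<noteq> {}"
          then obtain j where j: "j \<in> Sr" by blast
          have jI: "j \<in> I" "j \<in> K" using j SI IK by auto
          have "j \<notin> So" using elt_Sr[OF j] elt_So by blast
          then have "Y j \<inter> \<Union>(Y ` So) = {}" using disjI jI by blast
          moreover have "Y j \<subseteq> \<Union>(Bl ` I) - A" using jI unfolding Y_def by blast
          ultimately show False using Sr_leftover[OF j] e by blast
        qed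
        show ?thesis
        proof (rule case_rotations[OF _ IK ne])
          show "A \<inter> Rf \<noteq> {}" using bne bn0 by simp
          show "card I \<le> 2 * n" using card_I cA2 by linarith
          fix t assume t: "2 * n < card I + t"
          show "2 * n < card So + 2 * t + (if (\<Union>(Bl ` I) - A) \<inter> Rf - \<Union>(Y ` So) = {} then 0 else 2)"
          proof (cases "(\<Union>(Bl ` I) - A) \<inter> Rf - \<Union>(Y ` So) = {}")
            case True
            then show ?thesis using t count_singles Sr0[OF True] cA2 by simp
          next
            case False
            then show ?thesis using t count_singles cSr cA2 by simp
          qed
        qed simp
      qed
    qed
  qed
qed

end

section \<open>Dihedral groups\<close>

text \<open>Every ordering of the terms comes from an ordering of the indices, equal terms being
  distributed arbitrarily. Thus orderings with product one can be studied on index sets.\<close>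

lemma ex_index_list:
  "finite X \<Longrightarrow> mset ys = image_mset f (mset_set X) \<Longrightarrow> \<exists>xs. distinct xs \<and> set xs = X \<and> map f xs = ys"
proof (induction ys arbitrary: X)
  case Nil
  then have "X = {}" by (simp add: mset_set_empty_iff)
  then show ?case by simp
next
  case (Cons y ys)
  have "y \<in># image_mset f (mset_set X)" using Cons.prems(2) by (metis list.set_intros(1) set_mset_mset)
  then obtain x where x: "x \<in> X" "y = f x" using Cons.prems(1) by auto
  have "mset_set X = add_mset x (mset_set (X - {x}))" by (rule mset_set.remove[OF Cons.prems(1) x(1)])
  then have "mset ys = image_mset f (mset_set (X - {x}))" using Cons.prems(2) x by simp
  then obtain xs where "distinct xs" "set xs = X - {x}" "map f xs = ys" using Cons.IH[of "X - {x}"] Cons.prems(1) by auto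
  then show ?case using x by (intro exI[of _ "x # xs"]) auto
qed

lemma ex_index_subset:
  "finite X \<Longrightarrow> M \<subseteq># image_mset f (mset_set X) \<Longrightarrow> \<exists>B\<subseteq>X. image_mset f (mset_set B) = M"
proof -
  assume X: "finite X" and M: "M \<subseteq># image_mset f (mset_set X)"
  obtain N where N: "image_mset f (mset_set X) = M + N" using M by (metis mset_subset_eq_exists_conv)
  obtain ms ns where l: "mset ms = M" "mset ns = N" using ex_mset by metis
  then obtain xs where xs: "distinct xs" "set xs = X" "map f xs = ms @ ns"
    using ex_index_list[OF X, of "ms @ ns" f] N by auto
  let ?B = "set (take (length ms) xs)"
  have "mset_set ?B = mset (take (length ms) xs)" using xs(1) by (simp add: mset_set_set)
  then have "image_mset f (mset_set ?B) = mset (map f (take (length ms) xs))" by simp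
  also have "map f (take (length ms) xs) = ms" by (simp add: take_map[symmetric] xs(3))
  finally show ?thesis using l xs(2) set_take_subset by metis
qed

section \<open>Orderings and signings\<close>

context signed_index begin

text \<open>Exponent of \<open>a\<close> in the normal form of the product of the list, with
  \<open>lpar\<close> as exponent of \<open>b\<close>; see \<open>foldr_rp\<close>. A leading
  reflection negates the exponent of what follows.\<close>

fun lval :: "'i list \<Rightarrow> int" where
  "lval [] = 0"
| "lval (x # xs) = val x + (if x \<in> Rf then - lval xs else lval xs)"

fun lpar :: "'i list \<Rightarrow> bool" where
  "lpar [] = False"
| "lpar (x # xs) = ((x \<in> Rf) \<noteq> lpar xs)"

lemma imb_insert: "finite X \<Longrightarrow> x \<notin> X \<Longrightarrow> imb (insert x X) s = (if x \<in> Rf then s x else 0) + imb X s"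
  using imb_Un[of "{x}" X s] by (auto simp: imb_def)

lemma wt_insert: "finite X \<Longrightarrow> x \<notin> X \<Longrightarrow> wt (insert x X) s = s x * val x + wt X s"
  by (simp add: wt_def)

lemma signing_of_list:
  "distinct xs \<Longrightarrow> \<exists>s. signing s \<and> wt (set xs) s = lval xs \<and> imb (set xs) s = (if lpar xs then 1 else 0)"
proof (induction xs)
  case Nil
  then show ?case by (intro exI[of _ "\<lambda>_. 1"]) (simp add: signing_def)
next
  case (Cons x xs)
  then obtain s where s: "signing s" "wt (set xs) s = lval xs" "imb (set xs) s = (if lpar xs then 1 else 0)" by auto
  define s' where "s' i = (if i = x then 1 else if x \<in> Rf then - s i else s i)" for i
  have x: "x \<notin> set xs" using Cons.prems by simp
  have 1: "signing s'" unfolding signing_def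
  proof
    fix i show "s' i = 1 \<or> s' i = -1" unfolding s'_def using signingD[OF s(1), of i] by auto
  qed
  have "wt (set xs) s' = (if x \<in> Rf then - wt (set xs) s else wt (set xs) s)"
    using x by (auto simp: s'_def intro!: wt_cong wt_minus)
  moreover have "imb (set xs) s' = (if x \<in> Rf then - imb (set xs) s else imb (set xs) s)"
    using x by (auto simp: s'_def intro!: imb_cong imb_minus)
  ultimately have "wt (set (x # xs)) s' = lval (x # xs)" "imb (set (x # xs)) s' = (if lpar (x # xs) then 1 else 0)"
    using s x by (auto simp: wt_insert imb_insert s'_def)
  then show ?case using 1 by blast
qed

text \<open>The list is built from its head: a rotation of sign 1 if there is one, otherwise a
  reflection of sign 1, after which all remaining signs are negated. The imbalance stays 0 or 1. The
  last assumption excludes rotations of sign -1 that no reflection can turn around; it survives the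
  removal of a reflection because at that moment all remaining rotations have sign -1.\<close>

lemma list_of_signing:
  assumes "finite X" "signing s" "imb X s = 0 \<or> imb X s = 1" "X \<inter> Rf = {} \<Longrightarrow> \<forall>x\<in>X. s x = 1"
  shows "\<exists>xs. distinct xs \<and> set xs = X \<and> lval xs = wt X s \<and> lpar xs = (imb X s = 1)"
  using assms
proof (induction "card X" arbitrary: X s)
  case 0
  then show ?case by (intro exI[of _ "[]"]) simp
next
  case (Suc k)
  have fX: "finite X" and sg: "signing s" using Suc.prems by auto
  have step: "\<exists>xs. distinct xs \<and> set xs = X \<and> lval xs = wt X s \<and> lpar xs = (imb X s = 1)"
    if x: "x \<in> X" "s x = 1" and s': "s' = (if x \<in> Rf then (\<lambda>i. - s i) else s)"
      and h: "imb (X - {x}) s' = 0 \<or> imb (X - {x}) s' = 1" "(X - {x}) \<inter> Rf = {} \<Longrightarrow> \<forall>y\<in>X - {x}. s' y = 1" for x s'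
  proof -
    have f: "finite (X - {x})" and c: "k = card (X - {x})" using fX x Suc.hyps(2) by auto
    have sg': "signing s'" using sg signing_minus[OF sg] unfolding s' by auto
    obtain xs where xs: "distinct xs" "set xs = X - {x}" "lval xs = wt (X - {x}) s'" "lpar xs = (imb (X - {x}) s' = 1)"
      using Suc.hyps(1)[OF c f sg' h] by blast
    have Xe: "X = insert x (X - {x})" using x by auto
    have w: "wt X s = val x + wt (X - {x}) s" using wt_insert[OF f, of x s] x Xe by simp
    have i: "imb X s = (if x \<in> Rf then 1 else 0) + imb (X - {x}) s" using imb_insert[OF f, of x s] x Xe by simp
    have ws: "wt (X - {x}) s' = (if x \<in> Rf then - wt (X - {x}) s else wt (X - {x}) s)"
      unfolding s' by (auto intro!: wt_minus)
    have is': "imb (X - {x}) s' = (if x \<in> Rf then - imb (X - {x}) s else imb (X - {x}) s)"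
      unfolding s' by (auto intro!: imb_minus)
    have "lval (x # xs) = wt X s" using xs w ws by auto
    moreover have "lpar (x # xs) = (imb X s = 1)" using xs(4) i is' h(1) by (auto split: if_splits)
    ultimately show ?thesis using xs x by (intro exI[of _ "x # xs"]) auto
  qed
  show ?case
  proof (cases "\<exists>x\<in>X. x \<notin> Rf \<and> s x = 1")
    case True
    then obtain x where x: "x \<in> X" "x \<notin> Rf" "s x = 1" by blast
    have R: "(X - {x}) \<inter> Rf = X \<inter> Rf" using x by auto
    then have i: "imb (X - {x}) s = imb X s" unfolding imb_def by simp
    show ?thesis
    proof (rule step[OF x(1,3)])
      show "s = (if x \<in> Rf then (\<lambda>i. - s i) else s)" using x(2) by simp
      show "imb (X - {x}) s = 0 \<or> imb (X - {x}) s = 1" unfolding i by (rule Suc.prems(3))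
      show "\<forall>y\<in>X - {x}. s y = 1" if e: "(X - {x}) \<inter> Rf = {}"
      proof -
        have "X \<inter> Rf = {}" using e R by simp
        then have "\<forall>y\<in>X. s y = 1" by (rule Suc.prems(4))
        then show ?thesis by simp
      qed
    qed
  next
    case False
    have ne: "X \<noteq> {}" using Suc.hyps(2) by auto
    have R: "X \<inter> Rf \<noteq> {}" using False Suc.prems(4) ne by blast
    have "\<exists>x\<in>X \<inter> Rf. s x = 1"
    proof (rule ccontr)
      assume "\<not> ?thesis"
      then have "\<forall>x\<in>X \<inter> Rf. s x = -1" using signingD[OF sg] by blast
      then have "imb X s = (\<Sum>x\<in>X \<inter> Rf. -1)" unfolding imb_def by (intro sum.cong) auto
      then have "imb X s = - int (card (X \<inter> Rf))" by simp
      moreover have "card (X \<inter> Rf) > 0" using R fX by (simp add: card_gt_0_iff)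
      ultimately show False using Suc.prems(3) by auto
    qed
    then obtain x where x: "x \<in> X" "x \<in> Rf" "s x = 1" by blast
    have "finite (X - {x})" "x \<notin> X - {x}" "insert x (X - {x}) = X" using fX x(1) by auto
    then have i: "imb X s = 1 + imb (X - {x}) s" using imb_insert[of "X - {x}" x s] x(2,3) by simp
    have m: "imb (X - {x}) (\<lambda>i. - s i) = - imb (X - {x}) s" by (rule imb_minus) simp
    have h: "imb (X - {x}) (\<lambda>i. - s i) = 0 \<or> imb (X - {x}) (\<lambda>i. - s i) = 1"
      using i Suc.prems(3) unfolding m by linarith
    show ?thesis
    proof (rule step[OF x(1,3)])
      show "(\<lambda>i. - s i) = (if x \<in> Rf then (\<lambda>i. - s i) else s)" using x(2) by simp
      show "imb (X - {x}) (\<lambda>i. - s i) = 0 \<or> imb (X - {x}) (\<lambda>i. - s i) = 1" by (rule h)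
      show "\<forall>y\<in>X - {x}. - s y = 1" if e: "(X - {x}) \<inter> Rf = {}"
      proof
        fix y assume y: "y \<in> X - {x}"
        then have "y \<notin> Rf" "y \<in> X" using e by blast+
        then have "s y \<noteq> 1" using False by blast
        then show "- s y = 1" using signingD[OF sg, of y] by simp
      qed
    qed
  qed
qed

lemma product_one_iff_list:
  assumes "finite X"
  shows "product_one X \<longleftrightarrow> (\<exists>xs. distinct xs \<and> set xs = X \<and> \<not> lpar xs \<and> int n dvd lval xs)"
proof
  assume p: "product_one X"
  show "\<exists>xs. distinct xs \<and> set xs = X \<and> \<not> lpar xs \<and> int n dvd lval xs"
  proof (cases "X \<inter> Rf = {}")
    case True
    have "imb X (\<lambda>_. 1) = 0" "wt X (\<lambda>_. 1) = sum val X" using True by (simp_all add: imb_def wt_def)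
    then show ?thesis using list_of_signing[OF assms, of "\<lambda>_. 1"] p True
      by (auto simp: signing_def product_one_def)
  next
    case False
    then obtain s where "good X s" using p by (auto simp: product_one_def)
    then show ?thesis using list_of_signing[OF assms, of s] False by (auto simp: good_def)
  qed
next
  assume "\<exists>xs. distinct xs \<and> set xs = X \<and> \<not> lpar xs \<and> int n dvd lval xs"
  then obtain xs where xs: "distinct xs" "set xs = X" "\<not> lpar xs" "int n dvd lval xs" by blast
  then obtain s where s: "signing s" "wt X s = lval xs" "imb X s = 0" using signing_of_list[OF xs(1)] by auto
  have g: "good X s" using s xs by (simp add: good_def)
  have l: "lval ys = sum_list (map val ys)" if "set ys \<inter> Rf = {}" for ys using that by (induction ys) auto
  show "product_one X"
  proof (cases "X \<inter> Rf = {}")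
    case True
    then have "lval xs = sum val X" using l[of xs] xs by (simp add: sum_list_distinct_conv_sum_set)
    then show ?thesis using True xs by (simp add: product_one_def)
  next
    case False then show ?thesis using g by (auto simp: product_one_def)
  qed
qed

end

section \<open>Normal forms in a dihedral group\<close>

locale dihedral = group G for G (structure) +
  fixes n :: nat and a b
  assumes n3: "n \<ge> 3" and odd_n: "odd n" and ordG: "order G = 2 * n"
    and ab: "a \<in> carrier G" "b \<in> carrier G" and gen: "generate G {a, b} = carrier G"
    and an: "a [^] n = \<one>" and b2: "b [^] (2 :: nat) = \<one>" and bab: "b \<otimes> a \<otimes> inv b = inv a"
begin

definition rp :: "int \<Rightarrow> bool \<Rightarrow> 'a" where "rp u r = a [^] u \<otimes> (if r then b else \<one>)"

lemma bb: "b \<otimes> b = \<one>" using b2 ab by (simp add: numeral_2_eq_2)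

lemma rp_closed [simp]: "rp u r \<in> carrier G" unfolding rp_def using ab by simp

lemma b_a: "b \<otimes> a = inv a \<otimes> b"
proof -
  have "b \<otimes> a = (b \<otimes> a \<otimes> inv b) \<otimes> b" using ab by (simp add: m_assoc)
  then show ?thesis using bab by simp
qed

lemma b_inv_a: "b \<otimes> inv a = a \<otimes> b"
proof -
  have "a \<otimes> (b \<otimes> a) = b" unfolding b_a using ab by (simp add: m_assoc[symmetric])
  then have "a \<otimes> b \<otimes> a = b" using ab by (simp add: m_assoc)
  then show ?thesis using ab by (metis inv_closed inv_solve_right m_closed)
qed

lemma b_pow_nat: "b \<otimes> a [^] (k :: nat) = inv a [^] k \<otimes> b"
proof (induction k)
  case 0 then show ?case using ab by simp
next
  case (Suc k)
  have "b \<otimes> a [^] Suc k = (b \<otimes> a [^] k) \<otimes> a" using ab by (simp add: m_assoc)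
  also have "\<dots> = inv a [^] k \<otimes> (b \<otimes> a)" unfolding Suc using ab by (simp add: m_assoc)
  also have "\<dots> = inv a [^] Suc k \<otimes> b" unfolding b_a using ab by (simp add: m_assoc)
  finally show ?case .
qed

lemma b_inv_pow_nat: "b \<otimes> inv a [^] (k :: nat) = a [^] k \<otimes> b"
proof (induction k)
  case 0 then show ?case using ab by simp
next
  case (Suc k)
  have "b \<otimes> inv a [^] Suc k = (b \<otimes> inv a [^] k) \<otimes> inv a" using ab by (simp add: m_assoc)
  also have "\<dots> = a [^] k \<otimes> (b \<otimes> inv a)" unfolding Suc using ab by (simp add: m_assoc)
  also have "\<dots> = a [^] Suc k \<otimes> b" unfolding b_inv_a using ab by (simp add: m_assoc)
  finally show ?case .
qed

lemma b_pow: "b \<otimes> a [^] (u :: int) = a [^] (- u) \<otimes> b"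
proof (cases "u \<ge> 0")
  case True
  then obtain k where k: "u = int k" by (metis nonneg_int_cases)
  have "a [^] (- int k) = inv a [^] k" using ab by (simp add: int_pow_neg_int nat_pow_inv)
  then show ?thesis unfolding k using b_pow_nat[of k] ab by (simp add: int_pow_int)
next
  case False
  then obtain k where k: "u = - int k" by (metis int_cases2 le_cases neg_0_le_iff_le of_nat_0_le_iff)
  have "a [^] (- int k) = inv a [^] k" using ab by (simp add: int_pow_neg_int nat_pow_inv)
  then show ?thesis unfolding k using b_inv_pow_nat[of k] ab by (simp add: int_pow_int)
qed

lemma rp_mult: "rp u r \<otimes> rp v q = rp (u + (if r then - v else v)) (r \<noteq> q)"
proof -
  have m: "a [^] (i + j :: int) = a [^] i \<otimes> a [^] j" for i j using ab by (simp add: int_pow_mult)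
  show ?thesis
  proof (cases r)
    case False
    then show ?thesis unfolding rp_def m using ab by (auto simp: m_assoc m)
  next
    case True
    have "a [^] u \<otimes> b \<otimes> (a [^] v \<otimes> (if q then b else \<one>)) = a [^] u \<otimes> (b \<otimes> a [^] v) \<otimes> (if q then b else \<one>)"
      using ab by (simp add: m_assoc)
    also have "\<dots> = (a [^] u \<otimes> a [^] (- v)) \<otimes> (b \<otimes> (if q then b else \<one>))"
      unfolding b_pow using ab by (simp add: m_assoc)
    also have "b \<otimes> (if q then b else \<one>) = (if True \<noteq> q then b else \<one>)" using bb ab by simp
    finally show ?thesis unfolding rp_def using True m[of u "- v"] by simp
  qed
qed

lemma rp_one: "rp 0 False = \<one>" unfolding rp_def by simp
lemma rp_a: "rp 1 False = a" unfolding rp_def using ab by (simp add: int_pow_1)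
lemma rp_b: "rp 0 True = b" unfolding rp_def using ab by simp

lemma pow_mod: "a [^] (u mod int n) = a [^] u"
proof -
  have "a [^] u = a [^] (int n * (u div int n) + u mod int n)" by simp
  also have "\<dots> = a [^] (int n * (u div int n)) \<otimes> a [^] (u mod int n)" using ab by (simp only: int_pow_mult)
  also have "a [^] (int n * (u div int n)) = (a [^] int n) [^] (u div int n)" using ab by (simp only: int_pow_pow)
  also have "a [^] int n = \<one>" using an by (simp add: int_pow_int)
  finally show ?thesis using ab by simp
qed

lemma rp_mod: "rp (u mod int n) r = rp u r" unfolding rp_def pow_mod ..

lemma rp_inv: "inv (rp u r) = rp (if r then u else - u) r"
proof -
  have "rp u r \<otimes> rp (if r then u else - u) r = \<one>" unfolding rp_mult using rp_one by simp
  then show ?thesis by (metis inv_equality inv_inv rp_closed inv_closed)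
qed

lemma ex_rp: "g \<in> carrier G \<Longrightarrow> \<exists>u r. g = rp u r"
proof -
  assume "g \<in> carrier G"
  then have "g \<in> generate G {a, b}" using gen by simp
  then show ?thesis
  proof induction
    case one then show ?case using rp_one by metis
  next
    case (incl h) then show ?case using rp_a rp_b by (metis empty_iff insert_iff)
  next
    case (inv h) then show ?case using rp_a rp_b rp_inv by (metis empty_iff insert_iff)
  next
    case (eng h1 h2) then show ?case using rp_mult by metis
  qed
qed

text \<open>There are \<open>2 * n\<close> normal forms up to reduction of the exponent; they
  exhaust a group of order \<open>2 * n\<close>, so they are distinct.\<close>

lemma rp_inj: "rp u r = rp v q \<longleftrightarrow> int n dvd u - v \<and> r = q"
proof -
  let ?D = "{0..<int n} \<times> (UNIV :: bool set)"
  have n0: "int n > 0" using n3 by simp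
  have "(\<lambda>(u, r). rp u r) ` ?D = carrier G"
  proof
    show "carrier G \<subseteq> (\<lambda>(u, r). rp u r) ` ?D"
    proof
      fix g assume "g \<in> carrier G"
      then obtain u r where "g = rp u r" using ex_rp by blast
      then have "g = (\<lambda>(u, r). rp u r) (u mod int n, r)" by (simp add: rp_mod)
      moreover have "(u mod int n, r) \<in> ?D" using n0 by simp
      ultimately show "g \<in> (\<lambda>(u, r). rp u r) ` ?D" by blast
    qed
  qed auto
  then have "card ((\<lambda>(u, r). rp u r) ` ?D) = card ?D" using ordG by (simp add: order_def card_cartesian_product)
  then have inj: "inj_on (\<lambda>(u, r). rp u r) ?D" by (intro eq_card_imp_inj_on) auto
  show ?thesis
  proof
    assume "rp u r = rp v q"
    then have "rp (u mod int n) r = rp (v mod int n) q" by (simp add: rp_mod)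
    then have "(u mod int n, r) = (v mod int n, q)"
      using inj_onD[OF inj, of "(u mod int n, r)" "(v mod int n, q)"] n0 by simp
    then show "int n dvd u - v \<and> r = q" by (simp add: mod_eq_dvd_iff)
  next
    assume "int n dvd u - v \<and> r = q"
    then have e: "u mod int n = v mod int n" "r = q" by (auto simp: mod_eq_dvd_iff)
    have "rp u r = rp (u mod int n) q" unfolding e(2) by (rule rp_mod[symmetric])
    also have "\<dots> = rp v q" unfolding e(1) by (rule rp_mod)
    finally show "rp u r = rp v q" .
  qed
qed

lemma foldr_rp:
  assumes "\<And>i. i \<in> set xs \<Longrightarrow> el i = rp (val i) (i \<in> Rf)"
  shows "foldr (\<otimes>) (map el xs) \<one> = rp (signed_index.lval val Rf xs) (signed_index.lpar Rf xs)"
proof -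
  interpret signed_index n val Rf by unfold_locales (rule odd_n)
  show ?thesis using assms
    by (induction xs) (simp_all add: rp_one rp_mult)
qed

lemma product_one_iff:
  assumes X: "finite X" and el: "\<And>i. i \<in> X \<Longrightarrow> el i = rp (val i) (i \<in> Rf)"
  shows "image_mset el (mset_set X) \<in> product_one_seqs G \<longleftrightarrow> signed_index.product_one n val Rf X"
proof -
  interpret signed_index n val Rf by unfold_locales (rule odd_n)
  have sub: "set_mset (image_mset el (mset_set X)) \<subseteq> carrier G" using el X by auto
  have fo: "foldr (\<otimes>) (map el xs) \<one> = \<one> \<longleftrightarrow> \<not> lpar xs \<and> int n dvd lval xs" if "set xs = X" for xs
  proof -
    have "foldr (\<otimes>) (map el xs) \<one> = rp (lval xs) (lpar xs)" by (rule foldr_rp) (use el that in blast)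
    then show ?thesis using rp_inj[of "lval xs" "lpar xs" 0 False] rp_one by auto
  qed
  have "(\<exists>ys. mset ys = image_mset el (mset_set X) \<and> foldr (\<otimes>) ys \<one> = \<one>)
     \<longleftrightarrow> (\<exists>xs. distinct xs \<and> set xs = X \<and> foldr (\<otimes>) (map el xs) \<one> = \<one>)"
  proof
    assume "\<exists>ys. mset ys = image_mset el (mset_set X) \<and> foldr (\<otimes>) ys \<one> = \<one>"
    then show "\<exists>xs. distinct xs \<and> set xs = X \<and> foldr (\<otimes>) (map el xs) \<one> = \<one>"
      using ex_index_list[OF X] by metis
  next
    assume "\<exists>xs. distinct xs \<and> set xs = X \<and> foldr (\<otimes>) (map el xs) \<one> = \<one>"
    then obtain xs where xs: "distinct xs" "set xs = X" "foldr (\<otimes>) (map el xs) \<one> = \<one>" by blast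
    have "mset (map el xs) = image_mset el (mset_set X)" using xs mset_set_set[of xs] by auto
    then show "\<exists>ys. mset ys = image_mset el (mset_set X) \<and> foldr (\<otimes>) ys \<one> = \<one>" using xs by blast
  qed
  then show ?thesis unfolding product_one_seqs_def product_one_iff_list[OF X] using sub fo by auto
qed

section \<open>Transfer between sequences over the group and index sets\<close>

definition vl :: "'a \<Rightarrow> int" where "vl g = (SOME u. \<exists>r. g = rp u r)"
definition rf :: "'a \<Rightarrow> bool" where "rf g = (SOME r. g = rp (vl g) r)"

lemma rp_vl_rf: "g \<in> carrier G \<Longrightarrow> g = rp (vl g) (rf g)"
proof -
  assume "g \<in> carrier G"
  then have "\<exists>u r. g = rp u r" by (rule ex_rp)
  then have "\<exists>r. g = rp (vl g) r" unfolding vl_def by (rule someI_ex)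
  then show ?thesis unfolding rf_def by (rule someI_ex)
qed

lemma atom_index:
  assumes S: "image_mset el (mset_set X) \<in> product_one_atoms G" and X: "finite X"
    and el: "\<And>i. i \<in> X \<Longrightarrow> el i = rp (val i) (i \<in> Rf)"
  shows "signed_index.atom n val Rf X"
proof -
  interpret signed_index n val Rf by unfold_locales (rule odd_n)
  have po: "image_mset el (mset_set B) \<in> product_one_seqs G \<longleftrightarrow> product_one B" if "B \<subseteq> X" for B
    by (rule product_one_iff) (use that X el in \<open>auto intro: finite_subset\<close>)
  show ?thesis unfolding atom_def
  proof (intro conjI allI impI)
    show "finite X" by (rule X)
    show "X \<noteq> {}" using S unfolding product_one_atoms_def by auto
    show "product_one X" using S po[of X] unfolding product_one_atoms_def by auto
    fix B assume B: "B \<subseteq> X" "B \<noteq> {}" "B \<noteq> X" "product_one B"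
    show "\<not> product_one (X - B)"
    proof
      assume "product_one (X - B)"
      then have h: "image_mset el (mset_set B) \<in> product_one_seqs G" "image_mset el (mset_set (X - B)) \<in> product_one_seqs G"
        using po[of B] po[of "X - B"] B by auto
      have fB: "finite B" "finite (X - B)" using X B by (auto intro: finite_subset)
      have "mset_set X = mset_set B + mset_set (X - B)"
        using mset_set_Union[OF fB] B by (simp add: Un_absorb1)
      then have "image_mset el (mset_set X) = image_mset el (mset_set B) + image_mset el (mset_set (X - B))" by simp
      moreover have "image_mset el (mset_set B) \<noteq> {#}" "image_mset el (mset_set (X - B)) \<noteq> {#}"
        using fB B by (auto simp: mset_set_empty_iff)
      ultimately show False using S h unfolding product_one_atoms_def by blast
    qed
  qed
qed

lemma atoms_carrier: "S \<in> product_one_atoms G \<Longrightarrow> set_mset S \<subseteq> carrier G"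
  unfolding product_one_atoms_def product_one_seqs_def by auto

lemma image_mset_nth: "image_mset ((!) xs) (mset_set {..<length xs}) = mset xs"
proof -
  have "image_mset ((!) xs) (mset_set {..<length xs}) = mset (map ((!) xs) [0..<length xs])"
    by (simp add: atLeast0LessThan[symmetric])
  then show ?thesis by (simp add: map_nth)
qed

lemma atom_size: "S \<in> product_one_atoms G \<Longrightarrow> size S \<le> 2 * n"
proof -
  assume S: "S \<in> product_one_atoms G"
  obtain xs where xs: "mset xs = S" using ex_mset by blast
  have "signed_index.atom n (\<lambda>i. vl (xs ! i)) {i. rf (xs ! i)} {..<length xs}"
  proof (rule atom_index[where el = "(!) xs"])
    show "image_mset ((!) xs) (mset_set {..<length xs}) \<in> product_one_atoms G" unfolding image_mset_nth xs by (rule S)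
    show "xs ! i = rp (vl (xs ! i)) (i \<in> {i. rf (xs ! i)})" if "i \<in> {..<length xs}" for i
    proof -
      have "xs ! i \<in> carrier G" using atoms_carrier[OF S] that xs by (metis lessThan_iff nth_mem set_mset_mset subsetD)
      then show ?thesis using rp_vl_rf by simp
    qed
  qed simp
  moreover have "signed_index n" by unfold_locales (rule odd_n)
  ultimately have "card {..<length xs} \<le> 2 * n" by (rule signed_index.atom_card_le[rotated])
  then show ?thesis using xs by auto
qed

text \<open>Terms are indexed by block number and position. This makes the blocks disjoint and turns
  \<open>S\<close> into a subset \<open>A\<close> of their union, to which
  \<open>small_cover\<close> applies.\<close>

lemma omega_upper:
  assumes S: "S \<in> product_one_atoms G"
  shows "omega_elem G S \<le> enat (2 * n)"
  unfolding omega_elem_def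
proof (rule Least_le, intro allI impI)
  fix k :: nat and As :: "nat \<Rightarrow> 'a multiset"
  assume As: "\<forall>i\<in>{1..k}. As i \<in> product_one_seqs G" and dv: "seq_divides G S (\<Sum>i\<in>{1..k}. As i)"
  define ls where "ls i = (SOME xs. mset xs = As i)" for i
  have ls: "mset (ls i) = As i" for i unfolding ls_def using ex_mset by (rule someI_ex)
  define el where "el p = ls (fst p) ! snd p" for p
  define Bl where "Bl i = {i} \<times> {..<length (ls i)}" for i
  define val where "val p = vl (el p)" for p
  define Rf where "Rf = {p. rf (el p)}"
  have fBl: "finite (Bl i)" for i unfolding Bl_def by simp
  have imBl: "image_mset el (mset_set (Bl i)) = As i" for i
  proof -
    have "mset_set (Bl i) = image_mset (Pair i) (mset_set {..<length (ls i)})"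
    proof -
      have "Bl i = Pair i ` {..<length (ls i)}" unfolding Bl_def by auto
      then show ?thesis by (simp add: image_mset_mset_set inj_on_def)
    qed
    then have "image_mset el (mset_set (Bl i)) = image_mset ((!) (ls i)) (mset_set {..<length (ls i)})"
      by (simp add: multiset.map_comp comp_def el_def)
    then show ?thesis unfolding image_mset_nth ls .
  qed
  have imU: "image_mset el (mset_set (\<Union>(Bl ` Om))) = (\<Sum>i\<in>Om. As i)" if "finite Om" for Om
    using that
  proof (induction Om rule: finite_induct)
    case (insert i Om)
    have d: "Bl i \<inter> \<Union>(Bl ` Om) = {}" using insert.hyps unfolding Bl_def by auto
    have f: "finite (\<Union>(Bl ` Om))" using insert.hyps fBl by auto
    show ?case using mset_set_Union[OF fBl f d] insert imBl by simp
  qed simp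
  let ?K = "{1..k}"
  have fE: "finite (\<Union>(Bl ` ?K))" using fBl by auto
  have el: "el p = rp (val p) (p \<in> Rf)" if p: "p \<in> \<Union>(Bl ` ?K)" for p
  proof -
    obtain i where i: "i \<in> ?K" "p \<in> Bl i" using p by blast
    have "el p \<in># As i" unfolding imBl[symmetric] using i fBl by auto
    then have "el p \<in> carrier G" using As i unfolding product_one_seqs_def by auto
    then show ?thesis unfolding val_def Rf_def using rp_vl_rf by simp
  qed
  obtain C where C: "C \<in> product_one_seqs G" "(\<Sum>i\<in>?K. As i) = S + C" using dv unfolding seq_divides_def by blast
  have "S \<subseteq># image_mset el (mset_set (\<Union>(Bl ` ?K)))" unfolding imU[OF finite_atLeastAtMost] C(2) by simp
  then obtain A where A: "A \<subseteq> \<Union>(Bl ` ?K)" "image_mset el (mset_set A) = S" using ex_index_subset[OF fE] by blast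
  have fA: "finite A" using A fE finite_subset by blast
  have comp: "(\<Sum>i\<in>Om. As i) = S + image_mset el (mset_set (\<Union>(Bl ` Om) - A))"
    if "finite Om" "A \<subseteq> \<Union>(Bl ` Om)" for Om
  proof -
    have f: "finite (\<Union>(Bl ` Om) - A)" using that fBl by auto
    have "mset_set (\<Union>(Bl ` Om)) = mset_set A + mset_set (\<Union>(Bl ` Om) - A)"
      using mset_set_Union[OF fA f] that(2) by (simp add: Un_absorb1)
    then show ?thesis using imU[OF that(1)] A(2) by (metis image_mset_union)
  qed
  have C': "image_mset el (mset_set (\<Union>(Bl ` ?K) - A)) = C" using comp[OF finite_atLeastAtMost A(1)] C(2) by simp
  have po: "image_mset el (mset_set B) \<in> product_one_seqs G \<longleftrightarrow> signed_index.product_one n val Rf B" if "B \<subseteq> \<Union>(Bl ` ?K)" for B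
  proof (rule product_one_iff)
    show "finite B" by (rule finite_subset[OF that fE])
    show "el p = rp (val p) (p \<in> Rf)" if "p \<in> B" for p by (rule el) (use that \<open>B \<subseteq> \<Union>(Bl ` ?K)\<close> in blast)
  qed
  have "signed_index n" by unfold_locales (rule odd_n)
  then interpret atom_cover n val Rf ?K Bl A
  proof (intro atom_cover.intro atom_cover_axioms.intro)
    show "Bl i \<inter> Bl j = {}" if "i \<noteq> j" for i j using that unfolding Bl_def by auto
    show "signed_index.product_one n val Rf (Bl j)" if j: "j \<in> ?K" for j
    proof -
      have "Bl j \<subseteq> \<Union>(Bl ` ?K)" using j by blast
      moreover have "As j \<in> product_one_seqs G" using As j by blast
      ultimately show ?thesis using po[of "Bl j"] imBl[of j] by simp
    qed
    show "signed_index.atom n val Rf A"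
    proof (rule atom_index[OF _ fA])
      show "image_mset el (mset_set A) \<in> product_one_atoms G" unfolding A(2) by (rule S)
      show "el p = rp (val p) (p \<in> Rf)" if "p \<in> A" for p by (rule el) (use that A(1) in blast)
    qed
    show "signed_index.product_one n val Rf (\<Union>(Bl ` ?K) - A)" using po[of "\<Union>(Bl ` ?K) - A"] C' C by auto
  qed (use A fBl in auto)
  obtain Om where Om: "Om \<subseteq> ?K" "card Om \<le> 2 * n" "A \<subseteq> \<Union>(Bl ` Om)" "product_one (\<Union>(Bl ` Om) - A)"
    using small_cover by blast
  have fOm: "finite Om" using Om finite_subset by blast
  have "image_mset el (mset_set (\<Union>(Bl ` Om) - A)) \<in> product_one_seqs G"
    using po[of "\<Union>(Bl ` Om) - A"] Om by blast
  then have "seq_divides G S (\<Sum>i\<in>Om. As i)" unfolding seq_divides_def using comp[OF fOm Om(3)] by blast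
  then show "\<exists>\<Omega>\<subseteq>{1..k}. enat (card \<Omega>) \<le> enat (2 * n) \<and> seq_divides G S (\<Sum>i\<in>\<Omega>. As i)"
    using Om by auto
qed

section \<open>The extremal atom and the lower bounds\<close>

definition S0 :: "'a multiset" where "S0 = replicate_mset (2 * n - 2) a + {#b, b#}"

lemma foldr_append_mult: "set xs \<subseteq> carrier G \<Longrightarrow> set ys \<subseteq> carrier G \<Longrightarrow>
    foldr (\<otimes>) (xs @ ys) \<one> = foldr (\<otimes>) xs \<one> \<otimes> foldr (\<otimes>) ys \<one>"
proof (induction xs)
  case Nil
  have "foldr (\<otimes>) zs \<one> \<in> carrier G" if "set zs \<subseteq> carrier G" for zs using that by (induction zs) auto
  then show ?case using Nil by simp
next
  case (Cons x xs)
  have "foldr (\<otimes>) zs \<one> \<in> carrier G" if "set zs \<subseteq> carrier G" for zs using that by (induction zs) auto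
  then show ?case using Cons by (simp add: m_assoc)
qed

lemma foldr_replicate: "foldr (\<otimes>) (replicate k (rp u False)) \<one> = rp (int k * u) False"
  by (induction k) (simp_all add: rp_one rp_mult algebra_simps)

text \<open>It is product-one in the order \<open>a^(n-1) b a^(n-1) b\<close>. In a splitting both
  parts have an even number of reflections, so one part has none; it then consists of
  \<open>n\<close> copies of \<open>a\<close> and leaves \<open>a^(n-2) b^2\<close>. But a signed
  sum of \<open>n - 2\<close> ones is odd and less than \<open>n\<close> in absolute value, hence
  not 0 modulo \<open>n\<close>.\<close>

lemma S0_atom: "S0 \<in> product_one_atoms G"
proof -
  define val :: "nat \<Rightarrow> int" where "val i = (if i < 2 * n - 2 then 1 else 0)" for i
  define Rf where "Rf = {2 * n - 2, 2 * n - 1}"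
  define el where "el i = (if i < 2 * n - 2 then a else b)" for i
  interpret signed_index n val Rf by unfold_locales (rule odd_n)
  have el: "el i = rp (val i) (i \<in> Rf)" if "i \<in> {..<2 * n}" for i
  proof -
    have "i \<in> Rf \<longleftrightarrow> \<not> i < 2 * n - 2" using that n3 unfolding Rf_def by auto
    then show ?thesis unfolding el_def val_def by (simp add: rp_a rp_b)
  qed
  have im: "image_mset el (mset_set {..<2 * n}) = S0"
  proof -
    have e: "{..<2 * n} = {..<2 * n - 2} \<union> {2 * n - 2, 2 * n - 1}" using n3 by auto
    have "mset_set {..<2 * n} = mset_set {..<2 * n - 2} + mset_set {2 * n - 2, 2 * n - 1}"
      unfolding e by (rule mset_set_Union) auto
    moreover have "image_mset el (mset_set {..<2 * n - 2}) = image_mset (\<lambda>_. a) (mset_set {..<2 * n - 2})"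
      by (rule image_mset_cong) (simp add: el_def)
    moreover have "image_mset el (mset_set {2 * n - 2, 2 * n - 1}) = {#b, b#}"
    proof -
      have "2 * n - 2 \<noteq> 2 * n - 1" "\<not> 2 * n - 1 < 2 * n - 2" using n3 by simp_all
      then show ?thesis by (simp add: el_def)
    qed
    ultimately show ?thesis unfolding S0_def by (simp add: image_mset_const_eq)
  qed
  have po: "image_mset el (mset_set B) \<in> product_one_seqs G \<longleftrightarrow> product_one B" if "B \<subseteq> {..<2 * n}" for B
    by (rule product_one_iff) (use that el in \<open>auto intro: finite_subset\<close>)
  have no_split: False if X: "X \<subseteq> {..<2 * n}" "X \<noteq> {}" "X \<inter> Rf = {}" "product_one X" "product_one ({..<2 * n} - X)" for X
  proof -
    have fX: "finite X" using X finite_subset by blast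
    have Xs: "X \<subseteq> {..<2 * n - 2}"
    proof
      fix i assume "i \<in> X"
      then have "i < 2 * n" "i \<noteq> 2 * n - 2" "i \<noteq> 2 * n - 1" using X(1,3) unfolding Rf_def by auto
      then show "i \<in> {..<2 * n - 2}" by simp
    qed
    have "sum val X = (\<Sum>i\<in>X. 1)" by (rule sum.cong) (use Xs in \<open>auto simp: val_def\<close>)
    then have "int n dvd int (card X)" using X by (simp add: product_one_def)
    then have "n dvd card X" by simp
    moreover have "card X > 0" using X fX by (simp add: card_gt_0_iff)
    moreover have "card X \<le> 2 * n - 2" using card_mono[OF _ Xs] by simp
    ultimately have cX: "card X = n"
    proof -
      assume "n dvd card X" "card X > 0" "card X \<le> 2 * n - 2"
      then obtain q where q: "card X = n * q" by (elim dvdE)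
      have "q \<noteq> 0" using q \<open>card X > 0\<close> by auto
      moreover have "q < 2"
      proof (rule ccontr)
        assume "\<not> q < 2"
        then have "n * 2 \<le> n * q" by simp
        then show False using q \<open>card X \<le> 2 * n - 2\<close> n3 by linarith
      qed
      ultimately have "q = 1" by simp
      then show ?thesis using q by simp
    qed
    let ?Z = "{..<2 * n - 2} - X"
    have cZ: "card ?Z = n - 2" using Xs fX cX by (simp add: card_Diff_subset)
    have "{..<2 * n} - X = ?Z \<union> Rf"
    proof -
      have "{..<2 * n} = {..<2 * n - 2} \<union> Rf" using n3 unfolding Rf_def by auto
      then show ?thesis using X(3) by blast
    qed
    moreover obtain s where s: "good ({..<2 * n} - X) s" using X(5) product_one_good by blast
    ultimately have "int n dvd wt (?Z \<union> Rf) s" by (simp add: good_def)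
    moreover have "wt (?Z \<union> Rf) s = wt ?Z s + wt Rf s" by (rule wt_Un) (auto simp: Rf_def)
    moreover have "wt Rf s = 0" unfolding wt_def by (rule sum.neutral) (auto simp: Rf_def val_def)
    moreover have "wt ?Z s = sum s ?Z" unfolding wt_def by (rule sum.cong) (auto simp: val_def)
    ultimately have dv: "int n dvd sum s ?Z" by simp
    have sg: "signing s" using s by (simp add: good_def)
    have ab: "\<bar>sum s W\<bar> \<le> int (card W)" if "finite W" for W :: "nat set"
    proof -
      have "\<bar>sum s W\<bar> \<le> (\<Sum>i\<in>W. \<bar>s i\<bar>)" by (rule sum_abs)
      also have "\<dots> \<le> (\<Sum>i\<in>W. 1)" 
      proof (rule sum_mono)
        fix i show "\<bar>s i\<bar> \<le> 1" using signingD[OF sg, of i] by auto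
      qed
      finally show ?thesis by simp
    qed
    have ev: "even (sum s W) \<longleftrightarrow> even (card W)" if "finite W" for W :: "nat set"
      using that
    proof (induction W rule: finite_induct)
      case (insert x W)
      then show ?case using signingD[OF sg, of x] by auto
    qed simp
    have "odd (n - 2)" using odd_n n3 by simp
    then have "sum s ?Z \<noteq> 0" using ev[of ?Z] cZ by auto
    then have "int n \<le> \<bar>sum s ?Z\<bar>" using dvd_imp_le_int[OF _ dv] by simp
    then show False using ab[of ?Z] cZ n3 by simp
  qed
  have "product_one {..<2 * n}"
  proof -
    have "foldr (\<otimes>) (replicate k a @ [b] @ replicate k a @ [b]) \<one> = \<one>" for k
    proof -
      have r: "foldr (\<otimes>) (replicate k a) \<one> = rp (int k) False"
        using foldr_replicate[of k 1] rp_a by simp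
      have f: "foldr (\<otimes>) (replicate k a @ zs) \<one> = rp (int k) False \<otimes> foldr (\<otimes>) zs \<one>"
        if "set zs \<subseteq> carrier G" for zs
        unfolding r[symmetric] by (rule foldr_append_mult) (use ab that in auto)
      have "foldr (\<otimes>) (replicate k a @ [b] @ replicate k a @ [b]) \<one>
          = rp (int k) False \<otimes> (b \<otimes> (rp (int k) False \<otimes> (b \<otimes> \<one>)))"
      proof -
        have "set [b] \<subseteq> carrier G" "set ([b] @ replicate k a @ [b]) \<subseteq> carrier G" using ab by auto
        note this[THEN f]
        moreover have "foldr (\<otimes>) ([b] @ zs) \<one> = b \<otimes> foldr (\<otimes>) zs \<one>" for zs by simp
        ultimately show ?thesis by simp
      qed
      also have "\<dots> = \<one>"
      proof -
        have "rp u False \<otimes> (rp 0 True \<otimes> (rp u False \<otimes> (rp 0 True \<otimes> \<one>))) = \<one>" for u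
          by (simp add: rp_mult rp_one)
        then show ?thesis unfolding rp_b .
      qed
      finally show ?thesis .
    qed
    moreover have "mset (replicate (n - 1) a @ [b] @ replicate (n - 1) a @ [b]) = S0"
    proof -
      show ?thesis unfolding S0_def by (rule multiset_eqI) (use n3 in auto)
    qed
    moreover have "set_mset S0 \<subseteq> carrier G" unfolding S0_def using ab by auto
    ultimately have "S0 \<in> product_one_seqs G" unfolding product_one_seqs_def by blast
    then show ?thesis using po[of "{..<2 * n}"] im by simp
  qed
  then have S0p: "S0 \<in> product_one_seqs G" using po[of "{..<2 * n}"] im by simp
  have ind: "\<not> (A \<noteq> {#} \<and> B \<noteq> {#} \<and> S0 = A + B)" if AB: "A \<in> product_one_seqs G" "B \<in> product_one_seqs G" for A B
  proof
    assume h: "A \<noteq> {#} \<and> B \<noteq> {#} \<and> S0 = A + B"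
    then have "A \<subseteq># image_mset el (mset_set {..<2 * n})" unfolding im by simp
    then obtain X where X: "X \<subseteq> {..<2 * n}" "image_mset el (mset_set X) = A" using ex_index_subset[of "{..<2 * n}"] by blast
    have fX: "finite X" "finite ({..<2 * n} - X)" using X finite_subset by auto
    have "mset_set {..<2 * n} = mset_set X + mset_set ({..<2 * n} - X)"
      using mset_set_Union[OF fX] X(1) by (simp add: Un_absorb1)
    then have XB: "image_mset el (mset_set ({..<2 * n} - X)) = B" using h X(2) im by (metis add_left_imp_eq image_mset_union)
    have p: "product_one X" "product_one ({..<2 * n} - X)" using po[of X] po[of "{..<2 * n} - X"] X XB AB by auto
    have ne: "X \<noteq> {}" "{..<2 * n} - X \<noteq> {}"
      using h X(2) XB by (metis image_mset_empty mset_set.empty)+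
    obtain s where "good X s" using p product_one_good by blast
    then have "even (card (X \<inter> Rf))" using even_card_good fX by blast
    moreover have "card Rf = 2" unfolding Rf_def using n3 by simp
    moreover have "card (X \<inter> Rf) \<le> card Rf" by (rule card_mono) (auto simp: Rf_def)
    ultimately have "card (X \<inter> Rf) = 0 \<or> card (X \<inter> Rf) = card Rf" by presburger
    then have "X \<inter> Rf = {} \<or> Rf \<subseteq> X"
    proof
      assume "card (X \<inter> Rf) = card Rf"
      then have "X \<inter> Rf = Rf" by (intro card_subset_eq) (auto simp: Rf_def)
      then show ?thesis by blast
    qed (use fX in simp)
    then show False
    proof
      assume "X \<inter> Rf = {}" then show False using no_split[OF X(1)] ne p by blast
    next
      assume "Rf \<subseteq> X"
      then have "({..<2 * n} - X) \<inter> Rf = {}" by blast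
      moreover have "{..<2 * n} - ({..<2 * n} - X) = X" using X(1) by blast
      ultimately show False using no_split[of "{..<2 * n} - X"] ne p by auto
    qed
  qed
  show ?thesis unfolding product_one_atoms_def using S0p ind by (auto simp: S0_def)
qed

lemma size_S0: "size S0 = 2 * n" unfolding S0_def using n3 by simp

lemma davenport: "large_davenport G = 2 * n"
  unfolding large_davenport_def
proof (rule Max_eqI)
  show "finite (size ` product_one_atoms G)" by (rule finite_subset[of _ "{..2 * n}"]) (use atom_size in auto)
  show "y \<le> 2 * n" if "y \<in> size ` product_one_atoms G" for y using that atom_size by auto
  show "2 * n \<in> size ` product_one_atoms G" using S0_atom size_S0 by (metis imageI)
qed

text \<open>Each of the \<open>2 * n\<close> blocks of the witness contains exactly one term of
  \<open>S0\<close>, so none can be spared. A block with two copies of \<open>b\<close> would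
  provide both reflections at once; therefore \<open>b\<close> is completed to a product-one block
  by \<open>a b\<close> and the inverse of \<open>a\<close>.\<close>

lemma omega_lower: "enat (2 * n) \<le> omega_elem G S0"
proof -
  let ?P = "\<lambda>N :: enat. \<forall>k \<ge> (1::nat). \<forall>As :: nat \<Rightarrow> 'a multiset.
       (\<forall>i \<in> {1..k}. As i \<in> product_one_seqs G) \<longrightarrow>
       seq_divides G S0 (\<Sum>i \<in> {1..k}. As i) \<longrightarrow>
       (\<exists>\<Omega> \<subseteq> {1..k}. enat (card \<Omega>) \<le> N \<and> seq_divides G S0 (\<Sum>i \<in> \<Omega>. As i))"
  \<comment> \<open>This makes \<open>LeastI\<close> applicable, so \<open>omega_elem G S0\<close>
    itself has the defining property and can be tested on the witness.\<close>
  have "?P \<infinity>" by auto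
  then have P: "?P (omega_elem G S0)" unfolding omega_elem_def by (rule LeastI)
  have inv_a: "inv a = rp (-1) False" using rp_inv[of 1 False] rp_a by simp
  have a_b: "a \<otimes> b = rp 1 True" using rp_mult[of 1 False 0 True] rp_a rp_b by simp
  have n1: "\<not> int n dvd 1" "\<not> int n dvd 2" "\<not> int n dvd -1"
    using n3 zdvd_imp_le[of "int n" 1] zdvd_imp_le[of "int n" 2] by auto
  have neq: "a \<noteq> inv a" "a \<noteq> b" "a \<noteq> a \<otimes> b" "b \<noteq> a \<otimes> b" "b \<noteq> inv a"
    using rp_inj[of 1 False "-1" False] rp_inj[of 1 False 0 True] rp_inj[of 1 False 1 True] rp_inj[of 0 True 1 True]
      rp_inj[of 0 True "-1" False] n1 unfolding inv_a a_b rp_a rp_b by auto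
  define As where "As i = (if i \<le> 2 * n - 2 then {#a, inv a#} else {#b, a \<otimes> b, inv a#})" for i
  have pairs: "{#a, inv a#} \<in> product_one_seqs G" unfolding product_one_seqs_def
    using ab by (auto intro!: exI[of _ "[a, inv a]"])
  have "foldr (\<otimes>) [a \<otimes> b, b, inv a] \<one> = \<one>"
  proof -
    have "rp 1 True \<otimes> (rp 0 True \<otimes> rp (-1) False) = \<one>" by (simp add: rp_mult rp_one)
    then show ?thesis unfolding rp_b a_b inv_a by simp
  qed
  then have triples: "{#b, a \<otimes> b, inv a#} \<in> product_one_seqs G" unfolding product_one_seqs_def
    using ab by (auto intro!: exI[of _ "[a \<otimes> b, b, inv a]"])
  have As: "\<forall>i\<in>{1..2 * n}. As i \<in> product_one_seqs G" unfolding As_def using pairs triples by auto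
  define C where "C = replicate_mset (2 * n) (inv a) + {#a \<otimes> b, a \<otimes> b#}"
  have Cp: "C \<in> product_one_seqs G"
  proof -
    have "foldr (\<otimes>) (replicate (2 * n) (inv a) @ [a \<otimes> b, a \<otimes> b]) \<one> = rp (int (2 * n) * -1) False \<otimes> (rp 1 True \<otimes> (rp 1 True \<otimes> \<one>))"
      using ab foldr_replicate[of "2 * n" "-1"] unfolding inv_a a_b by (subst foldr_append_mult) auto
    also have "\<dots> = rp (int (2 * n) * -1) False" unfolding rp_one[symmetric] rp_mult by simp
    also have "\<dots> = \<one>" unfolding rp_one[symmetric] rp_inj by simp
    finally show ?thesis unfolding product_one_seqs_def C_def
      using ab by (auto intro!: exI[of _ "replicate (2 * n) (inv a) @ [a \<otimes> b, a \<otimes> b]"])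
  qed
  have tot: "(\<Sum>i\<in>{1..2 * n}. As i) = S0 + C"
  proof -
    have e: "{1..2 * n} = {1..2 * n - 2} \<union> {2 * n - 1, 2 * n}" using n3 by auto
    have "(\<Sum>i\<in>{1..2 * n}. As i) = (\<Sum>i\<in>{1..2 * n - 2}. As i) + (\<Sum>i\<in>{2 * n - 1, 2 * n}. As i)"
      unfolding e by (rule sum.union_disjoint) (use n3 in auto)
    also have "(\<Sum>i\<in>{1..2 * n - 2}. As i) = (\<Sum>i\<in>{1..2 * n - 2}. {#a, inv a#})"
      by (rule sum.cong) (auto simp: As_def)
    also have "\<dots> = replicate_mset (2 * n - 2) a + replicate_mset (2 * n - 2) (inv a)"
    proof -
      have "(\<Sum>i\<in>{1..m}. {#a, inv a#}) = replicate_mset m a + replicate_mset m (inv a)" for m :: nat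
        by (induction m) auto
      then show ?thesis .
    qed
    also have "(\<Sum>i\<in>{2 * n - 1, 2 * n}. As i) = {#b, a \<otimes> b, inv a#} + {#b, a \<otimes> b, inv a#}"
    proof -
      have "2 * n - 1 \<noteq> 2 * n" "\<not> 2 * n - 1 \<le> 2 * n - 2" "\<not> 2 * n \<le> 2 * n - 2" using n3 by auto
      then show ?thesis by (simp add: As_def)
    qed
    also have "replicate_mset (2 * n - 2) a + replicate_mset (2 * n - 2) (inv a) + ({#b, a \<otimes> b, inv a#} + {#b, a \<otimes> b, inv a#}) = S0 + C"
    proof -
      have "replicate_mset (2 * n) (inv a) = replicate_mset (2 * n - 2) (inv a) + replicate_mset 2 (inv a)"
        by (rule multiset_eqI) (use n3 in auto)
      then show ?thesis unfolding S0_def C_def by (simp add: numeral_2_eq_2)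
    qed
    finally show ?thesis .
  qed
  have "seq_divides G S0 (\<Sum>i\<in>{1..2 * n}. As i)" unfolding seq_divides_def using tot Cp by blast
  then obtain Om where Om: "Om \<subseteq> {1..2 * n}" "enat (card Om) \<le> omega_elem G S0" "seq_divides G S0 (\<Sum>i\<in>Om. As i)"
    using P[rule_format, of "2 * n" As] As n3 by auto
  have fOm: "finite Om" using Om finite_subset by blast
  have cnt: "count S0 x \<le> (\<Sum>i\<in>Om. count (As i) x)" for x
  proof -
    obtain D where "(\<Sum>i\<in>Om. As i) = S0 + D" using Om(3) unfolding seq_divides_def by blast
    then have "count (\<Sum>i\<in>Om. As i) x = count S0 x + count D x" by simp
    then show ?thesis by (simp add: count_sum)
  qed
  let ?L = "{i \<in> Om. i \<le> 2 * n - 2}" and ?H = "{i \<in> Om. \<not> i \<le> 2 * n - 2}"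
  have sum_ind: "(\<Sum>i\<in>Om. if Q i then 1 else 0) = card {i \<in> Om. Q i}" for Q
    using fOm by (simp add: sum.If_cases Int_def)
  have "count (As i) a = (if i \<le> 2 * n - 2 then 1 else 0)" for i using neq unfolding As_def by auto
  then have "2 * n - 2 \<le> card ?L" using cnt[of a] neq sum_ind[of "\<lambda>i. i \<le> 2 * n - 2"] unfolding S0_def by simp
  moreover have "count (As i) b = (if \<not> i \<le> 2 * n - 2 then 1 else 0)" for i using neq unfolding As_def by auto
  then have "2 \<le> card ?H" using cnt[of b] neq sum_ind[of "\<lambda>i. \<not> i \<le> 2 * n - 2"] unfolding S0_def by simp
  moreover have "card Om = card ?L + card ?H"
  proof -
    have "Om = ?L \<union> ?H" by auto
    moreover have "card (?L \<union> ?H) = card ?L + card ?H" by (rule card_Un_disjoint) (use fOm in auto)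
    ultimately show ?thesis by simp
  qed
  ultimately have "2 * n \<le> card Om" by linarith
  then show ?thesis using Om(2) by (meson enat_ord_simps(1) order_trans)
qed

lemma omega_eq: "omega G = enat (2 * n)"
  unfolding omega_def
proof (rule antisym)
  show "(SUP A\<in>product_one_atoms G. omega_elem G A) \<le> enat (2 * n)" by (rule SUP_least) (rule omega_upper)
  show "enat (2 * n) \<le> (SUP A\<in>product_one_atoms G. omega_elem G A)" by (rule SUP_upper2[where i = S0]) (rule S0_atom, rule omega_lower)
qed

end

theorem theorem4p1:
  fixes G :: "('a, 'b) monoid_scheme" and n :: nat
  assumes "n \<ge> 3" and "odd n" and "dihedral_group G n"
  shows "omega G = enat (large_davenport G) \<and> large_davenport G = 2 * n"
proof -
  obtain a b where h: "group G" "order G = 2 * n" "a \<in> carrier G" "b \<in> carrier G"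
    "generate G {a, b} = carrier G" "a [^]\<^bsub>G\<^esub> n = \<one>\<^bsub>G\<^esub>" "b [^]\<^bsub>G\<^esub> (2::nat) = \<one>\<^bsub>G\<^esub>"
    "b \<otimes>\<^bsub>G\<^esub> a \<otimes>\<^bsub>G\<^esub> inv\<^bsub>G\<^esub> b = inv\<^bsub>G\<^esub> a"
    using assms(3) unfolding dihedral_group_def by blast
  interpret dihedral G n a b
    by (intro dihedral.intro dihedral_axioms.intro) (use h assms in auto)
  show ?thesis using omega_eq davenport by simp
qed

end
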